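(* Let $f\in\Lambda_p$, $1<p<\infty$, $\alpha_i>0$, $n_i\in\mathbb{N}$, $i=1,2$. Then $$\omega_{\alpha_1,\alpha_2}\Big(f,\frac1{n_1},\frac1{n_2}\Big)_{L_p(\mathbb{T}^2)}\asymp\frac1{n_1^{\alpha_1}}\frac1{n_2^{\alpha_2}}\Big\{\sum_{\nu_1=1}^{n_1+1}\sum_{\nu_2=1}^{n_2+1}\nu_1^{2\alpha_1-1}\nu_2^{2\alpha_2-1}\,Y^2_{\nu_1-1,\nu_2-1}(f)_{L_p(\mathbb{T}^2)}\Big\}^{1/2}.$$
   Context: $L_p(\mathbb{T}^2)$, $1<p<\infty$, is the space of measurable functions $f(x,y)$ that are $2\pi$-periodic in each variable with $\|f\|_{L_p(\mathbb{T}^2)}=\big(\int_0^{2\pi}\int_0^{2\pi}|f(x,y)|^p\,dx\,dy\big)^{1/p}<\infty$; $L_p^0(\mathbb{T}^2)$ is the set of $f\in L_p(\mathbb{T}^2)$ with $\int_0^{2\pi}f(x,y)\,dy=0$ for a.e. $x$ and $\int_0^{2\pi}f(x,y)\,dx=0$ for a.e. $y$. $\mathbb{N}=\{1,2,\ldots\}$. The class $\Lambda_p$, $1<p<\infty$, is the set of $f\in L_p^0(\mathbb{T}^2)$ whose Fourier series is $\sum_{\mu_1=0}^\infty\sum_{\mu_2=0}^\infty\lambda_{\mu_1,\mu_2}\cos2^{\mu_1}x\cos2^{\mu_2}y$ with $\lambda_{\mu_1,\mu_2}\in\mathbb{R}$. For $\alpha_1,\alpha_2>0$ the (fractional) differences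 are $\Delta_{h_1}^{\alpha_1}(f)=\sum_{\nu=0}^\infty(-1)^\nu\binom{\alpha_1}{\nu}f(x+(\alpha_1-\nu)h_1,y)$ and $\Delta_{h_2}^{\alpha_2}(f)=\sum_{\nu=0}^\infty(-1)^\nu\binom{\alpha_2}{\nu}f(x,y+(\alpha_2-\nu)h_2)$, where $\binom{\alpha}{0}=1$, $\binom{\alpha}{\nu}=\frac{\alpha(\alpha-1)\cdots(\alpha-\nu+1)}{\nu!}$ for $\nu\ge1$. The mixed modulus of smoothness is $\omega_{\alpha_1,\alpha_2}(f,\delta_1,\delta_2)_{L_p(\mathbb{T}^2)}=\sup_{|h_i|\le\delta_i,\,i=1,2}\|\Delta_{h_1}^{\alpha_1}(\Delta_{h_2}^{\alpha_2}(f))\|_{L_p(\mathbb{T}^2)}$. The best angular approximation is $Y_{m_1,m_2}(f)_{L_p(\mathbb{T}^2)}=\inf\|f-T_{m_1,\infty}-T_{\infty,m_2}\|_{L_p(\mathbb{T}^2)}$, the infimum over all $T_{m_1,\infty},T_{\infty,m_2}\in L_p(\mathbb{T}^2)$ such that $T_{m_1,\infty}$ is a trigonometric polynomial of degree at most $m_1$ in $x$ (with coefficients depending on $y$) and $T_{\infty,m_2}$ is a trigonometric polynomial of degree at most $m_2$ in $y$ (with coefficients depending on $x$); $Y^s$ denotes its $s$-th power. $A\asymp B$ means $C^{-1}B\le A\le CB$ with a constant $C>0$ independent of $f,n_1,n_2$ ($C$ may depend on $p,\alpha_1,\alpha_2$). *)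

theory Defs
  imports "HOL-Analysis.Analysis"
begin

definition torus :: "(real \<times> real) set" where
  "torus = {0..2 * pi} \<times> {0..2 * pi}"

text \<open>The space \<open>L\<^sub>p\<close> of the torus consists of actual functions, periodic at every point; functions that
  agree almost everywhere are not identified.\<close>

definition Lp_torus :: "real \<Rightarrow> (real \<times> real \<Rightarrow> real) set" where
  "Lp_torus p = {f. f \<in> borel_measurable lebesgue \<and>
     (\<forall>x y. f (x + 2 * pi, y) = f (x, y) \<and> f (x, y + 2 * pi) = f (x, y)) \<and>
     set_integrable lebesgue torus (\<lambda>z. \<bar>f z\<bar> powr p)}"

definition Lp_norm :: "real \<Rightarrow> (real \<times> real \<Rightarrow> real) \<Rightarrow> real" where
  "Lp_norm p f = (LINT z:torus|lebesgue. \<bar>f z\<bar> powr p) powr (1 / p)"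

definition Lp0_torus :: "real \<Rightarrow> (real \<times> real \<Rightarrow> real) set" where
  "Lp0_torus p = {f \<in> Lp_torus p.
     (AE x in lebesgue. (LINT y:{0..2 * pi}|lebesgue. f (x, y)) = 0) \<and>
     (AE y in lebesgue. (LINT x:{0..2 * pi}|lebesgue. f (x, y)) = 0)}"

text \<open>The coefficient of \<open>u (k x) v (l y)\<close> in the Fourier series of \<open>f\<close>, where each of \<open>u\<close> and \<open>v\<close>
  is \<open>cos\<close> or \<open>sin\<close>. The mean square of \<open>cos (k x)\<close> over a period is \<open>1\<close> if \<open>k = 0\<close> and \<open>1/2\<close>
  otherwise, which explains the normalisation.\<close>

definition fourier_coeff ::
  "(real \<Rightarrow> real) \<Rightarrow> (real \<Rightarrow> real) \<Rightarrow> (real \<times> real \<Rightarrow> real) \<Rightarrow> nat \<Rightarrow> nat \<Rightarrow> real" where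
  "fourier_coeff u v f k l =
     (if k = 0 then 1 / (2 * pi) else 1 / pi) * (if l = 0 then 1 / (2 * pi) else 1 / pi) *
     (LINT z:torus|lebesgue. f z * u (real k * fst z) * v (real l * snd z))"

definition Lambda_class :: "real \<Rightarrow> (real \<times> real \<Rightarrow> real) set" where
  "Lambda_class p = {f \<in> Lp0_torus p. \<exists>c :: nat \<Rightarrow> nat \<Rightarrow> real.
     (\<forall>i j. fourier_coeff cos cos f (2 ^ i) (2 ^ j) = c i j) \<and>
     (\<forall>k l. (\<nexists>i j. k = 2 ^ i \<and> l = 2 ^ j) \<longrightarrow> fourier_coeff cos cos f k l = 0) \<and>
     (\<forall>k l. fourier_coeff cos sin f k l = 0 \<and> fourier_coeff sin cos f k l = 0 \<and>
            fourier_coeff sin sin f k l = 0)}"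

text \<open>For \<open>f\<close> in \<open>L\<^sub>p\<close>, \<open>p \<ge> 1\<close>, the series below converge absolutely almost everywhere, because
  the binomial coefficients are absolutely summable for \<open>\<alpha> > 0\<close>; the value of \<^const>\<open>suminf\<close> at
  the remaining points does not affect the norm.\<close>

definition frac_diff_x :: "real \<Rightarrow> real \<Rightarrow> (real \<times> real \<Rightarrow> real) \<Rightarrow> real \<times> real \<Rightarrow> real" where
  "frac_diff_x \<alpha> h f = (\<lambda>(x, y). \<Sum>\<nu>. (- 1) ^ \<nu> * (\<alpha> gchoose \<nu>) * f (x + (\<alpha> - real \<nu>) * h, y))"

definition frac_diff_y :: "real \<Rightarrow> real \<Rightarrow> (real \<times> real \<Rightarrow> real) \<Rightarrow> real \<times> real \<Rightarrow> real" where
  "frac_diff_y \<alpha> h f = (\<lambda>(x, y). \<Sum>\<nu>. (- 1) ^ \<nu> * (\<alpha> gchoose \<nu>) * f (x, y + (\<alpha> - real \<nu>) * h))"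

definition mixed_modulus ::
  "real \<Rightarrow> real \<Rightarrow> real \<Rightarrow> (real \<times> real \<Rightarrow> real) \<Rightarrow> real \<Rightarrow> real \<Rightarrow> real" where
  "mixed_modulus p \<alpha>1 \<alpha>2 f \<delta>1 \<delta>2 =
     (SUP (h1, h2) \<in> {(h1, h2). \<bar>h1\<bar> \<le> \<delta>1 \<and> \<bar>h2\<bar> \<le> \<delta>2}.
        Lp_norm p (frac_diff_x \<alpha>1 h1 (frac_diff_y \<alpha>2 h2 f)))"

definition trig_poly_x :: "nat \<Rightarrow> (real \<times> real \<Rightarrow> real) \<Rightarrow> bool" where
  "trig_poly_x m T \<longleftrightarrow> (\<exists>a b :: nat \<Rightarrow> real \<Rightarrow> real. \<forall>x y.
     T (x, y) = (\<Sum>k\<le>m. a k y * cos (real k * x) + b k y * sin (real k * x)))"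

definition trig_poly_y :: "nat \<Rightarrow> (real \<times> real \<Rightarrow> real) \<Rightarrow> bool" where
  "trig_poly_y m T \<longleftrightarrow> (\<exists>a b :: nat \<Rightarrow> real \<Rightarrow> real. \<forall>x y.
     T (x, y) = (\<Sum>k\<le>m. a k x * cos (real k * y) + b k x * sin (real k * y)))"

definition angular_approx :: "real \<Rightarrow> nat \<Rightarrow> nat \<Rightarrow> (real \<times> real \<Rightarrow> real) \<Rightarrow> real" where
  "angular_approx p m1 m2 f =
     Inf {Lp_norm p (\<lambda>z. f z - T1 z - T2 z) | T1 T2.
       T1 \<in> Lp_torus p \<and> T2 \<in> Lp_torus p \<and> trig_poly_x m1 T1 \<and> trig_poly_y m2 T2}"

end

theory Submission
  imports Defs
begin

text \<open>
  The idea is to express both sides by the Fourier coefficients \<open>c i j\<close> of \<open>f\<close> at the frequencies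
  \<open>2 ^ i\<close> and \<open>2 ^ j\<close>. With \<open>r n i = min 1 (2 ^ i / n)\<close> (\<open>freq_ratio\<close>), both turn out to be comparable to the square root of
  \<open>\<Sum>i j. (c i j)\<^sup>2 * (r n1 i) powr (2 * \<alpha>1) * (r n2 j) powr (2 * \<alpha>2)\<close>.

  The \<open>L\<^sub>p\<close> norm of a lacunary double series is equivalent to the \<open>l\<^sub>2\<close> norm of its coefficients. For finite
  sums, the upper bound holds because lacunary sums are subgaussian: by convexity, the exponential of such a
  sum is dominated by a Riesz product, whose integral is known. This bounds all moments in one variable, and
  an iteration bounds them in two (\<open>lacunary_Lp_upper\<close>). The lower bound follows by duality
  (\<open>lacunary_bessel\<close>) and holds for the lacunary coefficients of any \<open>L\<^sub>p\<close> function. The upper bound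
  passes to infinite series because trigonometric polynomials suffice for computing the \<open>L\<^sub>p\<close> norm by duality
  (\<open>Lp_norm_le_of_trig_poly_dual\<close>, \<open>Lp_norm_le_lacunary_coeffs\<close>); hence the partial sums of \<open>f\<close> converge in
  \<open>L\<^sub>p\<close>, and it is enough to compare finite sums, up to an error that tends to \<open>0\<close>.

  The best angular approximation with degrees \<open>m1\<close> and \<open>m2\<close> is comparable to the \<open>l\<^sub>2\<close> norm of the coefficients with
  \<open>2 ^ i > m1\<close> and \<open>2 ^ j > m2\<close> (\<open>angular_approx_lower\<close>, \<open>angular_approx_upper\<close>). Summation against the weights
  produces the expression above (\<open>smoothness_energy_asymp\<close>).

  A fractional difference with step \<open>h\<close> multiplies the amplitude at the frequency \<open>2 ^ i\<close> by
  \<open>(2 * \<bar>sin (2 ^ i * h / 2)\<bar>) powr \<alpha>\<close> and otherwise only shifts the phase (\<open>frac_diff_cos\<close>). For \<open>\<bar>h\<bar> \<le> 1 / n\<close> this factor is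
  at most a constant times \<open>(r n i) powr \<alpha>\<close>, and for one suitable \<open>h\<close> the converse holds at all
  frequencies simultaneously (\<open>diff_mult_lower\<close>), so no averaging over \<open>h\<close> is needed.
\<close>

section \<open>Lacunary sums in one variable\<close>

lemma integral_cos_nonzero_freq:
  fixes m :: int
  assumes "m \<noteq> 0"
  shows "integral {0..2 * pi} (\<lambda>x. cos (m * x + \<theta>)) = 0"
proof -
  have "((\<lambda>x. cos (m * x + \<theta>)) has_integral
          (sin (of_int m * (2 * pi) + \<theta>) / m - sin (of_int m * 0 + \<theta>) / m)) {0..2 * pi}"
    using assms by (intro fundamental_theorem_of_calculus)
      (auto intro!: derivative_eq_intros simp: has_real_derivative_iff_has_vector_derivative[symmetric])
  moreover have "sin (m * (2 * pi) + \<theta>) = sin \<theta>"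
    using sin.plus_of_int[of \<theta> m] by (simp add: algebra_simps)
  ultimately show ?thesis by (simp add: integral_unique)
qed

text \<open>The partial Riesz product with frequencies \<open>1, 2, \<dots>, 2 ^ (n - 1)\<close> only contains frequencies
  below \<open>2 ^ n\<close>. In this form the claim carries through an induction: multiplication by the next
  factor moves a frequency \<open>m\<close> with \<open>2 ^ (n + 1) \<le> \<bar>m\<bar>\<close> by \<open>2 ^ n\<close> at most.\<close>

lemma riesz_product_orthogonal:
  fixes A B \<phi> :: "nat \<Rightarrow> real" and m :: int
  assumes "\<bar>m\<bar> \<ge> 2 ^ n"
  shows "integral {0..2 * pi} (\<lambda>x. (\<Prod>i<n. A i + B i * cos (2 ^ i * x + \<phi> i)) * cos (m * x + \<theta>)) = 0"
  using assms
proof (induction n arbitrary: m \<theta>)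
  case 0
  then have "m \<noteq> 0" by auto
  then show ?case by (simp add: integral_cos_nonzero_freq)
next
  case (Suc n)
  let ?g = "\<lambda>x. \<Prod>i<n. A i + B i * cos (2 ^ i * x + \<phi> i)"
  have *: "?g x * (A n + B n * cos (2 ^ n * x + \<phi> n)) * cos (m * x + \<theta>) =
     A n * (?g x * cos (m * x + \<theta>)) +
     (B n / 2 * (?g x * cos ((m - 2 ^ n) * x + (\<theta> - \<phi> n))) +
      B n / 2 * (?g x * cos ((m + 2 ^ n) * x + (\<theta> + \<phi> n))))" for x :: real
  proof -
    have "cos (2 ^ n * x + \<phi> n) * cos (m * x + \<theta>) =
       (cos ((m - 2 ^ n) * x + (\<theta> - \<phi> n)) + cos ((m + 2 ^ n) * x + (\<theta> + \<phi> n))) / 2"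
    proof -
      have 1: "(m - 2 ^ n) * x + (\<theta> - \<phi> n) = (m * x + \<theta>) - (2 ^ n * x + \<phi> n)"
        by (simp add: algebra_simps)
      have 2: "(m + 2 ^ n) * x + (\<theta> + \<phi> n) = (m * x + \<theta>) + (2 ^ n * x + \<phi> n)"
        by (simp add: algebra_simps)
      show ?thesis unfolding 1 2 by (simp add: cos_add cos_diff)
    qed
    then have "?g x * (B n * (cos (2 ^ n * x + \<phi> n) * cos (m * x + \<theta>))) =
       ?g x * (B n * ((cos ((m - 2 ^ n) * x + (\<theta> - \<phi> n)) + cos ((m + 2 ^ n) * x + (\<theta> + \<phi> n))) / 2))"
      by simp
    then show ?thesis by argo
  qed
  have I: "(\<lambda>x. c * (?g x * cos (k * x + t))) integrable_on {0..2 * pi}" for c k t :: real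
    by (intro integrable_continuous_interval continuous_intros)
  have a: "\<bar>m\<bar> \<ge> 2 ^ n" "\<bar>m - 2 ^ n\<bar> \<ge> 2 ^ n" "\<bar>m + 2 ^ n\<bar> \<ge> 2 ^ n"
    using Suc.prems by auto
  have "integral {0..2 * pi} (\<lambda>x. (\<Prod>i<Suc n. A i + B i * cos (2 ^ i * x + \<phi> i)) * cos (m * x + \<theta>)) =
    A n * integral {0..2 * pi} (\<lambda>x. ?g x * cos (m * x + \<theta>)) +
    (B n / 2 * integral {0..2 * pi} (\<lambda>x. ?g x * cos (of_int (m - 2 ^ n) * x + (\<theta> - \<phi> n))) +
     B n / 2 * integral {0..2 * pi} (\<lambda>x. ?g x * cos (of_int (m + 2 ^ n) * x + (\<theta> + \<phi> n))))"
    unfolding prod.lessThan_Suc *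
    by (subst integral_add, rule I, intro integrable_add I,
        subst integral_add, rule I, rule I) simp
  also have "\<dots> = 0" using Suc.IH[OF a(1)] Suc.IH[OF a(2)] Suc.IH[OF a(3)] by simp
  finally show ?case .
qed

lemma integral_riesz_product:
  fixes A B \<phi> :: "nat \<Rightarrow> real"
  shows "integral {0..2 * pi} (\<lambda>x. \<Prod>i<n. A i + B i * cos (2 ^ i * x + \<phi> i)) = 2 * pi * (\<Prod>i<n. A i)"
proof (induction n)
  case (Suc n)
  let ?g = "\<lambda>x. \<Prod>i<n. A i + B i * cos (2 ^ i * x + \<phi> i)"
  have "integral {0..2 * pi} (\<lambda>x. \<Prod>i<Suc n. A i + B i * cos (2 ^ i * x + \<phi> i)) =
    integral {0..2 * pi} (\<lambda>x. A n * ?g x + B n * (?g x * cos ((2 ^ n :: int) * x + \<phi> n)))"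
    by (simp add: algebra_simps)
  also have "\<dots> = A n * integral {0..2 * pi} ?g +
      B n * integral {0..2 * pi} (\<lambda>x. ?g x * cos ((2 ^ n :: int) * x + \<phi> n))"
    by (subst integral_add) (auto intro!: integrable_continuous_interval continuous_intros)
  also have "\<dots> = 2 * pi * (\<Prod>i<Suc n. A i)"
    using Suc.IH riesz_product_orthogonal[of n "2 ^ n" A B \<phi> "\<phi> n"] by simp
  finally show ?case .
qed simp

lemma cosh_le_exp_square: "cosh x \<le> exp (x\<^sup>2)" for x :: real
proof -
  have c: "(\<lambda>n. x ^ (2 * n) / fact (2 * n)) sums cosh x"
  proof -
    have "(\<lambda>n. if even (2 * n) then x ^ (2 * n) /\<^sub>R fact (2 * n) else 0) sums cosh x"
      using cosh_converges[of x]
      by (subst sums_mono_reindex[of "\<lambda>n. 2 * n"])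
         (auto simp: strict_mono_def elim!: evenE)
    then show ?thesis by (simp add: field_simps)
  qed
  have e: "(\<lambda>n. (x\<^sup>2) ^ n /\<^sub>R fact n) sums exp (x\<^sup>2)"
    by (rule exp_converges)
  show ?thesis
  proof (rule sums_le[OF _ c e])
    fix n
    have "(fact n :: real) \<le> fact (2 * n)" by (rule fact_mono) simp
    then show "x ^ (2 * n) / fact (2 * n) \<le> (x\<^sup>2) ^ n /\<^sub>R fact n"
      unfolding power_mult by (simp add: frac_le divide_inverse[symmetric] divide_inverse_commute[symmetric])
  qed
qed

text \<open>By convexity \<open>exp\<close> lies below its chord over \<open>[- a, a]\<close>; the chord is affine in \<open>cos t\<close>, which
  turns an exponential of a lacunary sum into a Riesz product.\<close>

lemma exp_mult_cos_le: "exp (a * cos t) \<le> cosh a + sinh a * cos t" for a t :: real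
proof -
  have cv: "convex_on UNIV (exp :: real \<Rightarrow> real)" by (rule exp_convex)
  have "exp (((1 + cos t) / 2) *\<^sub>R a + ((1 - cos t) / 2) *\<^sub>R (- a)) \<le>
      ((1 + cos t) / 2) * exp a + ((1 - cos t) / 2) * exp (- a)"
    using convex_onD[OF cv, of "(1 - cos t) / 2" a "- a"] cos_ge_minus_one[of t]
    by (simp add: field_simps)
  moreover have "((1 + cos t) / 2) *\<^sub>R a + ((1 - cos t) / 2) *\<^sub>R (- a) = a * cos t"
    by (simp add: field_simps)
  moreover have "((1 + cos t) / 2) * exp a + ((1 - cos t) / 2) * exp (- a) = cosh a + sinh a * cos t"
    by (simp add: cosh_def sinh_def field_simps)
  ultimately show ?thesis by simp
qed

text \<open>Lacunary sums are subgaussian. The phases are arbitrary, because fractional differences shift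
  every frequency by its own phase.\<close>

lemma integral_exp_lacunary_le:
  fixes a \<phi> :: "nat \<Rightarrow> real"
  shows "integral {0..2 * pi} (\<lambda>x. exp (\<Sum>i<n. a i * cos (2 ^ i * x + \<phi> i)))
           \<le> 2 * pi * exp (\<Sum>i<n. (a i)\<^sup>2)"
proof -
  have "integral {0..2 * pi} (\<lambda>x. exp (\<Sum>i<n. a i * cos (2 ^ i * x + \<phi> i))) \<le>
     integral {0..2 * pi} (\<lambda>x. \<Prod>i<n. cosh (a i) + sinh (a i) * cos (2 ^ i * x + \<phi> i))"
    by (intro integral_le integrable_continuous_interval continuous_intros)
       (auto simp: exp_sum intro!: prod_mono exp_mult_cos_le)
  also have "\<dots> = 2 * pi * (\<Prod>i<n. cosh (a i))"
    by (rule integral_riesz_product)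
  also have "\<dots> \<le> 2 * pi * (\<Prod>i<n. exp ((a i)\<^sup>2))"
    by (intro mult_left_mono prod_mono) (auto simp: cosh_le_exp_square)
  finally show ?thesis by (simp add: exp_sum)
qed

lemma power_le_fact_mult_exp: "\<bar>u\<bar> ^ n \<le> fact n * (exp u + exp (- u))" for u :: real
proof -
  have "(\<lambda>k. \<bar>u\<bar> ^ k /\<^sub>R fact k) sums exp \<bar>u\<bar>" by (rule exp_converges)
  then have "(\<Sum>k\<in>{n}. \<bar>u\<bar> ^ k /\<^sub>R fact k) \<le> exp \<bar>u\<bar>"
    using sum_le_suminf[of "\<lambda>k. \<bar>u\<bar> ^ k /\<^sub>R fact k" "{n}"] by (simp add: sums_iff)
  then have "\<bar>u\<bar> ^ n \<le> fact n * exp \<bar>u\<bar>"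
    by (simp add: field_simps)
  also have "\<dots> \<le> fact n * (exp u + exp (- u))"
    by (intro mult_left_mono) (auto simp: abs_if)
  finally show ?thesis .
qed

text \<open>The moments follow from the exponential bound after normalising the coefficients; the constant
  depends on the exponent only.\<close>

lemma lacunary_moment_1d:
  fixes m :: nat
  assumes "m \<ge> 1"
  obtains K where "K > 0"
    "\<And>n (a :: nat \<Rightarrow> real) \<phi>. integral {0..2 * pi} (\<lambda>x. (\<Sum>i<n. a i * cos (2 ^ i * x + \<phi> i)) ^ (2 * m))
       \<le> K * (\<Sum>i<n. (a i)\<^sup>2) ^ m"
proof
  let ?K = "fact (2 * m) * (2 * (2 * pi * exp 1)) :: real"
  show "?K > 0" by simp
  fix n :: nat and a \<phi> :: "nat \<Rightarrow> real"
  define s where "s = (\<Sum>i<n. (a i)\<^sup>2)"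
  have s0: "s \<ge> 0" unfolding s_def by (simp add: sum_nonneg)
  show "integral {0..2 * pi} (\<lambda>x. (\<Sum>i<n. a i * cos (2 ^ i * x + \<phi> i)) ^ (2 * m))
       \<le> ?K * (\<Sum>i<n. (a i)\<^sup>2) ^ m"
  proof (cases "s = 0")
    case True
    then have "\<forall>i<n. a i = 0" unfolding s_def by (simp add: sum_nonneg_eq_0_iff)
    then show ?thesis using assms by (simp add: power_0_left)
  next
    case False
    then have sp: "s > 0" using s0 by simp
    define b where "b i = a i / sqrt s" for i
    have sb: "(\<Sum>i<n. (b i)\<^sup>2) = 1"
      unfolding b_def using sp by (simp add: power_divide sum_divide_distrib[symmetric] s_def[symmetric])
    define u where "u x = (\<Sum>i<n. b i * cos (2 ^ i * x + \<phi> i))" for x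
    have cu: "continuous_on A u" for A unfolding u_def by (intro continuous_intros)
    have e1: "integral {0..2 * pi} (\<lambda>x. exp (u x)) \<le> 2 * pi * exp 1"
      using integral_exp_lacunary_le[where n=n and a=b and \<phi>=\<phi>] by (simp add: u_def sb)
    have e2: "integral {0..2 * pi} (\<lambda>x. exp (- u x)) \<le> 2 * pi * exp 1"
      using integral_exp_lacunary_le[where n=n and a="\<lambda>i. - b i" and \<phi>=\<phi>] by (simp add: u_def sb sum_negf)
    have "integral {0..2 * pi} (\<lambda>x. u x ^ (2 * m)) \<le>
        integral {0..2 * pi} (\<lambda>x. fact (2 * m) * (exp (u x) + exp (- u x)))"
      using power_le_fact_mult_exp[of "u _" "2 * m"]
      by (intro integral_le integrable_continuous_interval continuous_intros cu) (auto simp: power_even_abs)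
    also have "\<dots> = fact (2 * m) * (integral {0..2 * pi} (\<lambda>x. exp (u x)) + integral {0..2 * pi} (\<lambda>x. exp (- u x)))"
      by (simp, subst integral_add) (auto intro!: integrable_continuous_interval continuous_intros cu)
    also have "\<dots> \<le> ?K"
      using e1 e2 by (intro mult_left_mono) auto
    finally have U: "integral {0..2 * pi} (\<lambda>x. u x ^ (2 * m)) \<le> ?K" .
    have "(\<Sum>i<n. a i * cos (2 ^ i * x + \<phi> i)) ^ (2 * m) = s ^ m * u x ^ (2 * m)" for x
    proof -
      have "(\<Sum>i<n. a i * cos (2 ^ i * x + \<phi> i)) = sqrt s * u x"
        using sp by (simp add: u_def b_def sum_distrib_left)
      then show ?thesis using sp by (simp add: power_mult_distrib power_mult)
    qed
    then have "integral {0..2 * pi} (\<lambda>x. (\<Sum>i<n. a i * cos (2 ^ i * x + \<phi> i)) ^ (2 * m)) =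
       s ^ m * integral {0..2 * pi} (\<lambda>x. u x ^ (2 * m))" by simp
    also have "\<dots> \<le> s ^ m * ?K" using U s0 by (intro mult_left_mono) auto
    finally show ?thesis by (simp add: s_def mult.commute)
  qed
qed

section \<open>Lebesgue spaces on the torus\<close>

text \<open>Lebesgue measure on a closed period square.\<close>

abbreviation torusM :: "(real \<times> real) measure" where
  "torusM \<equiv> lebesgue_on torus"

lemma torus_eq_cbox: "torus = cbox (0, 0) (2 * pi, 2 * pi)"
  unfolding torus_def by (simp add: cbox_Pair_eq)

lemma compact_torus: "compact torus"
  by (simp add: torus_eq_cbox)

lemma torus_in_sets [measurable, simp]: "torus \<in> sets lebesgue"
  by (simp add: torus_eq_cbox)

lemma finite_measure_torus: "finite_measure torusM"
  by (rule finite_measureI)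
     (simp add: emeasure_restrict_space torus_eq_cbox emeasure_lborel_cbox_eq)

lemma integrable_torus_continuous [intro]:
  fixes f :: "real \<times> real \<Rightarrow> real"
  assumes "continuous_on torus f"
  shows "integrable torusM f"
  using assms unfolding torus_eq_cbox by (rule continuous_imp_integrable)

lemma integral_torus_continuous:
  fixes f :: "real \<times> real \<Rightarrow> real"
  assumes "continuous_on torus f"
  shows "integral\<^sup>L torusM f =
    integral {0..2 * pi} (\<lambda>x. integral {0..2 * pi} (\<lambda>y. f (x, y)))"
proof -
  have "integral\<^sup>L torusM f = integral torus f"
    by (rule lebesgue_integral_eq_integral) (auto intro: assms)
  then show ?thesis
    using assms by (simp add: torus_eq_cbox integral_prod_continuous)
qed

lemma integral_torus_product:
  fixes f g :: "real \<Rightarrow> real"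
  assumes "continuous_on UNIV f" "continuous_on UNIV g"
  shows "(LINT z|torusM. f (fst z) * g (snd z)) =
    integral {0..2 * pi} f * integral {0..2 * pi} g"
  by (subst integral_torus_continuous)
     (auto intro!: continuous_intros continuous_on_compose2[OF assms(1)] continuous_on_compose2[OF assms(2)])

lemma Lp_norm_eq: "Lp_norm p f = ((LINT z|torusM. \<bar>f z\<bar> powr p)) powr (1 / p)"
  unfolding Lp_norm_def set_lebesgue_integral_def by (simp add: integral_restrict_space)

lemma Lp_norm_nonneg [simp]: "Lp_norm p f \<ge> 0"
  by (simp add: Lp_norm_eq)

lemma Lp_norm_powr:
  assumes "p > 0"
  shows "Lp_norm p f powr p = (LINT z|torusM. \<bar>f z\<bar> powr p)"
  using assms by (simp add: Lp_norm_eq powr_powr)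

lemma Lp_norm_le:
  assumes "p > 0" "K \<ge> 0" "(LINT z|torusM. \<bar>f z\<bar> powr p) \<le> K powr p"
  shows "Lp_norm p f \<le> K"
proof -
  have "Lp_norm p f \<le> (K powr p) powr (1 / p)"
    unfolding Lp_norm_eq using assms by (intro powr_mono2) auto
  then show ?thesis using assms by (simp add: powr_powr)
qed

text \<open>Periodicity with period \<open>2 \<pi>\<close> in each variable, at every point.\<close>

definition torus_periodic :: "(real \<times> real \<Rightarrow> 'a) \<Rightarrow> bool" where
  "torus_periodic f \<longleftrightarrow> (\<forall>x y. f (x + 2 * pi, y) = f (x, y) \<and> f (x, y + 2 * pi) = f (x, y))"

lemma Lp_torus_iff:
  "f \<in> Lp_torus p \<longleftrightarrow> f \<in> borel_measurable lebesgue \<and> torus_periodic f \<and>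
     integrable torusM (\<lambda>z. \<bar>f z\<bar> powr p)"
  unfolding Lp_torus_def set_integrable_def torus_periodic_def
  by (simp add: integrable_restrict_space)

lemma measurable_torus_lebesgue [measurable_dest]:
  "f \<in> borel_measurable lebesgue \<Longrightarrow> f \<in> borel_measurable torusM"
  by (rule measurable_restrict_space1)

lemma Lp_torus_measurable: "f \<in> Lp_torus p \<Longrightarrow> f \<in> borel_measurable torusM"
  by (rule measurable_torus_lebesgue) (simp add: Lp_torus_iff)

lemma continuous_measurable_lebesgue:
  fixes f :: "real \<times> real \<Rightarrow> real"
  assumes "continuous_on UNIV f"
  shows "f \<in> borel_measurable lebesgue"
  using borel_measurable_continuous_onI[OF assms] by (simp add: measurable_completion)

lemma Lp_torus_continuous:
  assumes "continuous_on UNIV f" "torus_periodic f" "p > 0"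
  shows "f \<in> Lp_torus p"
proof -
  have "continuous_on torus (\<lambda>z. \<bar>f z\<bar> powr p)"
    using assms by (intro continuous_on_powr' continuous_intros)
      (auto intro: continuous_on_subset)
  then show ?thesis
    using assms by (auto simp: Lp_torus_iff continuous_measurable_lebesgue)
qed

lemma abs_add_powr_le:
  fixes a b p :: real
  assumes "p > 0"
  shows "\<bar>a + b\<bar> powr p \<le> 2 powr p * (\<bar>a\<bar> powr p + \<bar>b\<bar> powr p)"
proof -
  have "\<bar>a + b\<bar> powr p \<le> (2 * max \<bar>a\<bar> \<bar>b\<bar>) powr p"
    using assms by (intro powr_mono2) auto
  also have "\<dots> = 2 powr p * (max \<bar>a\<bar> \<bar>b\<bar>) powr p"
    by (simp add: powr_mult)
  also have "\<dots> \<le> 2 powr p * (\<bar>a\<bar> powr p + \<bar>b\<bar> powr p)"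
    by (intro mult_left_mono) (auto simp: max_def)
  finally show ?thesis .
qed

lemma add_powr_le:
  fixes x y r :: real
  assumes "x \<ge> 0" "y \<ge> 0" "r > 0"
  shows "(x + y) powr r \<le> 2 powr r * (x powr r + y powr r)"
  using abs_add_powr_le[OF assms(3), of x y] assms by simp

lemma Lp_torus_add:
  assumes "f \<in> Lp_torus p" "g \<in> Lp_torus p" "p > 0"
  shows "(\<lambda>z. f z + g z) \<in> Lp_torus p"
proof -
  have m: "f \<in> borel_measurable lebesgue" "g \<in> borel_measurable lebesgue"
    using assms by (auto simp: Lp_torus_iff)
  have "integrable torusM (\<lambda>z. \<bar>f z + g z\<bar> powr p)"
  proof (rule Bochner_Integration.integrable_bound)
    show "integrable torusM (\<lambda>z. 2 powr p * (\<bar>f z\<bar> powr p + \<bar>g z\<bar> powr p))"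
      using assms by (auto simp: Lp_torus_iff)
    show "(\<lambda>z. \<bar>f z + g z\<bar> powr p) \<in> borel_measurable torusM"
      using m by measurable
    show "AE z in torusM. norm (\<bar>f z + g z\<bar> powr p) \<le> norm (2 powr p * (\<bar>f z\<bar> powr p + \<bar>g z\<bar> powr p))"
      using abs_add_powr_le[OF assms(3)] by auto
  qed
  then show ?thesis using assms m by (auto simp: Lp_torus_iff torus_periodic_def)
qed

lemma Lp_torus_uminus: "f \<in> Lp_torus p \<Longrightarrow> (\<lambda>z. - f z) \<in> Lp_torus p"
  by (auto simp: Lp_torus_iff torus_periodic_def)

lemma Lp_torus_diff:
  assumes "f \<in> Lp_torus p" "g \<in> Lp_torus p" "p > 0"
  shows "(\<lambda>z. f z - g z) \<in> Lp_torus p"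
  using Lp_torus_add[OF assms(1) Lp_torus_uminus[OF assms(2)] assms(3)] by simp

lemma Lp_norm_uminus: "Lp_norm p (\<lambda>z. - f z) = Lp_norm p f"
  by (simp add: Lp_norm_eq)

text \<open>A quasi-triangle inequality; the factor \<open>4\<close> is harmless, since all constants are free in the end.\<close>

lemma Lp_norm_add:
  assumes "f \<in> Lp_torus p" "g \<in> Lp_torus p" "p > 1"
  shows "Lp_norm p (\<lambda>z. f z + g z) \<le> 4 * (Lp_norm p f + Lp_norm p g)"
proof -
  have i: "integrable torusM (\<lambda>z. \<bar>f z\<bar> powr p)" "integrable torusM (\<lambda>z. \<bar>g z\<bar> powr p)"
     "integrable torusM (\<lambda>z. \<bar>f z + g z\<bar> powr p)"
    using assms Lp_torus_add[OF assms(1,2)] by (auto simp: Lp_torus_iff)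
  let ?F = "(LINT z|torusM. \<bar>f z\<bar> powr p)"
  let ?G = "(LINT z|torusM. \<bar>g z\<bar> powr p)"
  have "(LINT z|torusM. \<bar>f z + g z\<bar> powr p) \<le>
     (LINT z|torusM. 2 powr p * (\<bar>f z\<bar> powr p + \<bar>g z\<bar> powr p))"
    using i abs_add_powr_le[of p] assms by (intro integral_mono) auto
  also have "\<dots> = 2 powr p * (?F + ?G)" using i by simp
  finally have "Lp_norm p (\<lambda>z. f z + g z) \<le> (2 powr p * (?F + ?G)) powr (1 / p)"
    unfolding Lp_norm_eq using assms by (intro powr_mono2) auto
  also have "\<dots> = 2 * (?F + ?G) powr (1 / p)"
    using assms by (simp add: powr_mult powr_powr)
  also have "\<dots> \<le> 2 * (2 powr (1 / p) * (?F powr (1 / p) + ?G powr (1 / p)))"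
    using assms by (intro mult_left_mono add_powr_le) auto
  also have "\<dots> \<le> 2 * (2 powr 1 * (?F powr (1 / p) + ?G powr (1 / p)))"
    using assms by (intro mult_left_mono mult_right_mono powr_mono) auto
  finally show ?thesis by (simp add: Lp_norm_eq)
qed

lemma Lp_norm_le_diff:
  assumes "f \<in> Lp_torus p" "g \<in> Lp_torus p" "p > 1"
  shows "Lp_norm p f \<le> 4 * (Lp_norm p g + Lp_norm p (\<lambda>z. f z - g z))"
  using Lp_norm_add[OF assms(2) Lp_torus_diff[OF assms(1,2)] assms(3)] assms by simp

lemma integrable_mult_Lp:
  fixes f g :: "real \<times> real \<Rightarrow> real"
  assumes f: "f \<in> borel_measurable torusM" "integrable torusM (\<lambda>z. \<bar>f z\<bar> powr p)"
    and g: "g \<in> borel_measurable torusM" "integrable torusM (\<lambda>z. \<bar>g z\<bar> powr q)"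
    and pq: "p > 1" "q > 1" "1 / p + 1 / q = 1"
  shows "integrable torusM (\<lambda>z. f z * g z)"
proof (rule Bochner_Integration.integrable_bound)
  show "integrable torusM (\<lambda>z. \<bar>f z\<bar> powr p / p + \<bar>g z\<bar> powr q / q)"
    using f g by auto
  show "(\<lambda>z. f z * g z) \<in> borel_measurable torusM"
    using f g by measurable
  have "\<bar>f z * g z\<bar> \<le> \<bar>f z\<bar> powr p / p + \<bar>g z\<bar> powr q / q" for z
    using Youngs_inequality[OF pq, of "\<bar>f z\<bar>" "\<bar>g z\<bar>"] by (simp add: abs_mult)
  then show "AE z in torusM. norm (f z * g z) \<le> norm (\<bar>f z\<bar> powr p / p + \<bar>g z\<bar> powr q / q)"
    using pq by (auto intro: order_trans[OF _ abs_ge_self])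
qed

lemma Holder_torus:
  fixes f g :: "real \<times> real \<Rightarrow> real"
  assumes f: "f \<in> borel_measurable torusM" "integrable torusM (\<lambda>z. \<bar>f z\<bar> powr p)"
    and g: "g \<in> borel_measurable torusM" "integrable torusM (\<lambda>z. \<bar>g z\<bar> powr q)"
    and pq: "p > 1" "q > 1" "1 / p + 1 / q = 1"
  shows "\<bar>(LINT z|torusM. f z * g z)\<bar> \<le> Lp_norm p f * Lp_norm q g"
proof -
  define a where "a = Lp_norm p f"
  define b where "b = Lp_norm q g"
  have nn: "a \<ge> 0" "b \<ge> 0" unfolding a_def b_def by auto
  have ia: "(LINT z|torusM. \<bar>f z\<bar> powr p) = a powr p"
    unfolding a_def using pq by (simp add: Lp_norm_powr)
  have ib: "(LINT z|torusM. \<bar>g z\<bar> powr q) = b powr q"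
    unfolding b_def using pq by (simp add: Lp_norm_powr)
  have fg: "integrable torusM (\<lambda>z. f z * g z)"
    using integrable_mult_Lp[OF assms] .
  show ?thesis
  proof (cases "a = 0 \<or> b = 0")
    case True
    have "AE z in torusM. f z * g z = 0"
    proof (cases "a = 0")
      case True
      then have "AE z in torusM. \<bar>f z\<bar> powr p = 0"
        using ia f integral_nonneg_eq_0_iff_AE[of torusM "\<lambda>z. \<bar>f z\<bar> powr p"] by simp
      then show ?thesis by eventually_elim auto
    next
      case False
      then have "b = 0" using True by simp
      then have "AE z in torusM. \<bar>g z\<bar> powr q = 0"
        using ib g integral_nonneg_eq_0_iff_AE[of torusM "\<lambda>z. \<bar>g z\<bar> powr q"] by simp
      then show ?thesis by eventually_elim auto
    qed
    then have "(LINT z|torusM. f z * g z) = (LINT z|torusM. 0)"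
      using fg by (intro integral_cong_AE) auto
    then show ?thesis by simp
  next
    case False
    then have ab: "a > 0" "b > 0" using nn by auto
    have "\<bar>(LINT z|torusM. f z * g z)\<bar> \<le> (LINT z|torusM. \<bar>f z * g z\<bar>)"
      by (rule integral_abs_bound)
    also have "\<dots> \<le> (LINT z|torusM. a * b * (\<bar>f z\<bar> powr p / a powr p / p + \<bar>g z\<bar> powr q / b powr q / q))"
    proof (rule integral_mono)
      fix z
      have "(\<bar>f z\<bar> / a) * (\<bar>g z\<bar> / b) \<le> \<bar>f z\<bar> powr p / a powr p / p + \<bar>g z\<bar> powr q / b powr q / q"
        using Youngs_inequality[OF pq, of "\<bar>f z\<bar> / a" "\<bar>g z\<bar> / b"] ab by (simp add: powr_divide)
      then have "a * b * ((\<bar>f z\<bar> / a) * (\<bar>g z\<bar> / b)) \<le> a * b * (\<bar>f z\<bar> powr p / a powr p / p + \<bar>g z\<bar> powr q / b powr q / q)"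
        using ab by (intro mult_left_mono) auto
      then show "\<bar>f z * g z\<bar> \<le> a * b * (\<bar>f z\<bar> powr p / a powr p / p + \<bar>g z\<bar> powr q / b powr q / q)"
        using ab by (simp add: abs_mult)
    qed (use f g fg in auto)
    also have "\<dots> = a * b * (1 / p + 1 / q)"
      using f g ab by (simp add: ia ib)
    finally show ?thesis using pq by (simp add: a_def b_def)
  qed
qed

section \<open>Lacunary double sums\<close>

text \<open>The product of a wave in the first and a wave in the second variable, with phases.\<close>

abbreviation cos_cos :: "real \<Rightarrow> real \<Rightarrow> real \<Rightarrow> real \<Rightarrow> real \<times> real \<Rightarrow> real" where
  "cos_cos k l a b z \<equiv> cos (k * fst z + a) * cos (l * snd z + b)"

text \<open>A finite double sum over the frequencies \<open>2 ^ i\<close> and \<open>2 ^ j\<close>, \<open>i, j < N\<close>, with phases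
  \<open>\<phi> i\<close> and \<open>\<psi> j\<close>.\<close>

definition lacunary_poly :: "nat \<Rightarrow> (nat \<Rightarrow> nat \<Rightarrow> real) \<Rightarrow> (nat \<Rightarrow> real) \<Rightarrow> (nat \<Rightarrow> real) \<Rightarrow> real \<times> real \<Rightarrow> real" where
  "lacunary_poly N c \<phi> \<psi> = (\<lambda>z. \<Sum>i<N. \<Sum>j<N. c i j * cos_cos (2 ^ i) (2 ^ j) (\<phi> i) (\<psi> j) z)"

lemma continuous_lacunary_poly [continuous_intros]: "continuous_on A (lacunary_poly N c \<phi> \<psi>)"
  unfolding lacunary_poly_def by (intro continuous_intros)

lemma cos_pow2_periodic: "cos (2 ^ i * (x + 2 * pi) + \<phi>) = cos (2 ^ i * x + \<phi>)"
  using cos.plus_of_nat[of "2 ^ i * x + \<phi>" "2 ^ i"] by (simp add: algebra_simps)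

lemma periodic_lacunary_poly: "torus_periodic (lacunary_poly N c \<phi> \<psi>)"
  unfolding lacunary_poly_def torus_periodic_def by (simp add: cos_pow2_periodic)

lemma lacunary_poly_Lp: "p > 0 \<Longrightarrow> lacunary_poly N c \<phi> \<psi> \<in> Lp_torus p"
  by (intro Lp_torus_continuous continuous_lacunary_poly periodic_lacunary_poly)

lemma lacunary_poly_swap: "lacunary_poly N c \<phi> \<psi> (x, y) = lacunary_poly N (\<lambda>i j. c j i) \<psi> \<phi> (y, x)"
  unfolding lacunary_poly_def by (subst sum.swap) (simp add: mult.commute)

text \<open>The same sum without phases.\<close>

abbreviation cos_poly :: "nat \<Rightarrow> (nat \<Rightarrow> nat \<Rightarrow> real) \<Rightarrow> real \<times> real \<Rightarrow> real" where
  "cos_poly N c \<equiv> lacunary_poly N c (\<lambda>_. 0) (\<lambda>_. 0)"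

lemma convex_power_nonneg: "convex_on {0..} (\<lambda>x::real. x ^ n)"
  by (cases "even n")
     (auto intro: convex_power_odd convex_on_subset[OF convex_power_even])

text \<open>Jensen's inequality for \<open>x ^ m\<close> with weights \<open>s j / (\<Sum>j<N. s j)\<close>. Integrated, it takes the place of
  Minkowski's inequality in the passage from one variable to two. Indices with \<open>s j = 0\<close>
  contribute nothing and are left out, as the quotient \<open>1 / s j\<close> would be meaningless.\<close>

lemma power_sum_squares_le:
  fixes b s :: "nat \<Rightarrow> real"
  assumes s: "\<And>j. j < N \<Longrightarrow> s j \<ge> 0" and z: "\<And>j. j < N \<Longrightarrow> s j = 0 \<Longrightarrow> b j = 0"
    and S: "(\<Sum>j<N. s j) > 0" and m: "m \<ge> 1"
  shows "(\<Sum>j<N. (b j)\<^sup>2) ^ m \<le> (\<Sum>j<N. if s j = 0 then 0 else s j / (\<Sum>j<N. s j) * ((\<Sum>j<N. s j) / s j) ^ m * b j ^ (2 * m))"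
proof -
  define J where "J = {j. j < N \<and> s j \<noteq> 0}"
  define T where "T = (\<Sum>j<N. s j)"
  have fJ: "finite J" unfolding J_def by simp
  have TJ: "T = (\<Sum>j\<in>J. s j)" unfolding T_def J_def
    by (rule sum.mono_neutral_right) auto
  have T0: "T > 0" using S T_def by simp
  have Jne: "J \<noteq> {}" using TJ T0 by auto
  have pos: "s j > 0" if "j \<in> J" for j using that s[of j] by (auto simp: J_def less_eq_real_def)
  have "(\<Sum>j<N. (b j)\<^sup>2) = (\<Sum>j\<in>J. (b j)\<^sup>2)"
    unfolding J_def by (rule sum.mono_neutral_right) (auto simp: z)
  also have "\<dots> = (\<Sum>j\<in>J. (s j / T) *\<^sub>R (T / s j * (b j)\<^sup>2))"
    using T0 pos by (intro sum.cong) (auto simp: J_def)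
  finally have "(\<Sum>j<N. (b j)\<^sup>2) ^ m = (\<Sum>j\<in>J. (s j / T) *\<^sub>R (T / s j * (b j)\<^sup>2)) ^ m" by simp
  also have "\<dots> \<le> (\<Sum>j\<in>J. (s j / T) * (T / s j * (b j)\<^sup>2) ^ m)"
  proof (rule convex_on_sum[OF fJ Jne convex_power_nonneg])
    show "(\<Sum>j\<in>J. s j / T) = 1"
      using T0 TJ by (simp add: sum_divide_distrib[symmetric])
  qed (use pos T0 in \<open>auto intro!: mult_nonneg_nonneg divide_nonneg_nonneg simp: less_imp_le\<close>)
  also have "\<dots> = (\<Sum>j\<in>J. if s j = 0 then 0 else s j / T * (T / s j) ^ m * b j ^ (2 * m))"
    by (intro sum.cong) (auto simp: J_def power_mult_distrib power_mult power_divide)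
  also have "\<dots> = (\<Sum>j<N. if s j = 0 then 0 else s j / T * (T / s j) ^ m * b j ^ (2 * m))"
    unfolding J_def by (rule sum.mono_neutral_left) auto
  finally show ?thesis unfolding T_def .
qed

text \<open>For fixed \<open>x\<close> the double sum is a lacunary sum in \<open>y\<close> with coefficients \<open>b j x\<close>, which are themselves
  lacunary sums in \<open>x\<close>: the one-dimensional bound is applied in \<open>y\<close>, and then in \<open>x\<close>.\<close>

lemma lacunary_moment_2d:
  fixes m :: nat
  assumes "m \<ge> 1"
  obtains K where "K > 0"
    "\<And>N c \<phi> \<psi>. (LINT z|torusM. lacunary_poly N c \<phi> \<psi> z ^ (2 * m))
       \<le> K * (\<Sum>i<N. \<Sum>j<N. (c i j)\<^sup>2) ^ m"
proof -
  obtain K where K: "K > 0"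
    "\<And>n (a :: nat \<Rightarrow> real) \<phi>. integral {0..2 * pi} (\<lambda>x. (\<Sum>i<n. a i * cos (2 ^ i * x + \<phi> i)) ^ (2 * m))
       \<le> K * (\<Sum>i<n. (a i)\<^sup>2) ^ m"
    using lacunary_moment_1d[OF assms] by blast
  show ?thesis
  proof
    show "K * K > 0" using K by simp
    fix N :: nat and c :: "nat \<Rightarrow> nat \<Rightarrow> real" and \<phi> \<psi> :: "nat \<Rightarrow> real"
    define b where "b j x = (\<Sum>i<N. c i j * cos (2 ^ i * x + \<phi> i))" for j x
    define s where "s j = (\<Sum>i<N. (c i j)\<^sup>2)" for j
    define S where "S = (\<Sum>j<N. s j)"
    have s0: "s j \<ge> 0" for j unfolding s_def by (simp add: sum_nonneg)
    have S0: "S \<ge> 0" unfolding S_def by (simp add: sum_nonneg s0)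
    have Seq: "(\<Sum>i<N. \<Sum>j<N. (c i j)\<^sup>2) = S" unfolding S_def s_def by (rule sum.swap)
    have cb: "continuous_on A (b j)" for A j unfolding b_def by (intro continuous_intros)
    have sz: "b j x = 0" if "s j = 0" for j x
    proof -
      have "\<forall>i<N. c i j = 0" using that unfolding s_def by (simp add: sum_nonneg_eq_0_iff)
      then show ?thesis unfolding b_def by simp
    qed
    have h: "lacunary_poly N c \<phi> \<psi> (x, y) = (\<Sum>j<N. b j x * cos (2 ^ j * y + \<psi> j))" for x y
      unfolding lacunary_poly_def b_def sum_distrib_right
      by (subst sum.swap) (simp add: mult.assoc)
    have "(LINT z|torusM. lacunary_poly N c \<phi> \<psi> z ^ (2 * m)) =
      integral {0..2 * pi} (\<lambda>x. integral {0..2 * pi} (\<lambda>y. (\<Sum>j<N. b j x * cos (2 ^ j * y + \<psi> j)) ^ (2 * m)))"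
      by (subst integral_torus_continuous) (auto intro!: continuous_intros simp: h)
    also have "\<dots> \<le> integral {0..2 * pi} (\<lambda>x. K * (\<Sum>j<N. (b j x)\<^sup>2) ^ m)"
    proof (rule integral_le)
      show "(\<lambda>x. integral {0..2 * pi} (\<lambda>y. (\<Sum>j<N. b j x * cos (2 ^ j * y + \<psi> j)) ^ (2 * m)))
              integrable_on {0..2 * pi}"
      proof -
        have "continuous_on (cbox 0 (2 * pi)) (\<lambda>x. integral (cbox 0 (2 * pi)) (\<lambda>y. (\<Sum>j<N. b j x * cos (2 ^ j * y + \<psi> j)) ^ (2 * m)))"
          by (rule integral_continuous_on_param)
             (auto simp: case_prod_unfold intro!: continuous_intros continuous_on_compose2[OF cb])
        then show ?thesis by (intro integrable_continuous_interval) simp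
      qed
    qed (auto intro!: integrable_continuous_interval continuous_intros cb K)
    also have "\<dots> = K * integral {0..2 * pi} (\<lambda>x. (\<Sum>j<N. (b j x)\<^sup>2) ^ m)"
      by simp
    also have "\<dots> \<le> K * (K * S ^ m)"
    proof (cases "S = 0")
      case True
      then have "s j = 0" if "j < N" for j using that s0 unfolding S_def by (simp add: sum_nonneg_eq_0_iff)
      then have "b j x = 0" if "j < N" for j x using that sz by blast
      then show ?thesis using assms True by (simp add: power_0_left)
    next
      case False
      then have Sp: "S > 0" using S0 by simp
      define w where "w j = (if s j = 0 then 0 else s j / S * (S / s j) ^ m)" for j
      have w0: "w j \<ge> 0" for j unfolding w_def using s0 S0 by auto
      have "integral {0..2 * pi} (\<lambda>x. (\<Sum>j<N. (b j x)\<^sup>2) ^ m) \<le>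
        integral {0..2 * pi} (\<lambda>x. \<Sum>j<N. w j * b j x ^ (2 * m))"
      proof (intro integral_le)
        fix x
        have "(\<Sum>j<N. (b j x)\<^sup>2) ^ m \<le> (\<Sum>j<N. if s j = 0 then 0 else s j / S * (S / s j) ^ m * b j x ^ (2 * m))"
          unfolding S_def using Sp assms s0 sz unfolding S_def by (intro power_sum_squares_le) auto
        also have "\<dots> = (\<Sum>j<N. w j * b j x ^ (2 * m))" by (intro sum.cong) (auto simp: w_def)
        finally show "(\<Sum>j<N. (b j x)\<^sup>2) ^ m \<le> (\<Sum>j<N. w j * b j x ^ (2 * m))" .
      qed (auto intro!: integrable_continuous_interval continuous_intros cb)
      also have "\<dots> = (\<Sum>j<N. w j * integral {0..2 * pi} (\<lambda>x. b j x ^ (2 * m)))"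
        by (subst integral_sum) (auto intro!: integrable_continuous_interval continuous_intros cb)
      also have "\<dots> \<le> (\<Sum>j<N. w j * (K * s j ^ m))"
        unfolding b_def s_def by (intro sum_mono mult_left_mono K w0[unfolded s_def])
      also have "\<dots> = (\<Sum>j<N. K * S ^ m * (s j / S))"
        using Sp assms by (intro sum.cong) (auto simp: w_def power_divide)
      also have "\<dots> = K * S ^ m"
        using Sp by (simp add: sum_distrib_left[symmetric] sum_divide_distrib[symmetric] S_def[symmetric])
      finally show ?thesis using K by (intro mult_left_mono) auto
    qed
    finally show "(LINT z|torusM. lacunary_poly N c \<phi> \<psi> z ^ (2 * m))
       \<le> K * K * (\<Sum>i<N. \<Sum>j<N. (c i j)\<^sup>2) ^ m"
      unfolding Seq by (simp add: mult.assoc)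
  qed
qed

text \<open>One half of Zygmund's theorem: every \<open>L\<^sub>q\<close> norm of a lacunary sum is bounded by the \<open>l\<^sub>2\<close> norm of its
  coefficients.\<close>

theorem lacunary_Lp_upper:
  assumes "q > 0"
  obtains C where "C > 0"
    "\<And>N c \<phi> \<psi>. Lp_norm q (lacunary_poly N c \<phi> \<psi>) \<le> C * sqrt (\<Sum>i<N. \<Sum>j<N. (c i j)\<^sup>2)"
proof -
  obtain m :: nat where m: "m \<ge> 1" "q \<le> 2 * real m"
  proof
    show "nat \<lceil>q\<rceil> \<ge> 1" using assms by linarith
    show "q \<le> 2 * real (nat \<lceil>q\<rceil>)" using assms by linarith
  qed
  obtain K where K: "K > 0"
    "\<And>N c \<phi> \<psi>. (LINT z|torusM. lacunary_poly N c \<phi> \<psi> z ^ (2 * m))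
       \<le> K * (\<Sum>i<N. \<Sum>j<N. (c i j)\<^sup>2) ^ m"
    using lacunary_moment_2d[OF m(1)] by blast
  define V where "V = measure torusM (space torusM)"
  define C where "C = (V + K) powr (1 / q)"
  have "V + K > 0" unfolding V_def using K by (simp add: add_nonneg_pos)
  then have C0: "C > 0" unfolding C_def by simp
  interpret finite_measure torusM by (rule finite_measure_torus)
  have main: "Lp_norm q (lacunary_poly N c \<phi> \<psi>) \<le> C" if c1: "(\<Sum>i<N. \<Sum>j<N. (c i j)\<^sup>2) = 1" for N c \<phi> \<psi>
  proof -
    have "(LINT z|torusM. \<bar>lacunary_poly N c \<phi> \<psi> z\<bar> powr q) \<le>
      (LINT z|torusM. 1 + lacunary_poly N c \<phi> \<psi> z ^ (2 * m))"
    proof (rule integral_mono)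
      show "integrable torusM (\<lambda>z. \<bar>lacunary_poly N c \<phi> \<psi> z\<bar> powr q)"
        using lacunary_poly_Lp[OF assms] by (simp add: Lp_torus_iff)
      show "integrable torusM (\<lambda>z. 1 + lacunary_poly N c \<phi> \<psi> z ^ (2 * m))"
        by (intro integrable_torus_continuous continuous_intros)
      fix z
      let ?u = "lacunary_poly N c \<phi> \<psi> z"
      show "\<bar>?u\<bar> powr q \<le> 1 + ?u ^ (2 * m)"
      proof (cases "\<bar>?u\<bar> \<le> 1")
        case True
        then have "\<bar>?u\<bar> powr q \<le> 1 powr q" using assms by (intro powr_mono2) auto
        moreover have "?u ^ (2 * m) \<ge> 0" by (simp add: power_mult)
        ultimately show ?thesis unfolding powr_one_eq_one by linarith
      next
        case False
        then have "\<bar>?u\<bar> powr q \<le> \<bar>?u\<bar> powr (real (2 * m))" using m by (intro powr_mono) auto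
        also have "\<dots> = ?u ^ (2 * m)" using False by (subst powr_realpow) (auto simp: power_even_abs)
        finally show ?thesis by simp
      qed
    qed
    also have "\<dots> = V + (LINT z|torusM. lacunary_poly N c \<phi> \<psi> z ^ (2 * m))"
      unfolding V_def by (subst Bochner_Integration.integral_add) (auto intro!: integrable_torus_continuous continuous_intros)
    also have "\<dots> \<le> V + K" using K(2)[of N c \<phi> \<psi>] c1 by simp
    also have "\<dots> = C powr q" unfolding C_def using assms K V_def by (simp add: powr_powr)
    finally show ?thesis using assms C0 by (intro Lp_norm_le) auto
  qed
  show ?thesis
  proof (rule that[OF C0])
    fix N :: nat and c :: "nat \<Rightarrow> nat \<Rightarrow> real" and \<phi> \<psi> :: "nat \<Rightarrow> real"
    define s where "s = (\<Sum>i<N. \<Sum>j<N. (c i j)\<^sup>2)"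
    have s0: "s \<ge> 0" unfolding s_def by (intro sum_nonneg) auto
    show "Lp_norm q (lacunary_poly N c \<phi> \<psi>) \<le> C * sqrt (\<Sum>i<N. \<Sum>j<N. (c i j)\<^sup>2)"
    proof (cases "s = 0")
      case True
      then have "c i j = 0" if "i < N" "j < N" for i j
        using that unfolding s_def by (simp add: sum_nonneg_eq_0_iff sum_nonneg)
      then have "lacunary_poly N c \<phi> \<psi> = (\<lambda>z. 0)" unfolding lacunary_poly_def by simp
      then show ?thesis using True s_def assms by (simp add: Lp_norm_eq)
    next
      case False
      then have sp: "s > 0" using s0 by simp
      define d where "d i j = c i j / sqrt s" for i j
      have "(\<Sum>i<N. \<Sum>j<N. (d i j)\<^sup>2) = 1"
        unfolding d_def using sp by (simp add: power_divide sum_divide_distrib[symmetric] s_def[symmetric])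
      then have L: "Lp_norm q (lacunary_poly N d \<phi> \<psi>) \<le> C" by (rule main)
      have "lacunary_poly N c \<phi> \<psi> = (\<lambda>z. sqrt s * lacunary_poly N d \<phi> \<psi> z)"
        unfolding lacunary_poly_def d_def using sp by (simp add: sum_distrib_left)
      then have "Lp_norm q (lacunary_poly N c \<phi> \<psi>) = sqrt s * Lp_norm q (lacunary_poly N d \<phi> \<psi>)"
        unfolding Lp_norm_eq using sp assms by (simp add: abs_mult powr_mult powr_powr)
      then show ?thesis using mult_left_mono[OF L, of "sqrt s"] s0 by (simp add: s_def[symmetric] mult.commute)
    qed
  qed
qed

section \<open>Trigonometric polynomials and duality\<close>

text \<open>Real trigonometric polynomials in two variables. Integer frequencies and a free phase make the
  generators closed under multiplication up to sums.\<close>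

inductive trig_poly :: "(real \<times> real \<Rightarrow> real) \<Rightarrow> bool" where
  trig_poly_cos: "trig_poly (\<lambda>z. c * cos (of_int k * fst z + of_int l * snd z + \<theta>))" for c :: real and k l :: int and \<theta> :: real
| trig_poly_add: "trig_poly f \<Longrightarrow> trig_poly g \<Longrightarrow> trig_poly (\<lambda>z. f z + g z)"

lemma trig_poly_const: "trig_poly (\<lambda>z. c)"
  using trig_poly_cos[of c 0 0 0] by simp

lemma trig_poly_cmult: "trig_poly f \<Longrightarrow> trig_poly (\<lambda>z. a * f z)"
proof (induction rule: trig_poly.induct)
  case (trig_poly_cos c k l \<theta>)
  show ?case using trig_poly.trig_poly_cos[of "a * c" k l \<theta>] by (simp add: mult.assoc)
next
  case (trig_poly_add f g)
  then show ?case using trig_poly.trig_poly_add[of "\<lambda>z. a * f z" "\<lambda>z. a * g z"] by (simp add: distrib_left)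
qed

lemma trig_poly_mult_cos:
  assumes "trig_poly g"
  shows "trig_poly (\<lambda>z. (c * cos (of_int k * fst z + of_int l * snd z + \<theta>)) * g z)"
  using assms
proof (induction rule: trig_poly.induct)
  case (trig_poly_cos d k' l' \<theta>')
  have "c * cos (of_int k * fst z + of_int l * snd z + \<theta>) * (d * cos (of_int k' * fst z + of_int l' * snd z + \<theta>')) =
    c * d / 2 * cos (of_int (k - k') * fst z + of_int (l - l') * snd z + (\<theta> - \<theta>')) +
    c * d / 2 * cos (of_int (k + k') * fst z + of_int (l + l') * snd z + (\<theta> + \<theta>'))" for z :: "real \<times> real"
  proof -
    let ?a = "of_int k * fst z + of_int l * snd z + \<theta>"
    let ?b = "of_int k' * fst z + of_int l' * snd z + \<theta>'"
    have 1: "of_int (k - k') * fst z + of_int (l - l') * snd z + (\<theta> - \<theta>') = ?a - ?b"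
      by (simp add: algebra_simps)
    have 2: "of_int (k + k') * fst z + of_int (l + l') * snd z + (\<theta> + \<theta>') = ?a + ?b"
      by (simp add: algebra_simps)
    show ?thesis unfolding 1 2 cos_add cos_diff by (simp add: field_simps)
  qed
  then show ?case by (simp only:) (intro trig_poly.intros)
next
  case (trig_poly_add f g)
  then show ?case by (simp only: distrib_left) (intro trig_poly.trig_poly_add)
qed

lemma trig_poly_mult: "trig_poly f \<Longrightarrow> trig_poly g \<Longrightarrow> trig_poly (\<lambda>z. f z * g z)"
proof (induction rule: trig_poly.induct)
  case (trig_poly_cos c k l \<theta>)
  then show ?case by (rule trig_poly_mult_cos)
next
  case (trig_poly_add f g)
  from trig_poly.trig_poly_add[OF trig_poly_add.IH(1) trig_poly_add.IH(2)] trig_poly_add.prems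
  show ?case by (simp add: distrib_right)
qed

lemma continuous_trig_poly: "trig_poly f \<Longrightarrow> continuous_on A f"
  by (induction rule: trig_poly.induct) (intro continuous_intros; assumption)+

lemma trig_poly_coords:
  "trig_poly (\<lambda>z. cos (fst z))" "trig_poly (\<lambda>z. sin (fst z))"
  "trig_poly (\<lambda>z. cos (snd z))" "trig_poly (\<lambda>z. sin (snd z))"
  using trig_poly_cos[of 1 1 0 0] trig_poly_cos[of 1 1 0 "- pi / 2"]
    trig_poly_cos[of 1 0 1 0] trig_poly_cos[of 1 0 1 "- pi / 2"]
  by (simp_all add: cos_diff)

text \<open>The torus as a compact subset of a four-dimensional Euclidean space, where trigonometric polynomials
  are restrictions of polynomials.\<close>

definition torus_embedding :: "real \<times> real \<Rightarrow> (real \<times> real) \<times> (real \<times> real)" where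
  "torus_embedding z = ((cos (fst z), sin (fst z)), (cos (snd z), sin (snd z)))"

lemma trig_poly_polynomial_embedding:
  assumes "real_polynomial_function P"
  shows "trig_poly (\<lambda>z. P (torus_embedding z))"
  using assms
proof (induction rule: real_polynomial_function.induct)
  case (linear f)
  interpret bounded_linear f by fact
  have "f (torus_embedding z) = (f ((1, 0), 0) * cos (fst z) + f ((0, 1), 0) * sin (fst z)) +
      (f (0, (1, 0)) * cos (snd z) + f (0, (0, 1)) * sin (snd z))" for z
  proof -
    have "torus_embedding z = (cos (fst z) *\<^sub>R ((1, 0), 0) + sin (fst z) *\<^sub>R ((0, 1), 0)) +
       (cos (snd z) *\<^sub>R (0, (1, 0)) + sin (snd z) *\<^sub>R (0, (0, 1)))"
      by (simp add: torus_embedding_def zero_prod_def)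
    then have "f (torus_embedding z) = f ((cos (fst z) *\<^sub>R ((1, 0), 0) + sin (fst z) *\<^sub>R ((0, 1), 0)) +
       (cos (snd z) *\<^sub>R (0, (1, 0)) + sin (snd z) *\<^sub>R (0, (0, 1))))" by simp
    then show ?thesis unfolding add scale by (simp add: mult.commute)
  qed
  then show ?case
    by (simp only:) (intro trig_poly_add trig_poly_cmult trig_poly_coords)
next
  case (const c)
  show ?case by (rule trig_poly_const)
next
  case (add f g)
  then show ?case by (intro trig_poly_add)
next
  case (mult f g)
  then show ?case by (intro trig_poly_mult)
qed

lemma torus_embedding_eq:
  assumes "z \<in> torus" "w \<in> torus" "torus_embedding z = torus_embedding w" "z \<noteq> w"
  shows "z \<in> frontier torus \<and> w \<in> frontier torus"
proof -
  have 1: "a = b \<or> (a = 0 \<and> b = 2 * pi) \<or> (a = 2 * pi \<and> b = 0)"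
    if ab: "a \<in> {0..2 * pi}" "b \<in> {0..2 * pi}" "cos a = cos b" "sin a = sin b" for a b :: real
  proof -
    have "sin a = sin b \<and> cos a = cos b" using ab by simp
    then obtain n :: int where n: "a = b + 2 * pi * n"
      unfolding sin_cos_eq_iff by auto
    have "\<bar>2 * pi * n\<bar> \<le> 2 * pi * 1" using n ab unfolding atLeastAtMost_iff by linarith
    then have "\<bar>real_of_int n\<bar> \<le> 1" by (simp only: abs_mult) simp
    then have "n = 0 \<or> n = 1 \<or> n = -1" by linarith
    then show ?thesis using n ab by auto
  qed
  have "interior torus = {0<..<2*pi} \<times> {0<..<2*pi}"
    by (simp add: torus_def interior_Times)
  then have fr: "u \<in> frontier torus" if "u \<in> torus" "fst u \<in> {0, 2 * pi} \<or> snd u \<in> {0, 2 * pi}" for u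
    using that compact_torus by (auto simp: frontier_def compact_imp_closed)
  have "fst z \<noteq> fst w \<or> snd z \<noteq> snd w" using assms(4) by (simp add: prod_eq_iff)
  then show ?thesis
    using assms 1[of "fst z" "fst w"] 1[of "snd z" "snd w"]
    by (intro conjI fr) (auto simp: torus_def torus_embedding_def)
qed

text \<open>A continuous function on the square that vanishes on the boundary factors through the embedding,
  which identifies only boundary points. The factor is continuous because the embedding of a compact
  set is a closed map, and Stone-Weierstrass applies to it.\<close>

lemma trig_poly_uniform_approx:
  fixes \<phi> :: "real \<times> real \<Rightarrow> real"
  assumes cont: "continuous_on torus \<phi>" and zero: "\<And>z. z \<in> frontier torus \<Longrightarrow> \<phi> z = 0" and "e > 0"
  obtains T where "trig_poly T" "\<And>z. z \<in> torus \<Longrightarrow> \<bar>\<phi> z - T z\<bar> < e"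
proof -
  define X where "X = torus_embedding ` torus"
  have cE: "continuous_on A torus_embedding" for A
    unfolding torus_embedding_def by (intro continuous_intros)
  have X: "compact X" unfolding X_def by (intro compact_continuous_image cE compact_torus)
  define \<psi> where "\<psi> w = \<phi> (SOME z. z \<in> torus \<and> torus_embedding z = w)" for w
  have \<psi>: "\<psi> (torus_embedding z) = \<phi> z" if "z \<in> torus" for z
  proof -
    define z' where "z' = (SOME z'. z' \<in> torus \<and> torus_embedding z' = torus_embedding z)"
    have z': "z' \<in> torus \<and> torus_embedding z' = torus_embedding z"
      unfolding z'_def by (rule someI[of _ z]) (use that in auto)
    have "\<phi> z' = \<phi> z"
    proof (cases "z' = z")
      case False
      then show ?thesis using torus_embedding_eq[of z' z] z' that zero by auto
    qed simp
    then show ?thesis unfolding \<psi>_def z'_def .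
  qed
  have "continuous_on X \<psi>"
    unfolding continuous_on_closed_vimage[OF compact_imp_closed[OF X]]
  proof (intro allI impI)
    fix B :: "real set" assume "closed B"
    have "\<psi> -` B \<inter> X = torus_embedding ` (torus \<inter> \<phi> -` B)"
      using \<psi> unfolding X_def by auto
    moreover have "compact (torus \<inter> \<phi> -` B)"
      using continuous_closed_preimage[OF cont compact_imp_closed[OF compact_torus] \<open>closed B\<close>]
        compact_torus by (metis bounded_Int compact_eq_bounded_closed)
    ultimately show "closed (\<psi> -` B \<inter> X)"
      by (simp add: compact_continuous_image[OF cE] compact_imp_closed)
  qed
  then obtain P where P: "real_polynomial_function P" "\<And>w. w \<in> X \<Longrightarrow> \<bar>\<psi> w - P w\<bar> < e"
    using Stone_Weierstrass_real_polynomial_function[OF X _ \<open>e > 0\<close>] by metis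
  show ?thesis
    by (rule that[OF trig_poly_polynomial_embedding[OF P(1)]])
       (use P(2) \<psi> in \<open>fastforce simp: X_def\<close>)
qed

text \<open>A bounded measurable function is an a.e. limit of continuous functions; these are truncated at
  \<open>M\<close> and multiplied by a cutoff that vanishes on the boundary of the square.\<close>

lemma trig_poly_bounded_approx:
  fixes \<phi> :: "real \<times> real \<Rightarrow> real"
  assumes m: "\<phi> \<in> borel_measurable lebesgue" and b: "\<And>z. \<bar>\<phi> z\<bar> \<le> M"
  obtains T where "\<And>n. trig_poly (T n)" "\<And>n z. z \<in> torus \<Longrightarrow> \<bar>T n z\<bar> \<le> M + 1"
    "AE z in torusM. (\<lambda>n. T n z) \<longlonglongrightarrow> \<phi> z"
proof -
  have M0: "M \<ge> 0" using b[of 0] by simp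
  have "\<phi> measurable_on UNIV" using m by (intro lebesgue_measurable_imp_measurable_on) auto
  then obtain N and g :: "nat \<Rightarrow> real \<times> real \<Rightarrow> real" where N: "negligible N" and cg: "\<And>n. continuous_on UNIV (g n)"
    and lim: "\<And>z. z \<notin> N \<Longrightarrow> (\<lambda>n. g n z) \<longlonglongrightarrow> \<phi> z"
    unfolding measurable_on_def by auto
  \<comment> \<open>\<open>d\<close> is positive inside the square and zero on its boundary, so the cutoffs tend to \<open>1\<close> inside\<close>
  define d where "d z = fst z * (2 * pi - fst z) * (snd z * (2 * pi - snd z))" for z :: "real \<times> real"
  define ct where "ct n z = min 1 (real n * d z)" for n :: nat and z
  define h where "h n z = ct n z * max (- M) (min M (g n z))" for n z
  have intr: "interior torus = {0<..<2*pi} \<times> {0<..<2*pi}"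
    by (simp add: torus_def interior_Times)
  have d0: "d z \<ge> 0" if "z \<in> torus" for z using that by (auto simp: d_def torus_def)
  have dpos: "d z > 0" if "z \<in> interior torus" for z using that intr by (auto simp: d_def)
  have dz: "d z = 0" if "z \<in> frontier torus" for z
  proof -
    have "z \<in> torus" "z \<notin> interior torus"
      using that compact_torus by (auto simp: frontier_def compact_imp_closed)
    then show ?thesis unfolding intr by (auto simp: torus_def d_def)
  qed
  have "\<exists>T. trig_poly T \<and> (\<forall>z\<in>torus. \<bar>h n z - T z\<bar> < 1 / real (Suc n))" for n
  proof -
    have "continuous_on torus (h n)"
      unfolding h_def ct_def d_def
      by (intro continuous_intros continuous_on_subset[OF cg]) auto
    moreover have "h n z = 0" if "z \<in> frontier torus" for z
      using dz[OF that] by (simp add: h_def ct_def)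
    ultimately show ?thesis
      using trig_poly_uniform_approx[of "h n" "1 / real (Suc n)"] by (metis of_nat_0_less_iff zero_less_Suc zero_less_divide_1_iff)
  qed
  then obtain T where T: "\<And>n. trig_poly (T n)" "\<And>n z. z \<in> torus \<Longrightarrow> \<bar>h n z - T n z\<bar> < 1 / real (Suc n)"
    by metis
  have hb: "\<bar>h n z\<bar> \<le> M" if "z \<in> torus" for n z
  proof -
    have "\<bar>h n z\<bar> = ct n z * \<bar>max (- M) (min M (g n z))\<bar>"
      using d0[OF that] by (simp add: h_def ct_def abs_mult)
    also have "\<dots> \<le> 1 * M"
      using d0[OF that] M0 by (intro mult_mono) (auto simp: ct_def)
    finally show ?thesis by simp
  qed
  have limz: "(\<lambda>n. T n z) \<longlonglongrightarrow> \<phi> z" if z: "z \<in> interior torus" "z \<notin> N" for z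
  proof -
    have zt: "z \<in> torus" using z interior_subset by blast
    have "eventually (\<lambda>n. ct n z = 1) sequentially"
    proof -
      obtain n0 :: nat where n0: "1 / d z \<le> real n0" using real_arch_simple by blast
      have "ct n z = 1" if "n \<ge> n0" for n
      proof -
        have "1 / d z \<le> real n" using n0 that by linarith
        then show ?thesis using dpos[OF z(1)] by (simp add: ct_def field_simps)
      qed
      then show ?thesis unfolding eventually_sequentially by blast
    qed
    then have c1: "(\<lambda>n. ct n z) \<longlonglongrightarrow> 1" by (simp add: tendsto_eventually)
    have "(\<lambda>n. max (- M) (min M (g n z))) \<longlonglongrightarrow> max (- M) (min M (\<phi> z))"
      by (intro tendsto_intros lim z)
    moreover have "max (- M) (min M (\<phi> z)) = \<phi> z" using b[of z] by auto
    ultimately have hl: "(\<lambda>n. h n z) \<longlonglongrightarrow> 1 * \<phi> z" unfolding h_def using c1 by (intro tendsto_mult) auto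
    have "(\<lambda>n. h n z - T n z) \<longlonglongrightarrow> 0"
    proof (rule Lim_null_comparison)
      show "eventually (\<lambda>n. norm (h n z - T n z) \<le> 1 / real (Suc n)) sequentially"
        using T(2)[OF zt] by (auto intro!: always_eventually less_imp_le)
      show "(\<lambda>n. 1 / real (Suc n)) \<longlonglongrightarrow> 0" using LIMSEQ_inverse_real_of_nat by (simp add: inverse_eq_divide)
    qed
    from tendsto_diff[OF hl this] show ?thesis by simp
  qed
  show ?thesis
  proof (rule that[OF T(1)])
    show "\<bar>T n z\<bar> \<le> M + 1" if "z \<in> torus" for n z
    proof -
      have "1 / real (Suc n) \<le> 1" by simp
      then show ?thesis using T(2)[OF that, of n] hb[OF that, of n] by linarith
    qed
    have "negligible (frontier torus)"
      by (simp add: torus_eq_cbox negligible_convex_frontier)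
    then have "negligible (N \<union> frontier torus)" using N by (rule negligible_Un[rotated])
    then have "AE z in lebesgue. z \<notin> N \<union> frontier torus"
      unfolding negligible_iff_null_sets by (rule AE_not_in)
    then have "AE z in lebesgue. z \<in> torus \<longrightarrow> (\<lambda>n. T n z) \<longlonglongrightarrow> \<phi> z"
    proof eventually_elim
      case (elim z)
      then show ?case using limz[of z] compact_torus by (auto simp: frontier_def compact_imp_closed)
    qed
    then show "AE z in torusM. (\<lambda>n. T n z) \<longlonglongrightarrow> \<phi> z"
      by (simp add: AE_restrict_space_iff)
  qed
qed

text \<open>The \<open>L\<^sub>p\<close> norm is determined by testing against trigonometric polynomials. This contains the
  completeness of the trigonometric system: it is how the Fourier coefficients control a function.\<close>

theorem Lp_norm_le_of_trig_poly_dual: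
  assumes F: "F \<in> Lp_torus p" and pq: "p > 1" "q > 1" "1 / p + 1 / q = 1" and K: "K \<ge> 0"
    and dual: "\<And>T. trig_poly T \<Longrightarrow> \<bar>(LINT z|torusM. F z * T z)\<bar> \<le> K * Lp_norm q T"
  shows "Lp_norm p F \<le> K"
proof -
  interpret finite_measure torusM by (rule finite_measure_torus)
  have mF: "F \<in> borel_measurable lebesgue" and iF: "integrable torusM (\<lambda>z. \<bar>F z\<bar> powr p)"
    using F by (auto simp: Lp_torus_iff)
  have mF': "F \<in> borel_measurable torusM" using mF by measurable
  have "integrable torusM (\<lambda>z. F z * 1)"
    by (rule integrable_mult_Lp[OF mF' iF _ _ pq]) (auto intro: integrable_torus_continuous)
  then have iF1: "integrable torusM F" by simp
  have bd: "\<bar>(LINT z|torusM. F z * \<phi> z)\<bar> \<le> K * Lp_norm q \<phi>"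
    if m: "\<phi> \<in> borel_measurable lebesgue" and b: "\<And>z. \<bar>\<phi> z\<bar> \<le> M" for \<phi> :: "real \<times> real \<Rightarrow> real" and M
  proof -
    obtain T where T: "\<And>n. trig_poly (T n)" "\<And>n z. z \<in> torus \<Longrightarrow> \<bar>T n z\<bar> \<le> M + 1"
      "AE z in torusM. (\<lambda>n. T n z) \<longlonglongrightarrow> \<phi> z"
      using trig_poly_bounded_approx[OF m b] by blast
    have m': "\<phi> \<in> borel_measurable torusM" using m by measurable
    have mT: "T n \<in> borel_measurable torusM" for n
      using continuous_measurable_lebesgue[OF continuous_trig_poly[OF T(1)]] by measurable
    have ae: "AE z in torusM. z \<in> torus" by (simp add: AE_restrict_space_iff)
    have 1: "(\<lambda>n. (LINT z|torusM. F z * T n z)) \<longlonglongrightarrow> (LINT z|torusM. F z * \<phi> z)"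
    proof (rule integral_dominated_convergence[where w = "\<lambda>z. (M + 1) * \<bar>F z\<bar>"])
      show "AE z in torusM. (\<lambda>n. F z * T n z) \<longlonglongrightarrow> F z * \<phi> z"
        using T(3) by eventually_elim (intro tendsto_intros)
      show "AE z in torusM. norm (F z * T n z) \<le> (M + 1) * \<bar>F z\<bar>" for n
        using ae
      proof eventually_elim
        case (elim z)
        show ?case using mult_left_mono[OF T(2)[OF elim, of n], of "\<bar>F z\<bar>"] by (simp add: abs_mult mult.commute)
      qed
    qed (use iF1 mF' mT m' in auto)
    have 2: "(\<lambda>n. (LINT z|torusM. \<bar>T n z\<bar> powr q)) \<longlonglongrightarrow> (LINT z|torusM. \<bar>\<phi> z\<bar> powr q)"
    proof (rule integral_dominated_convergence[where w = "\<lambda>z. (M + 1) powr q"])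
      show "AE z in torusM. (\<lambda>n. \<bar>T n z\<bar> powr q) \<longlonglongrightarrow> \<bar>\<phi> z\<bar> powr q"
        using T(3) by eventually_elim (use pq in \<open>intro tendsto_powr' tendsto_intros; auto\<close>)
      show "AE z in torusM. norm (\<bar>T n z\<bar> powr q) \<le> (M + 1) powr q" for n
        using ae by eventually_elim (use T(2) pq in \<open>auto intro!: powr_mono2\<close>)
    qed (use mT m' in auto)
    have 3: "(\<lambda>n. K * Lp_norm q (T n)) \<longlonglongrightarrow> K * Lp_norm q \<phi>"
      unfolding Lp_norm_eq using pq by (intro tendsto_mult tendsto_const tendsto_powr' 2) auto
    show ?thesis
      by (rule LIMSEQ_le[OF tendsto_rabs[OF 1] 3]) (auto intro: dual T(1))
  qed
  have J: "(LINT z|torusM. (min \<bar>F z\<bar> R) powr p) \<le> K powr p" if R: "R \<ge> 0" for R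
  proof -
    \<comment> \<open>the extremal function in Hoelder's inequality, truncated at height \<open>R\<close> to make it bounded\<close>
    define \<phi> where "\<phi> z = sgn (F z) * (min \<bar>F z\<bar> R) powr (p - 1)" for z
    define J where "J = (LINT z|torusM. (min \<bar>F z\<bar> R) powr p)"
    have J0: "J \<ge> 0" unfolding J_def by simp
    have m: "\<phi> \<in> borel_measurable lebesgue" unfolding \<phi>_def using mF by measurable
    have b: "\<bar>\<phi> z\<bar> \<le> R powr (p - 1)" for z
      unfolding \<phi>_def using R pq by (auto simp: abs_mult sgn_if intro!: powr_mono2)
    have q: "(p - 1) * q = p" using pq by (simp add: field_simps)
    have "\<bar>\<phi> z\<bar> powr q = (min \<bar>F z\<bar> R) powr p" for z
      unfolding \<phi>_def using R pq q by (cases "F z = 0") (auto simp: abs_mult powr_powr sgn_if)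
    then have nq: "Lp_norm q \<phi> = J powr (1 / q)" unfolding Lp_norm_eq J_def by simp
    have ge: "(min \<bar>F z\<bar> R) powr p \<le> F z * \<phi> z" for z
    proof -
      have "(min \<bar>F z\<bar> R) powr p = (min \<bar>F z\<bar> R) powr 1 * (min \<bar>F z\<bar> R) powr (p - 1)"
        by (simp only: powr_add[symmetric]) simp
      also have "\<dots> \<le> \<bar>F z\<bar> * (min \<bar>F z\<bar> R) powr (p - 1)"
        using R by (intro mult_right_mono) auto
      also have "\<dots> = F z * \<phi> z" by (simp add: \<phi>_def abs_sgn mult.assoc)
      finally show ?thesis .
    qed
    have iFp: "integrable torusM (\<lambda>z. F z * \<phi> z)"
    proof (rule Bochner_Integration.integrable_bound)
      show "integrable torusM (\<lambda>z. R powr (p - 1) * \<bar>F z\<bar>)" using iF1 by auto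
      show "(\<lambda>z. F z * \<phi> z) \<in> borel_measurable torusM" using mF m by measurable
      show "AE z in torusM. norm (F z * \<phi> z) \<le> norm (R powr (p - 1) * \<bar>F z\<bar>)"
      proof (rule AE_I2)
        fix z
        show "norm (F z * \<phi> z) \<le> norm (R powr (p - 1) * \<bar>F z\<bar>)"
          using mult_left_mono[OF b[of z], of "\<bar>F z\<bar>"] by (simp add: abs_mult mult.commute)
      qed
    qed
    have "J \<le> (LINT z|torusM. F z * \<phi> z)"
      unfolding J_def
    proof (rule integral_mono)
      show "integrable torusM (\<lambda>z. (min \<bar>F z\<bar> R) powr p)"
      proof (rule Bochner_Integration.integrable_bound[OF iF])
        show "(\<lambda>z. min \<bar>F z\<bar> R powr p) \<in> borel_measurable torusM" using mF by measurable
        show "AE z in torusM. norm (min \<bar>F z\<bar> R powr p) \<le> norm (\<bar>F z\<bar> powr p)"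
          using R pq by (auto intro!: powr_mono2)
      qed
    qed (use iFp ge in auto)
    also have "\<dots> \<le> K * J powr (1 / q)" using bd[OF m b] nq by simp
    finally have le: "J \<le> K * J powr (1 / q)" .
    show ?thesis
    proof (cases "J = 0")
      case True
      then show ?thesis using J_def by simp
    next
      case False
      then have Jp: "J > 0" using J0 by simp
      have "J powr (1 / p) * J powr (1 / q) = J" using Jp pq by (simp add: powr_add[symmetric])
      then have "J powr (1 / p) * J powr (1 / q) \<le> K * J powr (1 / q)" using le by simp
      then have "J powr (1 / p) \<le> K" using Jp by simp
      then have "(J powr (1 / p)) powr p \<le> K powr p" using pq by (intro powr_mono2) auto
      then show ?thesis using Jp pq unfolding J_def[symmetric] by (simp add: powr_powr)
    qed
  qed
  have "(\<lambda>n. (LINT z|torusM. (min \<bar>F z\<bar> (real n)) powr p)) \<longlonglongrightarrow> (LINT z|torusM. \<bar>F z\<bar> powr p)"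
  proof (rule integral_dominated_convergence[OF _ _ iF])
    show "AE z in torusM. (\<lambda>n. min \<bar>F z\<bar> (real n) powr p) \<longlonglongrightarrow> \<bar>F z\<bar> powr p"
    proof (rule AE_I2, rule tendsto_eventually)
      fix z
      obtain n0 :: nat where n0: "\<bar>F z\<bar> \<le> real n0" using real_arch_simple by blast
      have "min \<bar>F z\<bar> (real n) powr p = \<bar>F z\<bar> powr p" if "n \<ge> n0" for n
      proof -
        have "\<bar>F z\<bar> \<le> real n" using n0 that by linarith
        then show ?thesis by simp
      qed
      then show "\<forall>\<^sub>F n in sequentially. min \<bar>F z\<bar> (real n) powr p = \<bar>F z\<bar> powr p"
        unfolding eventually_sequentially by blast
    qed
    show "AE z in torusM. norm (min \<bar>F z\<bar> (real n) powr p) \<le> \<bar>F z\<bar> powr p" for n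
      using pq by (auto intro!: powr_mono2)
  qed (use mF in measurable)
  then have "(LINT z|torusM. \<bar>F z\<bar> powr p) \<le> K powr p"
    by (rule LIMSEQ_le_const2) (use J in auto)
  then show ?thesis using pq K by (intro Lp_norm_le) auto
qed

section \<open>Lacunary Fourier coefficients\<close>

lemma integral_cos_mult_cos:
  fixes k l :: nat
  assumes "k > 0"
  shows "integral {0..2 * pi} (\<lambda>x. cos (k * x + a) * cos (l * x + b)) = (if k = l then pi * cos (a - b) else 0)"
proof -
  have "cos (k * x + a) * cos (l * x + b) =
     1 / 2 * cos (of_int (int k - int l) * x + (a - b)) + 1 / 2 * cos (of_int (int k + int l) * x + (a + b))" for x :: real
  proof -
    have 1: "of_int (int k - int l) * x + (a - b) = (k * x + a) - (l * x + b)" by (simp add: algebra_simps)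
    have 2: "of_int (int k + int l) * x + (a + b) = (k * x + a) + (l * x + b)" by (simp add: algebra_simps)
    show ?thesis unfolding 1 2 cos_times_cos by simp
  qed
  then have "integral {0..2 * pi} (\<lambda>x. cos (k * x + a) * cos (l * x + b)) =
     1 / 2 * integral {0..2 * pi} (\<lambda>x. cos (of_int (int k - int l) * x + (a - b))) +
     1 / 2 * integral {0..2 * pi} (\<lambda>x. cos (of_int (int k + int l) * x + (a + b)))"
    by (simp only:, subst integral_add) (auto intro!: integrable_continuous_interval continuous_intros simp del: of_int_diff of_int_add)
  moreover have "integral {0..2 * pi} (\<lambda>x. cos (of_int (int k + int l) * x + (a + b))) = 0"
    using assms by (intro integral_cos_nonzero_freq) auto
  moreover have "integral {0..2 * pi} (\<lambda>x. cos (of_int (int k - int l) * x + (a - b))) = (if k = l then 2 * pi * cos (a - b) else 0)"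
  proof (cases "k = l")
    case False
    then show ?thesis using integral_cos_nonzero_freq[of "int k - int l" "a - b"] by simp
  qed simp
  ultimately show ?thesis by (cases "k = l") auto
qed

lemma integral_lacunary_poly_mult:
  fixes k l :: nat
  shows "(LINT z|torusM. lacunary_poly N c \<phi> \<psi> z * cos_cos k l a b z) =
    pi\<^sup>2 * (\<Sum>i<N. \<Sum>j<N. if 2 ^ i = k \<and> 2 ^ j = l then c i j * cos (\<phi> i - a) * cos (\<psi> j - b) else 0)"
proof -
  have e: "lacunary_poly N c \<phi> \<psi> z * cos_cos k l a b z =
    (\<Sum>i<N. \<Sum>j<N. c i j * ((cos (2 ^ i * fst z + \<phi> i) * cos (k * fst z + a)) * (cos (2 ^ j * snd z + \<psi> j) * cos (l * snd z + b))))" for z :: "real \<times> real"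
    unfolding lacunary_poly_def sum_distrib_right by (simp add: mult_ac)
  have 1: "integral {0..2 * pi} (\<lambda>x. cos (2 ^ i * x + t) * cos (k * x + a)) = (if 2 ^ i = k then pi * cos (t - a) else 0)" for i k :: nat and t a :: real
    using integral_cos_mult_cos[of "2 ^ i" t k a] by simp
  have I: "(LINT z|torusM. c i j * ((cos (2 ^ i * fst z + \<phi> i) * cos (k * fst z + a)) * (cos (2 ^ j * snd z + \<psi> j) * cos (l * snd z + b)))) =
    c i j * ((if 2 ^ i = k then pi * cos (\<phi> i - a) else 0) * (if 2 ^ j = l then pi * cos (\<psi> j - b) else 0))" for i j
    by (subst Bochner_Integration.integral_mult_right_zero, subst integral_torus_product)
       (auto intro!: continuous_intros simp: 1)
  show ?thesis unfolding e
    apply (subst Bochner_Integration.integral_sum)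
     apply (intro integrable_torus_continuous continuous_intros)
    apply (subst Bochner_Integration.integral_sum)
     apply (intro integrable_torus_continuous continuous_intros)
    apply (simp only: I sum_distrib_left)
    apply (intro sum.cong refl)
    apply (auto simp: power2_eq_square)
    done
qed

text \<open>Orthogonality against a wave with the same phases picks out one coefficient.\<close>

lemma integral_lacunary_poly_mult_same:
  assumes "i < N" "j < N"
  shows "(LINT z|torusM. lacunary_poly N c \<phi> \<psi> z * cos_cos (2 ^ i) (2 ^ j) (\<phi> i) (\<psi> j) z) =
    pi\<^sup>2 * c i j"
proof -
  have "(\<Sum>i'<N. \<Sum>j'<N. if 2 ^ i' = (2 ^ i :: nat) \<and> 2 ^ j' = (2 ^ j :: nat) then c i' j' * cos (\<phi> i' - \<phi> i) * cos (\<psi> j' - \<psi> j) else 0) =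
     (\<Sum>i'<N. \<Sum>j'<N. if i' = i then if j' = j then c i j else 0 else 0)"
    by (intro sum.cong refl) auto
  also have "\<dots> = (\<Sum>i'<N. if i' = i then (\<Sum>j'<N. if j' = j then c i j else 0) else 0)"
    by (intro sum.cong refl) auto
  also have "\<dots> = c i j" using assms by simp
  finally show ?thesis
    using integral_lacunary_poly_mult[of N c \<phi> \<psi> "2 ^ i" "\<phi> i" "2 ^ j" "\<psi> j"] by simp
qed

lemma conjugate_exponent:
  fixes p :: real
  assumes "p > 1"
  obtains q where "q > 1" "1 / p + 1 / q = 1"
proof
  show "p / (p - 1) > 1" "1 / p + 1 / (p / (p - 1)) = 1"
    using assms by (auto simp: field_simps)
qed

lemma integrable_Lp_mult_continuous:
  assumes "g \<in> Lp_torus p" "p > 1" and h: "continuous_on UNIV h"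
  shows "integrable torusM (\<lambda>z. g z * h z)"
proof -
  obtain q where q: "q > 1" "1 / p + 1 / q = 1" using conjugate_exponent[OF assms(2)] by blast
  have "continuous_on torus (\<lambda>z. \<bar>h z\<bar> powr q)"
    using q by (intro continuous_on_powr' continuous_intros) (auto intro: continuous_on_subset[OF h])
  then show ?thesis
    using assms q continuous_measurable_lebesgue[OF h]
    by (intro integrable_mult_Lp[of g p h q]) (auto simp: Lp_torus_iff intro: measurable_torus_lebesgue)
qed

text \<open>The coefficient of \<open>g\<close> at the frequencies \<open>2 ^ i\<close> and \<open>2 ^ j\<close> with respect to waves with given phases; each
  wave has mean square \<open>1/2\<close>, whence the factor \<open>\<pi>\<^sup>2\<close>.\<close>

definition lacunary_coeff :: "(nat \<Rightarrow> real) \<Rightarrow> (nat \<Rightarrow> real) \<Rightarrow> (real \<times> real \<Rightarrow> real) \<Rightarrow> nat \<Rightarrow> nat \<Rightarrow> real" where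
  "lacunary_coeff \<phi> \<psi> g i j =
     (LINT z|torusM. g z * cos_cos (2 ^ i) (2 ^ j) (\<phi> i) (\<psi> j) z) / pi\<^sup>2"

lemma lacunary_coeff_lacunary_poly:
  "i < N \<Longrightarrow> j < N \<Longrightarrow> lacunary_coeff \<phi> \<psi> (lacunary_poly N c \<phi> \<psi>) i j = c i j"
  unfolding lacunary_coeff_def by (simp add: integral_lacunary_poly_mult_same)

text \<open>Bessel's inequality in \<open>L\<^sub>p\<close>, also for \<open>p < 2\<close>: it is dual to the upper bound for the conjugate
  exponent, \<open>g\<close> being paired with the lacunary sum of its own coefficients.\<close>

theorem lacunary_bessel:
  assumes p: "p > 1"
  shows "\<exists>C>0. \<forall>N \<phi> \<psi>. \<forall>g\<in>Lp_torus p.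
    sqrt (\<Sum>i<N. \<Sum>j<N. (lacunary_coeff \<phi> \<psi> g i j)\<^sup>2) \<le> C * Lp_norm p g"
proof -
  obtain q where q: "q > 1" "1 / p + 1 / q = 1" using conjugate_exponent[OF p] by blast
  have "q > 0" using q by simp
  then obtain C where C: "C > 0" "\<And>N c \<phi> \<psi>. Lp_norm q (lacunary_poly N c \<phi> \<psi>) \<le> C * sqrt (\<Sum>i<N. \<Sum>j<N. (c i j)\<^sup>2)"
    using lacunary_Lp_upper by blast
  show ?thesis
  proof (intro exI[of _ "C / pi\<^sup>2"] conjI allI ballI)
    show "C / pi\<^sup>2 > 0" using C by simp
    fix N \<phi> \<psi> g
    assume g: "g \<in> Lp_torus p"
    define c where "c = lacunary_coeff \<phi> \<psi> g"
    define s where "s = (\<Sum>i<N. \<Sum>j<N. (c i j)\<^sup>2)"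
    have s0: "s \<ge> 0" unfolding s_def by (intro sum_nonneg) auto
    let ?h = "lacunary_poly N c \<phi> \<psi>"
    have int: "integrable torusM (\<lambda>z. g z * cos_cos (2 ^ i) (2 ^ j) (\<phi> i) (\<psi> j) z)" for i j
      by (intro integrable_Lp_mult_continuous[OF g p] continuous_intros)
    have e: "g z * ?h z = (\<Sum>i<N. \<Sum>j<N. c i j * (g z * cos_cos (2 ^ i) (2 ^ j) (\<phi> i) (\<psi> j) z))" for z
      unfolding lacunary_poly_def sum_distrib_left by (simp add: mult_ac)
    have "(LINT z|torusM. g z * ?h z) =
      (\<Sum>i<N. \<Sum>j<N. c i j * (LINT z|torusM. g z * cos_cos (2 ^ i) (2 ^ j) (\<phi> i) (\<psi> j) z))"
      unfolding e
      by (subst Bochner_Integration.integral_sum, intro Bochner_Integration.integrable_sum integrable_mult_right int)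
         (subst Bochner_Integration.integral_sum, intro integrable_mult_right int, simp)
    also have "\<dots> = (\<Sum>i<N. \<Sum>j<N. pi\<^sup>2 * (c i j)\<^sup>2)"
      by (intro sum.cong refl) (simp add: c_def lacunary_coeff_def power2_eq_square)
    also have "\<dots> = pi\<^sup>2 * s" unfolding s_def by (simp add: sum_distrib_left)
    finally have I: "(LINT z|torusM. g z * ?h z) = pi\<^sup>2 * s" .
    have "\<bar>(LINT z|torusM. g z * ?h z)\<bar> \<le> Lp_norm p g * Lp_norm q ?h"
      using g lacunary_poly_Lp[of q N c \<phi> \<psi>] q p
      by (intro Holder_torus) (auto simp: Lp_torus_iff intro: measurable_torus_lebesgue)
    also have "\<dots> \<le> Lp_norm p g * (C * sqrt s)"
      unfolding s_def by (intro mult_left_mono C) auto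
    finally have le: "pi\<^sup>2 * s \<le> Lp_norm p g * (C * sqrt s)" using I s0 by simp
    show "sqrt (\<Sum>i<N. \<Sum>j<N. (lacunary_coeff \<phi> \<psi> g i j)\<^sup>2) \<le> C / pi\<^sup>2 * Lp_norm p g"
    proof (cases "s = 0")
      case True
      then show ?thesis unfolding c_def[symmetric] s_def[symmetric] using C by simp
    next
      case False
      then have sp: "sqrt s > 0" using s0 by simp
      have "(pi\<^sup>2 * sqrt s) * sqrt s \<le> (Lp_norm p g * C) * sqrt s"
        using le s0 by (simp add: mult.assoc)
      then have "pi\<^sup>2 * sqrt s \<le> Lp_norm p g * C" using sp by simp
      then show ?thesis unfolding c_def[symmetric] s_def[symmetric] by (simp add: field_simps)
    qed
  qed
qed

lemma lacunary_Lp_lower: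
  assumes p: "p > 1"
  obtains C where "C > 0"
    "\<And>N c \<phi> \<psi>. sqrt (\<Sum>i<N. \<Sum>j<N. (c i j)\<^sup>2) \<le> C * Lp_norm p (lacunary_poly N c \<phi> \<psi>)"
proof -
  obtain C where C: "C > 0" "\<forall>N \<phi> \<psi>. \<forall>g\<in>Lp_torus p.
      sqrt (\<Sum>i<N. \<Sum>j<N. (lacunary_coeff \<phi> \<psi> g i j)\<^sup>2) \<le> C * Lp_norm p g"
    using lacunary_bessel[OF p] by blast
  show ?thesis
  proof (rule that[OF C(1)])
    fix N c \<phi> \<psi>
    have "lacunary_poly N c \<phi> \<psi> \<in> Lp_torus p" using p by (intro lacunary_poly_Lp) simp
    then have "sqrt (\<Sum>i<N. \<Sum>j<N. (lacunary_coeff \<phi> \<psi> (lacunary_poly N c \<phi> \<psi>) i j)\<^sup>2) \<le> C * Lp_norm p (lacunary_poly N c \<phi> \<psi>)"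
      using C(2) by blast
    then show "sqrt (\<Sum>i<N. \<Sum>j<N. (c i j)\<^sup>2) \<le> C * Lp_norm p (lacunary_poly N c \<phi> \<psi>)"
      by (simp add: lacunary_coeff_lacunary_poly)
  qed
qed

text \<open>The Fourier coefficients of \<open>F\<close> vanish, except for those of \<open>cos (2 ^ i * x) * cos (2 ^ j * y)\<close>, which
  are \<open>c i j\<close>. The phases \<open>a\<close> and \<open>b\<close> cover cosines and sines at once.\<close>

definition has_lacunary_coeffs :: "(real \<times> real \<Rightarrow> real) \<Rightarrow> (nat \<Rightarrow> nat \<Rightarrow> real) \<Rightarrow> bool" where
  "has_lacunary_coeffs F c \<longleftrightarrow>
     (\<forall>i j a b. (LINT z|torusM. F z * cos_cos (real (2 ^ i)) (real (2 ^ j)) a b z) =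
        pi\<^sup>2 * c i j * cos a * cos b) \<and>
     (\<forall>(k::nat) (l::nat) a b. (\<nexists>i j. k = 2 ^ i \<and> l = 2 ^ j) \<longrightarrow>
        (LINT z|torusM. F z * cos_cos (real k) (real l) a b z) = 0)"

lemma has_lacunary_coeffs_lacunary_poly:
  "has_lacunary_coeffs (cos_poly N c) (\<lambda>i j. if i < N \<and> j < N then c i j else 0)"
  unfolding has_lacunary_coeffs_def
proof (intro conjI allI impI)
  fix i j a b
  have "(\<Sum>i'<N. \<Sum>j'<N. if 2 ^ i' = (2 ^ i :: nat) \<and> 2 ^ j' = (2 ^ j :: nat) then c i' j' * cos (0 - a) * cos (0 - b) else 0) =
     (\<Sum>i'<N. \<Sum>j'<N. if i' = i then if j' = j then c i j * cos a * cos b else 0 else 0)"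
    by (intro sum.cong refl) auto
  also have "\<dots> = (\<Sum>i'<N. if i' = i then (\<Sum>j'<N. if j' = j then c i j * cos a * cos b else 0) else 0)"
    by (intro sum.cong refl) auto
  also have "\<dots> = (if i < N \<and> j < N then c i j else 0) * cos a * cos b" by simp
  finally show "(LINT z|torusM. cos_poly N c z * cos_cos (real (2 ^ i)) (real (2 ^ j)) a b z) =
        pi\<^sup>2 * (if i < N \<and> j < N then c i j else 0) * cos a * cos b"
    unfolding integral_lacunary_poly_mult by simp
next
  fix k l :: nat and a b
  assume "\<nexists>i j. k = 2 ^ i \<and> l = 2 ^ j"
  then have N: "(2 ^ i = k \<and> 2 ^ j = l) = False" for i j by auto
  then show "(LINT z|torusM. cos_poly N c z * cos_cos (real k) (real l) a b z) = 0"
    unfolding integral_lacunary_poly_mult N by simp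
qed

lemma has_lacunary_coeffs_diff:
  assumes "F \<in> Lp_torus p" "G \<in> Lp_torus p" "p > 1" "has_lacunary_coeffs F c" "has_lacunary_coeffs G d"
  shows "has_lacunary_coeffs (\<lambda>z. F z - G z) (\<lambda>i j. c i j - d i j)"
proof -
  have "(LINT z|torusM. (F z - G z) * cos_cos k l a b z) =
    (LINT z|torusM. F z * cos_cos k l a b z) -
    (LINT z|torusM. G z * cos_cos k l a b z)" for k a l b :: real
    unfolding left_diff_distrib
    by (intro Bochner_Integration.integral_diff integrable_Lp_mult_continuous[OF assms(1,3)] integrable_Lp_mult_continuous[OF assms(2,3)] continuous_intros)
  note diff = this
  show ?thesis
    unfolding has_lacunary_coeffs_def diff
  proof (intro conjI allI impI)
    fix i j and a b :: real
    let ?I = "\<lambda>F. (LINT z|torusM. F z * cos_cos (real (2 ^ i)) (real (2 ^ j)) a b z)"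
    have "?I F = pi\<^sup>2 * c i j * cos a * cos b" "?I G = pi\<^sup>2 * d i j * cos a * cos b"
      using assms(4,5) unfolding has_lacunary_coeffs_def by blast+
    then show "?I F - ?I G = pi\<^sup>2 * (c i j - d i j) * cos a * cos b" by (simp only: algebra_simps)
  next
    fix k l :: nat and a b :: real
    let ?I = "\<lambda>F. (LINT z|torusM. F z * cos_cos (real k) (real l) a b z)"
    assume "\<nexists>i j. k = 2 ^ i \<and> l = 2 ^ j"
    then have "?I F = 0" "?I G = 0"
      using assms(4,5) unfolding has_lacunary_coeffs_def by blast+
    then show "?I F - ?I G = 0" by (simp only: diff_self)
  qed
qed

lemma has_lacunary_coeffs_coeff:
  assumes "has_lacunary_coeffs f c"
  shows "lacunary_coeff (\<lambda>_. 0) (\<lambda>_. 0) f i j = c i j"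
proof -
  have "(LINT z|torusM. f z * cos_cos (real (2 ^ i)) (real (2 ^ j)) 0 0 z) = pi\<^sup>2 * c i j * cos 0 * cos 0"
    using assms unfolding has_lacunary_coeffs_def by blast
  then show ?thesis by (simp add: lacunary_coeff_def)
qed

lemma integral_lacunary_cos:
  fixes k l :: int
  assumes F: "F \<in> Lp_torus p" "p > 1" and c: "has_lacunary_coeffs F c"
  shows "(LINT z|torusM. F z * cos (of_int k * fst z + of_int l * snd z + \<theta>)) =
    (if \<exists>i j. nat \<bar>k\<bar> = 2 ^ i \<and> nat \<bar>l\<bar> = 2 ^ j
     then pi\<^sup>2 * cos \<theta> * c (THE i. nat \<bar>k\<bar> = 2 ^ i) (THE j. nat \<bar>l\<bar> = 2 ^ j) else 0)"
proof -
  define sk where "sk = (if k \<ge> 0 then 1 else - 1 :: real)"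
  define sl where "sl = (if l \<ge> 0 then 1 else - 1 :: real)"
  let ?k = "nat \<bar>k\<bar>" and ?l = "nat \<bar>l\<bar>"
  let ?I = "\<lambda>a b. (LINT z|torusM. F z * cos_cos (real ?k) (real ?l) a b z)"
  have e: "cos (of_int k * x + of_int l * y + \<theta>) =
     cos (real ?k * x + 0) * cos (real ?l * y + sl * \<theta>) - sk * (cos (real ?k * x + - (pi / 2)) * cos (real ?l * y + sl * (\<theta> - pi / 2)))" for x y :: real
  proof -
    have 1: "cos (of_int k * x) = cos (real ?k * x + 0)"
      by (cases "k \<ge> 0") auto
    have 2: "sin (of_int k * x) = sk * cos (real ?k * x + - (pi / 2))"
      by (cases "k \<ge> 0") (auto simp: sk_def cos_add cos_diff)
    have 3: "cos (of_int l * y + t) = cos (real ?l * y + sl * t)" for t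
    proof (cases "l \<ge> 0")
      case False
      then have "real ?l * y + sl * t = - (of_int l * y + t)" by (simp add: sl_def)
      then show ?thesis by (simp only: cos_minus)
    qed (simp add: sl_def)
    have 4: "sin (of_int l * y + \<theta>) = cos (of_int l * y + (\<theta> - pi / 2))"
      using cos_diff[of "of_int l * y + \<theta>" "pi / 2"] by (simp add: add_diff_eq)
    have "cos (of_int k * x + of_int l * y + \<theta>) = cos (of_int k * x) * cos (of_int l * y + \<theta>) - sin (of_int k * x) * sin (of_int l * y + \<theta>)"
      by (simp only: add.assoc cos_add)
    then show ?thesis unfolding 1 2 4 3[of \<theta>] 3[of "\<theta> - pi / 2"] by simp
  qed
  have int: "integrable torusM (\<lambda>z. F z * cos_cos (real ?k) (real ?l) a b z)" for a b
    by (intro integrable_Lp_mult_continuous[OF F] continuous_intros)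
  have "(LINT z|torusM. F z * cos (of_int k * fst z + of_int l * snd z + \<theta>)) =
    (LINT z|torusM. F z * cos_cos (real ?k) (real ?l) 0 (sl * \<theta>) z -
      sk * (F z * cos_cos (real ?k) (real ?l) (- (pi / 2)) (sl * (\<theta> - pi / 2)) z))"
    unfolding e by (simp only: right_diff_distrib mult.left_commute)
  also have "\<dots> = ?I 0 (sl * \<theta>) - sk * ?I (- (pi / 2)) (sl * (\<theta> - pi / 2))"
    by (subst Bochner_Integration.integral_diff) (intro int integrable_mult_right, intro int integrable_mult_right, simp)
  finally have main: "(LINT z|torusM. F z * cos (of_int k * fst z + of_int l * snd z + \<theta>)) =
    ?I 0 (sl * \<theta>) - sk * ?I (- (pi / 2)) (sl * (\<theta> - pi / 2))" .
  have sl: "cos (sl * \<theta>) = cos \<theta>" by (simp add: sl_def)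
  show ?thesis
  proof (cases "\<exists>i j. ?k = 2 ^ i \<and> ?l = 2 ^ j")
    case True
    then obtain i j where ij: "?k = 2 ^ i" "?l = 2 ^ j" by auto
    have the: "(THE i. ?k = 2 ^ i) = i" "(THE j. ?l = 2 ^ j) = j"
      using ij by auto
    have "?I a b = pi\<^sup>2 * c i j * cos a * cos b" for a b
      using c unfolding ij has_lacunary_coeffs_def by blast
    note Iab = this
    show ?thesis using True unfolding main the Iab sl
      by simp
  next
    case False
    then have Iab: "?I a b = 0" for a b using c unfolding has_lacunary_coeffs_def by blast
    show ?thesis unfolding main Iab by (subst if_not_P[OF False]) simp
  qed
qed

text \<open>On functions with lacunary coefficients, integration against a trigonometric polynomial is a finite
  bilinear form in the coefficients. The coefficients \<open>t\<close> depend on \<open>T\<close> alone.\<close>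

lemma trig_poly_pairing:
  assumes "trig_poly T" "p > 1"
  shows "\<exists>t M. \<forall>F c M'. F \<in> Lp_torus p \<longrightarrow> has_lacunary_coeffs F c \<longrightarrow> M' \<ge> M \<longrightarrow>
     (LINT z|torusM. F z * T z) = pi\<^sup>2 * (\<Sum>i<M'. \<Sum>j<M'. c i j * t i j)"
  using assms(1)
proof (induction rule: trig_poly.induct)
    case (trig_poly_cos d k l \<theta>)
    have I: "(LINT z|torusM. F z * (d * cos (of_int k * fst z + of_int l * snd z + \<theta>))) =
       d * (LINT z|torusM. F z * cos (of_int k * fst z + of_int l * snd z + \<theta>))" for F
      by (simp add: mult.left_commute[of _ d])
    show ?case
    proof (cases "\<exists>i j. nat \<bar>k\<bar> = 2 ^ i \<and> nat \<bar>l\<bar> = 2 ^ j")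
      case True
      then obtain i0 j0 where ij: "nat \<bar>k\<bar> = 2 ^ i0" "nat \<bar>l\<bar> = 2 ^ j0" by auto
      have the: "(THE i. nat \<bar>k\<bar> = 2 ^ i) = i0" "(THE j. nat \<bar>l\<bar> = 2 ^ j) = j0" using ij by auto
      have S: "(\<Sum>i<M'. \<Sum>j<M'. c i j * (if i = i0 then if j = j0 then d * cos \<theta> else 0 else 0)) = c i0 j0 * (d * cos \<theta>)"
        if "M' \<ge> Suc (max i0 j0)" for M' and c :: "nat \<Rightarrow> nat \<Rightarrow> real"
      proof -
        have "(\<Sum>i<M'. \<Sum>j<M'. c i j * (if i = i0 then if j = j0 then d * cos \<theta> else 0 else 0)) =
          (\<Sum>i<M'. if i = i0 then (\<Sum>j<M'. if j = j0 then c i0 j0 * (d * cos \<theta>) else 0) else 0)"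
        proof (intro sum.cong refl)
          fix i
          have "(\<Sum>j<M'. c i0 j * (if j = j0 then d * cos \<theta> else 0)) = (\<Sum>j<M'. if j = j0 then c i0 j0 * (d * cos \<theta>) else 0)"
            by (intro sum.cong refl) auto
          then show "(\<Sum>j<M'. c i j * (if i = i0 then if j = j0 then d * cos \<theta> else 0 else 0)) =
            (if i = i0 then (\<Sum>j<M'. if j = j0 then c i0 j0 * (d * cos \<theta>) else 0) else 0)"
            by simp
        qed
        then show ?thesis using that by (simp add: Suc_le_eq)
      qed
      show ?thesis
        by (rule exI[of _ "\<lambda>i j. if i = i0 then if j = j0 then d * cos \<theta> else 0 else 0"], rule exI[of _ "Suc (max i0 j0)"])
           (intro allI impI, simp only: I integral_lacunary_cos[OF _ assms(2)] S the True if_True, simp)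
    next
      case False
      show ?thesis
        by (rule exI[of _ "\<lambda>i j. 0"], rule exI[of _ "0"])
           (use False in \<open>auto simp: I integral_lacunary_cos[OF _ assms(2)]\<close>)
    qed
  next
    case (trig_poly_add f g)
    obtain t M where 1: "\<forall>F c M'. F \<in> Lp_torus p \<longrightarrow> has_lacunary_coeffs F c \<longrightarrow> M' \<ge> M \<longrightarrow>
     (LINT z|torusM. F z * f z) = pi\<^sup>2 * (\<Sum>i<M'. \<Sum>j<M'. c i j * t i j)"
      using trig_poly_add.IH(1) by blast
    obtain t' L where 2: "\<forall>F c M'. F \<in> Lp_torus p \<longrightarrow> has_lacunary_coeffs F c \<longrightarrow> M' \<ge> L \<longrightarrow>
     (LINT z|torusM. F z * g z) = pi\<^sup>2 * (\<Sum>i<M'. \<Sum>j<M'. c i j * t' i j)"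
      using trig_poly_add.IH(2) by blast
    have "(LINT z|torusM. F z * (f z + g z)) = pi\<^sup>2 * (\<Sum>i<M'. \<Sum>j<M'. c i j * (t i j + t' i j))"
      if h: "F \<in> Lp_torus p" "has_lacunary_coeffs F c" "M' \<ge> max M L" for F c M'
    proof -
      have "(LINT z|torusM. F z * (f z + g z)) =
         (LINT z|torusM. F z * f z) + (LINT z|torusM. F z * g z)"
        unfolding distrib_left
        by (intro Bochner_Integration.integral_add integrable_Lp_mult_continuous[OF h(1) assms(2)] continuous_trig_poly trig_poly_add)
      also have "\<dots> = pi\<^sup>2 * (\<Sum>i<M'. \<Sum>j<M'. c i j * (t i j + t' i j))"
        using 1[rule_format, OF h(1,2), of M'] 2[rule_format, OF h(1,2), of M'] h(3) by (simp add: distrib_left sum.distrib)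
      finally show ?thesis .
    qed
    note sum = this
    show ?case
      by (rule exI[of _ "\<lambda>i j. t i j + t' i j"], rule exI[of _ "max M L"], intro allI impI, rule sum)
qed

lemma double_sum_cauchy_schwarz:
  fixes c t :: "nat \<Rightarrow> nat \<Rightarrow> real"
  shows "\<bar>\<Sum>i<M. \<Sum>j<M. c i j * t i j\<bar> \<le> sqrt (\<Sum>i<M. \<Sum>j<M. (c i j)\<^sup>2) * sqrt (\<Sum>i<M. \<Sum>j<M. (t i j)\<^sup>2)"
proof -
  let ?A = "{..<M} \<times> {..<M}"
  let ?c = "\<lambda>x. c (fst x) (snd x)" and ?t = "\<lambda>x. t (fst x) (snd x)"
  have "\<bar>\<Sum>x\<in>?A. ?c x * ?t x\<bar> \<le> (\<Sum>x\<in>?A. \<bar>?c x\<bar> * \<bar>?t x\<bar>)"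
    by (rule order_trans[OF sum_abs]) (simp add: abs_mult)
  also have "\<dots> \<le> L2_set ?c ?A * L2_set ?t ?A" by (rule L2_set_mult_ineq)
  finally show ?thesis
    unfolding L2_set_def sum.cartesian_product by (simp add: case_prod_unfold)
qed

text \<open>Zygmund's upper bound for infinite lacunary series. In the pairing of \<open>F\<close> with a trigonometric
  polynomial \<open>T\<close> only the lacunary coefficients \<open>t\<close> of \<open>T\<close> matter, and by duality their \<open>l\<^sub>2\<close> norm is
  bounded by the norm of \<open>T\<close>.\<close>

theorem Lp_norm_le_lacunary_coeffs:
  assumes p: "p > 1"
  shows "\<exists>C>0. \<forall>F c s. F \<in> Lp_torus p \<longrightarrow> has_lacunary_coeffs F c \<longrightarrow>
      (\<forall>M. sqrt (\<Sum>i<M. \<Sum>j<M. (c i j)\<^sup>2) \<le> s) \<longrightarrow> Lp_norm p F \<le> C * s"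
proof -
  obtain q where q: "q > 1" "1 / p + 1 / q = 1" using conjugate_exponent[OF p] by blast
  have "p > 0" using p by simp
  then obtain C where C: "C > 0" "\<And>N c \<phi> \<psi>. Lp_norm p (lacunary_poly N c \<phi> \<psi>) \<le> C * sqrt (\<Sum>i<N. \<Sum>j<N. (c i j)\<^sup>2)"
    using lacunary_Lp_upper by blast
  show ?thesis
  proof (intro exI[of _ C] conjI allI impI)
    show "C > 0" by (rule C(1))
    fix F c s
    assume F: "F \<in> Lp_torus p" "has_lacunary_coeffs F c" and "\<forall>M. sqrt (\<Sum>i<M. \<Sum>j<M. (c i j)\<^sup>2) \<le> s"
    then have s: "sqrt (\<Sum>i<M. \<Sum>j<M. (c i j)\<^sup>2) \<le> s" for M by blast
    have s0: "s \<ge> 0" using s[of 0] by simp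
    show "Lp_norm p F \<le> C * s"
    proof (rule Lp_norm_le_of_trig_poly_dual[OF F(1) p q])
      show "C * s \<ge> 0" using C s0 by simp
      fix T assume T: "trig_poly T"
      obtain t M where tM: "\<forall>F c M'. F \<in> Lp_torus p \<longrightarrow> has_lacunary_coeffs F c \<longrightarrow> M' \<ge> M \<longrightarrow>
         (LINT z|torusM. F z * T z) = pi\<^sup>2 * (\<Sum>i<M'. \<Sum>j<M'. c i j * t i j)"
        using trig_poly_pairing[OF T p] by blast
      \<comment> \<open>the sum of the coefficients of \<open>T\<close> itself: paired with \<open>T\<close> it yields their squares\<close>
      define h where "h = cos_poly M t"
      define r where "r = (\<Sum>i<M. \<Sum>j<M. (t i j)\<^sup>2)"
      have r0: "r \<ge> 0" unfolding r_def by (intro sum_nonneg) auto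
      have hL: "h \<in> Lp_torus p" unfolding h_def using p by (intro lacunary_poly_Lp) auto
      have "(LINT z|torusM. h z * T z) = pi\<^sup>2 * (\<Sum>i<M. \<Sum>j<M. (if i < M \<and> j < M then t i j else 0) * t i j)"
        by (rule tM[rule_format, OF hL has_lacunary_coeffs_lacunary_poly[of M t, folded h_def]]) simp
      also have "\<dots> = pi\<^sup>2 * r" unfolding r_def by (simp add: power2_eq_square)
      finally have I: "(LINT z|torusM. h z * T z) = pi\<^sup>2 * r" .
      have cT: "continuous_on A T" for A using continuous_trig_poly[OF T] .
      have cTq: "continuous_on torus (\<lambda>z. \<bar>T z\<bar> powr q)"
        using q by (intro continuous_on_powr' continuous_intros cT) auto
      have "\<bar>(LINT z|torusM. h z * T z)\<bar> \<le> Lp_norm p h * Lp_norm q T"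
        using hL q p cTq continuous_measurable_lebesgue[OF cT]
        by (intro Holder_torus) (auto simp: Lp_torus_iff intro: measurable_torus_lebesgue)
      also have "\<dots> \<le> (C * sqrt r) * Lp_norm q T"
        unfolding h_def r_def by (intro mult_right_mono C) auto
      finally have le: "pi\<^sup>2 * r \<le> (C * sqrt r) * Lp_norm q T" using I r0 by simp
      have r1: "pi\<^sup>2 * sqrt r \<le> C * Lp_norm q T"
      proof (cases "r = 0")
        case False
        then have sp: "sqrt r > 0" using r0 by simp
        have "(pi\<^sup>2 * sqrt r) * sqrt r \<le> (C * Lp_norm q T) * sqrt r"
          using le r0 by (simp add: mult.assoc mult.commute[of "sqrt r" "Lp_norm q T"])
        then show ?thesis using sp by simp
      qed (use C in simp)
      have "(LINT z|torusM. F z * T z) = pi\<^sup>2 * (\<Sum>i<M. \<Sum>j<M. c i j * t i j)"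
        using tM[rule_format, OF F, of M] by simp
      then have "\<bar>(LINT z|torusM. F z * T z)\<bar> = pi\<^sup>2 * \<bar>\<Sum>i<M. \<Sum>j<M. c i j * t i j\<bar>"
        by (simp add: abs_mult)
      also have "\<dots> \<le> pi\<^sup>2 * (s * sqrt r)"
        using order_trans[OF double_sum_cauchy_schwarz[of c t M] mult_right_mono[OF s[of M] real_sqrt_ge_zero[OF r0[unfolded r_def]]]]
        unfolding r_def by (rule mult_left_mono) simp
      also have "\<dots> = s * (pi\<^sup>2 * sqrt r)" by simp
      also have "\<dots> \<le> s * (C * Lp_norm q T)" using r1 s0 by (rule mult_left_mono)
      finally show "\<bar>(LINT z|torusM. F z * T z)\<bar> \<le> C * s * Lp_norm q T" by (simp add: mult_ac)
    qed
  qed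
qed

section \<open>Fractional differences\<close>

text \<open>The binomial coefficients decay at least like \<open>n powr (- \<alpha> - 1)\<close>.\<close>

lemma summable_gbinomial_abs:
  fixes \<alpha> :: real
  assumes "\<alpha> > 0"
  shows "summable (\<lambda>n. \<bar>\<alpha> gchoose n\<bar>)"
proof -
  have "(\<lambda>n. (\<alpha> gchoose n) / ((-1)^n / exp ((\<alpha>+1) * of_real (ln (real n))))) \<longlonglongrightarrow> inverse (Gamma (- \<alpha>))"
    by (rule gbinomial_asymptotic)
  then have "Bseq (\<lambda>n. (\<alpha> gchoose n) / ((-1)^n / exp ((\<alpha>+1) * of_real (ln (real n)))))"
    by (rule convergent_imp_Bseq[OF convergentI])
  then obtain B where B: "B > 0" "\<And>n. norm ((\<alpha> gchoose n) / ((-1)^n / exp ((\<alpha>+1) * of_real (ln (real n))))) \<le> B"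
    unfolding Bseq_def by blast
  have b: "\<bar>\<alpha> gchoose n\<bar> \<le> B * real n powr (- (\<alpha> + 1))" if "n \<ge> 1" for n
  proof -
    have "\<bar>\<alpha> gchoose n\<bar> * real n powr (\<alpha> + 1) \<le> B"
      using B(2)[of n] that by (simp add: powr_def abs_mult norm_divide)
    then show ?thesis using that unfolding powr_minus by (simp add: field_simps)
  qed
  show ?thesis
  proof (rule summable_comparison_test_ev)
    show "\<forall>\<^sub>F n in sequentially. norm \<bar>\<alpha> gchoose n\<bar> \<le> B * real n powr (- (\<alpha> + 1))"
      unfolding eventually_sequentially using b by (intro exI[of _ 1]) auto
    show "summable (\<lambda>n. B * real n powr (- (\<alpha> + 1)))"
      using assms by (intro summable_mult) (simp add: summable_real_powr_iff)
  qed
qed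

lemma measurable_translation_lebesgue [measurable]:
  fixes a :: "'a::euclidean_space"
  shows "(\<lambda>z. z + a) \<in> lebesgue \<rightarrow>\<^sub>M lebesgue"
  using lebesgue_affine_measurable[of "\<lambda>_. 1" a] by (simp add: euclidean_representation add.commute)

lemma distr_translation_lebesgue:
  fixes a :: "'a::euclidean_space"
  shows "distr lebesgue lebesgue (\<lambda>z. z + a) = lebesgue"
  using lebesgue_affine_euclidean[of "\<lambda>_. 1" a]
  by (simp add: euclidean_representation add.commute density_1)

lemma nn_integral_translation_lebesgue:
  fixes a :: "'a::euclidean_space"
  assumes "F \<in> borel_measurable lebesgue"
  shows "(\<integral>\<^sup>+z. F (z + a) \<partial>lebesgue) = (\<integral>\<^sup>+z. F z \<partial>lebesgue)"
proof -
  have "(\<integral>\<^sup>+z. F z \<partial>distr lebesgue lebesgue (\<lambda>z. z + a)) = (\<integral>\<^sup>+z. F (z + a) \<partial>lebesgue)"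
    using assms by (intro nn_integral_distr measurable_translation_lebesgue) (simp add: measurable_cong_sets[of "distr lebesgue lebesgue (\<lambda>z. z + a)" lebesgue])
  then show ?thesis by (simp add: distr_translation_lebesgue)
qed

lemma torus_periodic_int:
  assumes "torus_periodic F" "e \<in> {(1, 0), (0, 1)}"
  shows "F (z + (2 * pi * of_int m) *\<^sub>R e) = F z"
proof -
  have step: "F (z + (2 * pi) *\<^sub>R e) = F z" for z
    using assms by (cases z) (auto simp: torus_periodic_def)
  show ?thesis
  proof (induction m arbitrary: z rule: int_induct[where k = 0])
    case (step1 i)
    have "z + (2 * pi * of_int (i + 1)) *\<^sub>R e = (z + (2 * pi * of_int i) *\<^sub>R e) + (2 * pi) *\<^sub>R e"
      by (simp add: algebra_simps)
    then show ?case using step step1 by metis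
  next
    case (step2 i)
    have "z + (2 * pi * of_int i) *\<^sub>R e = (z + (2 * pi * of_int (i - 1)) *\<^sub>R e) + (2 * pi) *\<^sub>R e"
      by (simp add: algebra_simps)
    then show ?case using step step2 by metis
  qed simp
qed

text \<open>Integrals of periodic functions over the square are invariant under translations along the axes.
  The translation is first reduced to one by \<open>0 \<le> s \<le> 2 * pi\<close>; then the part of the shifted square that
  sticks out is moved back by one period.\<close>

lemma nn_integral_torus_translation:
  fixes F :: "real \<times> real \<Rightarrow> ennreal"
  assumes F: "F \<in> borel_measurable lebesgue" and per: "torus_periodic F" and e: "e \<in> {(1, 0), (0, 1)}"
  shows "(\<integral>\<^sup>+z. F (z + t *\<^sub>R e) \<partial>torusM) = (\<integral>\<^sup>+z. F z \<partial>torusM)"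
proof -
  define e' where "e' = (snd e, fst e)"
  have ee: "e \<bullet> e = 1" "e \<bullet> e' = 0" "e' \<bullet> e = 0" "e \<noteq> 0" using e by (auto simp: e'_def zero_prod_def)
  \<comment> \<open>half-open strips in the direction of \<open>e\<close>, on which the integral \<open>\<Phi>\<close> is additive\<close>
  define S where "S a b = {z :: real \<times> real. a \<le> z \<bullet> e \<and> z \<bullet> e < b \<and> 0 \<le> z \<bullet> e' \<and> z \<bullet> e' \<le> 2 * pi}" for a b
  define \<Phi> where "\<Phi> a b = (\<integral>\<^sup>+z. F z * indicator (S a b) z \<partial>lebesgue)" for a b
  have Sb: "S a b \<in> sets borel" for a b unfolding S_def by measurable
  have Sm [measurable]: "S a b \<in> sets lebesgue" for a b using Sb by auto
  note F [measurable]
  have split: "\<Phi> a c = \<Phi> a b + \<Phi> b c" if "a \<le> b" "b \<le> c" for a b c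
  proof -
    have "indicator (S a c) z = (indicator (S a b) z + indicator (S b c) z :: ennreal)" for z
      using that by (auto simp: S_def indicator_def)
    then have "\<Phi> a c = (\<integral>\<^sup>+z. F z * indicator (S a b) z + F z * indicator (S b c) z \<partial>lebesgue)"
      unfolding \<Phi>_def by (simp add: distrib_left)
    also have "\<dots> = \<Phi> a b + \<Phi> b c" unfolding \<Phi>_def by (rule nn_integral_add) measurable
    finally show ?thesis .
  qed
  have shift: "(\<integral>\<^sup>+z. F (z + s *\<^sub>R e) * indicator (S a b) z \<partial>lebesgue) = \<Phi> (a + s) (b + s)" for a b s
  proof -
    have "indicator (S a b) z = (indicator (S (a + s) (b + s)) (z + s *\<^sub>R e) :: ennreal)" for z
      by (auto simp: S_def indicator_def inner_add_left ee)
    then have "(\<integral>\<^sup>+z. F (z + s *\<^sub>R e) * indicator (S a b) z \<partial>lebesgue) =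
        (\<integral>\<^sup>+z. F (z + s *\<^sub>R e) * indicator (S (a + s) (b + s)) (z + s *\<^sub>R e) \<partial>lebesgue)" by simp
    also have "\<dots> = (\<integral>\<^sup>+z. F z * indicator (S (a + s) (b + s)) z \<partial>lebesgue)"
      by (rule nn_integral_translation_lebesgue[of "\<lambda>z. F z * indicator (S (a + s) (b + s)) z"]) measurable
    finally show ?thesis unfolding \<Phi>_def .
  qed
  have perF: "F (z + (2 * pi) *\<^sub>R e) = F z" for z
    using torus_periodic_int[OF per e, of z 1] by simp
  have shift2: "\<Phi> (a + 2 * pi) (b + 2 * pi) = \<Phi> a b" for a b
    using shift[of "2 * pi" a b] unfolding perF by (simp add: \<Phi>_def)
  have fund: "\<Phi> s (s + 2 * pi) = \<Phi> 0 (2 * pi)" if "0 \<le> s" "s \<le> 2 * pi" for s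
    using split[of s "2 * pi" "s + 2 * pi"] split[of 0 s "2 * pi"] shift2[of 0 s] that
    by (simp add: add.commute)
  have tor: "(\<integral>\<^sup>+z. G z \<partial>torusM) = (\<integral>\<^sup>+z. G z * indicator (S 0 (2 * pi)) z \<partial>lebesgue)" for G
  proof -
    have "(\<integral>\<^sup>+z. G z \<partial>torusM) = (\<integral>\<^sup>+z. G z * indicator torus z \<partial>lebesgue)"
      by (rule nn_integral_restrict_space) simp
    also have "\<dots> = (\<integral>\<^sup>+z. G z * indicator (S 0 (2 * pi)) z \<partial>lebesgue)"
    proof (rule nn_integral_cong_AE)
      have "negligible {z. e \<bullet> z = 2 * pi}" by (rule negligible_hyperplane) (use ee in auto)
      then have "AE z in lebesgue. z \<notin> {z. e \<bullet> z = 2 * pi}"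
        unfolding negligible_iff_null_sets by (rule AE_not_in)
      then show "AE z in lebesgue. G z * indicator torus z = G z * indicator (S 0 (2 * pi)) z"
        by eventually_elim (use e in \<open>auto simp: S_def e'_def torus_def indicator_def inner_commute\<close>)
    qed
    finally show ?thesis .
  qed
  define m where "m = \<lfloor>t / (2 * pi)\<rfloor>"
  define s where "s = t - 2 * pi * of_int m"
  have s: "0 \<le> s" "s \<le> 2 * pi"
  proof -
    have "of_int m \<le> t / (2 * pi)" "t / (2 * pi) < of_int m + 1" unfolding m_def by linarith+
    then show "0 \<le> s" "s \<le> 2 * pi" unfolding s_def by (auto simp: field_simps)
  qed
  have "F (z + t *\<^sub>R e) = F (z + s *\<^sub>R e)" for z
  proof -
    have "z + t *\<^sub>R e = (z + s *\<^sub>R e) + (2 * pi * of_int m) *\<^sub>R e" unfolding s_def by (simp add: algebra_simps)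
    then show ?thesis using torus_periodic_int[OF per e] by metis
  qed
  then show ?thesis
    unfolding tor using shift[of s 0 "2 * pi"] fund[OF s] by (simp add: \<Phi>_def add.commute)
qed

text \<open>The series \<open>\<Sum>\<nu>. w \<nu> * f (z + t \<nu> *\<^sub>R e)\<close> of translates in the direction \<open>e\<close>. Both fractional differences
  are of this form, with \<open>e\<close> one of the two unit vectors.\<close>

definition shift_series :: "(nat \<Rightarrow> real) \<Rightarrow> (nat \<Rightarrow> real) \<Rightarrow> real \<times> real \<Rightarrow> (real \<times> real \<Rightarrow> real) \<Rightarrow> real \<times> real \<Rightarrow> real" where
  "shift_series w t e f z = (\<Sum>\<nu>. w \<nu> * f (z + t \<nu> *\<^sub>R e))"

lemma frac_diff_x_eq: "frac_diff_x \<alpha> h f = shift_series (\<lambda>\<nu>. (- 1) ^ \<nu> * (\<alpha> gchoose \<nu>)) (\<lambda>\<nu>. (\<alpha> - real \<nu>) * h) (1, 0) f"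
  by (auto simp: frac_diff_x_def shift_series_def fun_eq_iff)

lemma frac_diff_y_eq: "frac_diff_y \<alpha> h f = shift_series (\<lambda>\<nu>. (- 1) ^ \<nu> * (\<alpha> gchoose \<nu>)) (\<lambda>\<nu>. (\<alpha> - real \<nu>) * h) (0, 1) f"
  by (auto simp: frac_diff_y_def shift_series_def fun_eq_iff)

text \<open>Jensen's inequality for \<open>x powr p\<close> and a summable sequence of weights, together with the
  summability that it presupposes.\<close>

lemma weighted_power_mean:
  fixes A x :: "nat \<Rightarrow> real"
  assumes p: "p > 1" and A: "\<And>n. A n \<ge> 0" "summable A" "suminf A > 0" and x: "\<And>n. x n \<ge> 0"
    and s: "summable (\<lambda>n. A n * x n powr p)"
  shows "summable (\<lambda>n. A n * x n)" "(\<Sum>n. A n * x n) powr p \<le> suminf A powr (p - 1) * (\<Sum>n. A n * x n powr p)"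
proof -
  obtain q where q: "q > 1" "1 / p + 1 / q = 1" using conjugate_exponent[OF p] by blast
  have qp: "(p - 1) * q = p" using p q by (simp add: field_simps)
  \<comment> \<open>the tangent inequality of \<open>x powr p\<close> at \<open>m\<close>; the mean value is inserted for \<open>m\<close> below\<close>
  have young: "p * x n * m powr (p - 1) \<le> x n powr p + (p - 1) * m powr p" if "m \<ge> 0" for m n
  proof -
    have "x n * m powr (p - 1) \<le> x n powr p / p + (m powr (p - 1)) powr q / q"
      using Youngs_inequality[OF p q] x by simp
    also have "(m powr (p - 1)) powr q = m powr p" by (simp add: powr_powr qp)
    finally have "p * (x n * m powr (p - 1)) \<le> p * (x n powr p / p + m powr p / q)"
      using p by (intro mult_left_mono) auto
    also have "\<dots> = x n powr p + (p / q) * m powr p" using p by (simp add: field_simps)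
    also have "p / q = p - 1" using p q by (simp add: field_simps)
    finally show ?thesis by (simp add: mult.assoc)
  qed
  have "A n * x n \<le> A n * x n powr p + (p - 1) * A n" for n
  proof -
    have "1 * x n \<le> p * x n" using p x[of n] by (intro mult_right_mono) auto
    then have "x n \<le> x n powr p + (p - 1)" using young[of 1 n] by simp
    then have "A n * x n \<le> A n * (x n powr p + (p - 1))" using A(1) by (intro mult_left_mono)
    then show ?thesis by (simp add: algebra_simps)
  qed
  then show sx: "summable (\<lambda>n. A n * x n)"
    using A x by (intro summable_comparison_test[OF _ summable_add[OF s summable_mult[OF A(2), of "p - 1"]]]) auto
  define W where "W = suminf A"
  define m where "m = (\<Sum>n. A n * x n) / W"
  have W: "W > 0" using A W_def by simp
  have X0: "(\<Sum>n. A n * x n) \<ge> 0" using sx A x by (intro suminf_nonneg) auto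
  have m0: "m \<ge> 0" unfolding m_def using W X0 by simp
  have Wm: "(\<Sum>n. A n * x n) = W * m" unfolding m_def using W by simp
  have "(\<Sum>n. p * m powr (p - 1) * (A n * x n)) \<le> (\<Sum>n. A n * x n powr p + (p - 1) * m powr p * A n)"
  proof (rule suminf_le)
    fix n
    have "A n * (p * x n * m powr (p - 1)) \<le> A n * (x n powr p + (p - 1) * m powr p)"
      using young[OF m0] A(1) by (intro mult_left_mono)
    then show "p * m powr (p - 1) * (A n * x n) \<le> A n * x n powr p + (p - 1) * m powr p * A n"
      by (simp add: algebra_simps)
  qed (intro summable_mult sx summable_add s A(2))+
  also have "(\<Sum>n. A n * x n powr p + (p - 1) * m powr p * A n) = (\<Sum>n. A n * x n powr p) + (p - 1) * m powr p * W"
    unfolding W_def by (simp add: suminf_add[symmetric] s summable_mult A suminf_mult)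
  also have "(\<Sum>n. p * m powr (p - 1) * (A n * x n)) = p * m powr (p - 1) * (W * m)"
    using sx by (simp add: suminf_mult Wm)
  also have "\<dots> = p * m powr p * W"
  proof -
    have "m powr (p - 1) * m powr 1 = m powr p" by (simp only: powr_add[symmetric]) simp
    then have "m powr (p - 1) * m = m powr p" using m0 by simp
    then show ?thesis by (simp add: mult.commute mult.left_commute)
  qed
  finally have key: "m powr p * W \<le> (\<Sum>n. A n * x n powr p)" by (simp add: algebra_simps)
  have "(\<Sum>n. A n * x n) powr p = W powr (p - 1) * W powr 1 * m powr p"
    unfolding Wm powr_add[symmetric] using W m0 by (simp add: powr_mult)
  also have "\<dots> = W powr (p - 1) * (m powr p * W)" using W by simp
  also have "\<dots> \<le> W powr (p - 1) * (\<Sum>n. A n * x n powr p)"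
    using key by (intro mult_left_mono) auto
  finally show "(\<Sum>n. A n * x n) powr p \<le> suminf A powr (p - 1) * (\<Sum>n. A n * x n powr p)"
    unfolding W_def .
qed

text \<open>A series of translates with absolutely summable weights converges a.e. and is bounded on \<open>L\<^sub>p\<close>.\<close>

lemma shift_series_Lp:
  assumes p: "p > 1" and e: "e \<in> {(1, 0), (0, 1)}" and w: "summable (\<lambda>\<nu>. \<bar>w \<nu>\<bar>)" "(\<Sum>\<nu>. \<bar>w \<nu>\<bar>) > 0"
    and f: "f \<in> Lp_torus p"
  shows "AE z in torusM. summable (\<lambda>\<nu>. w \<nu> * f (z + t \<nu> *\<^sub>R e))"
    and "shift_series w t e f \<in> Lp_torus p"
    and "Lp_norm p (shift_series w t e f) \<le> (\<Sum>\<nu>. \<bar>w \<nu>\<bar>) * Lp_norm p f"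
proof -
  define W where "W = (\<Sum>\<nu>. \<bar>w \<nu>\<bar>)"
  have W0: "W > 0" using w W_def by simp
  have f' [measurable]: "f \<in> borel_measurable lebesgue" and per: "torus_periodic f"
    and fi: "integrable torusM (\<lambda>z. \<bar>f z\<bar> powr p)"
    using f by (auto simp: Lp_torus_iff)
  have ft [measurable]: "(\<lambda>z. f (z + a)) \<in> borel_measurable lebesgue" for a
    by (rule measurable_compose[OF measurable_translation_lebesgue f'])
  have ft' [measurable]: "(\<lambda>z. f (z + a)) \<in> borel_measurable torusM" for a
    by (rule measurable_restrict_space1) simp
  let ?J = "\<integral>\<^sup>+z. ennreal (\<bar>f z\<bar> powr p) \<partial>torusM"
  have J: "?J = ennreal ((LINT z|torusM. \<bar>f z\<bar> powr p))"
    by (rule nn_integral_eq_integral[OF fi]) simp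
  let ?G = "\<lambda>z. \<Sum>\<nu>. ennreal (\<bar>w \<nu>\<bar> * \<bar>f (z + t \<nu> *\<^sub>R e)\<bar> powr p)"
  have G: "(\<integral>\<^sup>+z. ?G z \<partial>torusM) = ennreal W * ?J"
  proof -
    have "(\<integral>\<^sup>+z. ?G z \<partial>torusM) = (\<Sum>\<nu>. \<integral>\<^sup>+z. ennreal (\<bar>w \<nu>\<bar> * \<bar>f (z + t \<nu> *\<^sub>R e)\<bar> powr p) \<partial>torusM)"
      by (rule nn_integral_suminf) measurable
    also have "\<dots> = (\<Sum>\<nu>. ennreal \<bar>w \<nu>\<bar> * ?J)"
    proof (intro suminf_cong)
      fix \<nu>
      have "(\<integral>\<^sup>+z. ennreal (\<bar>w \<nu>\<bar> * \<bar>f (z + t \<nu> *\<^sub>R e)\<bar> powr p) \<partial>torusM) =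
         ennreal \<bar>w \<nu>\<bar> * (\<integral>\<^sup>+z. ennreal (\<bar>f (z + t \<nu> *\<^sub>R e)\<bar> powr p) \<partial>torusM)"
        by (subst nn_integral_cmult[symmetric]) (auto simp: ennreal_mult)
      also have "(\<integral>\<^sup>+z. ennreal (\<bar>f (z + t \<nu> *\<^sub>R e)\<bar> powr p) \<partial>torusM) = ?J"
        by (rule nn_integral_torus_translation[of "\<lambda>z. ennreal (\<bar>f z\<bar> powr p)"])
           (use per e in \<open>auto simp: torus_periodic_def\<close>)
      finally show "(\<integral>\<^sup>+z. ennreal (\<bar>w \<nu>\<bar> * \<bar>f (z + t \<nu> *\<^sub>R e)\<bar> powr p) \<partial>torusM) = ennreal \<bar>w \<nu>\<bar> * ?J" .
    qed
    also have "\<dots> = ennreal W * ?J"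
      unfolding W_def by (subst ennreal_suminf_multc) (simp add: suminf_ennreal2 w)
    finally show ?thesis .
  qed
  also have "\<dots> < \<infinity>" unfolding J by (simp add: ennreal_mult_less_top)
  finally have "(\<integral>\<^sup>+z. ?G z \<partial>torusM) \<noteq> \<infinity>" by simp
  then have "AE z in torusM. ?G z \<noteq> \<infinity>"
    by (intro nn_integral_PInf_AE) measurable
  then have ae1: "AE z in torusM. summable (\<lambda>\<nu>. \<bar>w \<nu>\<bar> * \<bar>f (z + t \<nu> *\<^sub>R e)\<bar> powr p)"
    by eventually_elim (intro summable_suminf_not_top; simp)
  have ae2: "AE z in torusM. summable (\<lambda>\<nu>. \<bar>w \<nu>\<bar> * \<bar>f (z + t \<nu> *\<^sub>R e)\<bar>)"
    using ae1 by eventually_elim (rule weighted_power_mean(1)[OF p _ w], auto)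
  show sm: "AE z in torusM. summable (\<lambda>\<nu>. w \<nu> * f (z + t \<nu> *\<^sub>R e))"
    using ae2 by eventually_elim (rule summable_rabs_cancel, simp add: abs_mult)
  have ae3: "AE z in torusM. ennreal (\<bar>shift_series w t e f z\<bar> powr p) \<le> ennreal (W powr (p - 1)) * ?G z"
    using ae1 ae2
  proof eventually_elim
    case (elim z)
    let ?x = "\<lambda>\<nu>. \<bar>f (z + t \<nu> *\<^sub>R e)\<bar>"
    have "\<bar>shift_series w t e f z\<bar> \<le> (\<Sum>\<nu>. \<bar>w \<nu>\<bar> * ?x \<nu>)"
      unfolding shift_series_def using elim(2) by (subst abs_mult[symmetric]) (intro summable_rabs, simp add: abs_mult)
    then have "\<bar>shift_series w t e f z\<bar> powr p \<le> (\<Sum>\<nu>. \<bar>w \<nu>\<bar> * ?x \<nu>) powr p"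
      using p by (intro powr_mono2) auto
    also have "\<dots> \<le> W powr (p - 1) * (\<Sum>\<nu>. \<bar>w \<nu>\<bar> * ?x \<nu> powr p)"
      unfolding W_def by (rule weighted_power_mean(2)[OF p _ w _ elim(1)]) auto
    finally have "ennreal (\<bar>shift_series w t e f z\<bar> powr p) \<le> ennreal (W powr (p - 1) * (\<Sum>\<nu>. \<bar>w \<nu>\<bar> * ?x \<nu> powr p))"
      by (rule ennreal_leI)
    also have "\<dots> = ennreal (W powr (p - 1)) * ?G z"
      using elim(1) by (subst ennreal_mult) (auto intro!: suminf_nonneg simp: suminf_ennreal2 simp del: ennreal_mult)
    finally show ?case .
  qed
  have Dm: "shift_series w t e f \<in> borel_measurable lebesgue"
    unfolding shift_series_def[abs_def] by measurable
  have Dm' [measurable]: "shift_series w t e f \<in> borel_measurable torusM"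
    using Dm by (rule measurable_restrict_space1)
  have "(\<integral>\<^sup>+z. ennreal (\<bar>shift_series w t e f z\<bar> powr p) \<partial>torusM) \<le>
     (\<integral>\<^sup>+z. ennreal (W powr (p - 1)) * ?G z \<partial>torusM)"
    by (rule nn_integral_mono_AE[OF ae3])
  also have "\<dots> = ennreal (W powr (p - 1)) * (ennreal W * ?J)"
    by (subst nn_integral_cmult) (auto simp: G)
  also have "\<dots> = ennreal (W powr p * (LINT z|torusM. \<bar>f z\<bar> powr p))"
  proof -
    have "W powr (p - 1) * W powr 1 = W powr p" by (simp only: powr_add[symmetric]) simp
    then have "W powr (p - 1) * W = W powr p" using W0 by simp
    then show ?thesis unfolding J using W0 by (simp add: ennreal_mult[symmetric] mult.assoc[symmetric])
  qed
  finally have nn: "(\<integral>\<^sup>+z. ennreal (\<bar>shift_series w t e f z\<bar> powr p) \<partial>torusM) \<le>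
     ennreal (W powr p * (LINT z|torusM. \<bar>f z\<bar> powr p))" .
  have int: "integrable torusM (\<lambda>z. \<bar>shift_series w t e f z\<bar> powr p)"
  proof (rule integrableI_bounded)
    show "(\<integral>\<^sup>+z. ennreal (norm (\<bar>shift_series w t e f z\<bar> powr p)) \<partial>torusM) < \<infinity>"
      using nn by (simp add: order_le_less_trans)
  qed measurable
  have perD: "torus_periodic (shift_series w t e f)"
  proof -
    have "f (x + 2 * pi, y) = f (x, y)" "f (x, y + 2 * pi) = f (x, y)" for x y
      using per by (auto simp: torus_periodic_def)
    note per' = this
    have "f ((x + 2 * pi, y) + a) = f ((x, y) + a)" "f ((x, y + 2 * pi) + a) = f ((x, y) + a)" for x y a
      using per'(1)[of "x + fst a" "y + snd a"] per'(2)[of "x + fst a" "y + snd a"]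
      by (cases a; simp add: algebra_simps)+
    then show ?thesis unfolding torus_periodic_def shift_series_def by simp
  qed
  show "shift_series w t e f \<in> Lp_torus p"
    using Dm perD int by (simp add: Lp_torus_iff)
  have "ennreal ((LINT z|torusM. \<bar>shift_series w t e f z\<bar> powr p)) \<le>
     ennreal (W powr p * (LINT z|torusM. \<bar>f z\<bar> powr p))"
    using nn by (subst (asm) nn_integral_eq_integral[OF int]) auto
  then have "(LINT z|torusM. \<bar>shift_series w t e f z\<bar> powr p) \<le>
     W powr p * (LINT z|torusM. \<bar>f z\<bar> powr p)"
    by (subst (asm) ennreal_le_iff) auto
  also have "\<dots> = (W * Lp_norm p f) powr p"
    using p W0 by (simp add: powr_mult Lp_norm_powr)
  finally show "Lp_norm p (shift_series w t e f) \<le> (\<Sum>\<nu>. \<bar>w \<nu>\<bar>) * Lp_norm p f"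
    unfolding W_def[symmetric] using p W0 by (intro Lp_norm_le) auto
qed

lemma shift_series_Lipschitz:
  assumes p: "p > 1" and e: "e \<in> {(1, 0), (0, 1)}" and w: "summable (\<lambda>\<nu>. \<bar>w \<nu>\<bar>)" "(\<Sum>\<nu>. \<bar>w \<nu>\<bar>) > 0"
    and f: "f \<in> Lp_torus p" and g: "g \<in> Lp_torus p"
  shows "Lp_norm p (\<lambda>z. shift_series w t e f z - shift_series w t e g z) \<le> (\<Sum>\<nu>. \<bar>w \<nu>\<bar>) * Lp_norm p (\<lambda>z. f z - g z)"
proof -
  have fg: "(\<lambda>z. f z - g z) \<in> Lp_torus p" using p f g by (intro Lp_torus_diff) auto
  note m = shift_series_Lp(2)[OF p e w f, of t, THEN Lp_torus_measurable]
    shift_series_Lp(2)[OF p e w g, of t, THEN Lp_torus_measurable]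
    shift_series_Lp(2)[OF p e w fg, of t, THEN Lp_torus_measurable]
  have "AE z in torusM. shift_series w t e f z - shift_series w t e g z = shift_series w t e (\<lambda>z. f z - g z) z"
    using shift_series_Lp(1)[OF p e w f, of t] shift_series_Lp(1)[OF p e w g, of t]
    by eventually_elim (simp add: shift_series_def suminf_diff right_diff_distrib)
  then have "Lp_norm p (\<lambda>z. shift_series w t e f z - shift_series w t e g z) = Lp_norm p (shift_series w t e (\<lambda>z. f z - g z))"
    unfolding Lp_norm_eq using m by (intro arg_cong[where f = "\<lambda>x. x powr (1 / p)"] integral_cong_AE) auto
  then show ?thesis using shift_series_Lp(3)[OF p e w fg] by simp
qed

lemma of_real_gbinomial: "of_real (\<alpha> gchoose n) = (of_real \<alpha> gchoose n :: complex)"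
  by (simp add: gbinomial_prod_rev)

text \<open>The binomial series on the closed unit disc. Both sides are continuous there and agree in the
  interior, so the identity extends to the boundary circle, where it is needed.\<close>

lemma norm_gbinomial_series_cball:
  fixes u :: complex and \<alpha> :: real
  assumes \<alpha>: "\<alpha> > 0" and u: "norm u \<le> 1"
  shows "norm (\<Sum>n. of_real (\<alpha> gchoose n) * (- u) ^ n) = norm (1 - u) powr \<alpha>"
proof -
  define G where "G u = (\<Sum>n. of_real (\<alpha> gchoose n) * (- u) ^ n)" for u :: complex
  have cG: "continuous_on (cball 0 1) G"
  proof (rule uniform_limit_theorem)
    show "uniform_limit (cball 0 1) (\<lambda>n u::complex. \<Sum>i<n. of_real (\<alpha> gchoose i) * (- u) ^ i) G sequentially"
      unfolding G_def
      by (rule Weierstrass_m_test[OF _ summable_gbinomial_abs[OF \<alpha>]])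
         (auto simp: norm_mult norm_power intro!: mult_left_le power_le_one)
    show "\<forall>\<^sub>F n in sequentially. continuous_on (cball 0 1) (\<lambda>u::complex. \<Sum>i<n. of_real (\<alpha> gchoose i) * (- u) ^ i)"
      by (intro always_eventually allI continuous_intros)
  qed simp
  have "norm (G u) - norm (1 - u) powr \<alpha> = 0"
  proof (rule continuous_constant_on_closure[where S = "ball 0 1" and f = "\<lambda>u. norm (G u) - norm (1 - u) powr \<alpha>" and x = u])
    show "continuous_on (closure (ball 0 1)) (\<lambda>u. norm (G u) - norm (1 - u) powr \<alpha>)"
      using \<alpha> cG by (auto intro!: continuous_intros continuous_on_powr')
    show "u \<in> closure (ball 0 1)" using u by simp
    fix v :: complex assume "v \<in> ball 0 1"
    then have "norm (- v) < 1" by simp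
    then have "(\<lambda>n. (of_real \<alpha> gchoose n) * (- v) ^ n) sums (1 + - v) powr (of_real \<alpha>)"
      by (rule gen_binomial_complex)
    then have "G v = (1 - v) powr (of_real \<alpha>)"
      unfolding G_def by (simp add: sums_iff of_real_gbinomial)
    then show "norm (G v) - norm (1 - v) powr \<alpha> = 0"
      by (simp add: norm_powr_real_powr')
  qed
  then show ?thesis by (simp add: G_def)
qed

lemma norm_one_minus_cis: "norm (1 - cis t) = 2 * \<bar>sin (t / 2)\<bar>"
proof -
  have "(norm (1 - cis t))\<^sup>2 = (1 - cos t)\<^sup>2 + (sin t)\<^sup>2"
    by (simp add: cmod_power2)
  also have "\<dots> = 2 - 2 * cos t"
    using sin_cos_squared_add[of t] by (simp add: power2_eq_square algebra_simps)
  also have "cos t = 1 - 2 * (sin (t / 2))\<^sup>2"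
    using cos_double_sin[of "t / 2"] by simp
  finally have "(norm (1 - cis t))\<^sup>2 = (2 * \<bar>sin (t / 2)\<bar>)\<^sup>2" by (simp add: power_mult_distrib)
  then show ?thesis by (rule power2_eq_imp_eq) auto
qed

text \<open>A fractional difference multiplies the amplitude of a wave by \<open>(2 * \<bar>sin (k * h / 2)\<bar>) powr \<alpha>\<close> and shifts
  its phase.\<close>

lemma frac_diff_cos:
  fixes k :: real
  assumes \<alpha>: "\<alpha> > 0"
  shows "\<exists>\<phi>. \<forall>x. (\<lambda>\<nu>. (- 1) ^ \<nu> * (\<alpha> gchoose \<nu>) * cos (k * (x + (\<alpha> - real \<nu>) * h) + \<theta>)) sums
     ((2 * \<bar>sin (k * h / 2)\<bar>) powr \<alpha> * cos (k * x + (\<theta> + \<phi>)))"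
proof -
  define u where "u = cis (- (k * h))"
  define Z where "Z = cis (k * h * \<alpha>) * (\<Sum>n. of_real (\<alpha> gchoose n) * (- u) ^ n)"
  have nu: "norm u = 1" by (simp add: u_def)
  have "summable (\<lambda>n. norm (of_real (\<alpha> gchoose n) * (- u) ^ n))"
    using summable_gbinomial_abs[OF \<alpha>] by (simp add: norm_mult norm_power nu)
  then have "(\<lambda>n. of_real (\<alpha> gchoose n) * (- u) ^ n) sums (\<Sum>n. of_real (\<alpha> gchoose n) * (- u) ^ n)"
    by (rule summable_sums[OF summable_norm_cancel])
  then have Z: "(\<lambda>n. cis (k * h * \<alpha>) * (of_real (\<alpha> gchoose n) * (- u) ^ n)) sums Z"
    unfolding Z_def by (rule sums_mult)
  have nZ: "norm Z = (2 * \<bar>sin (k * h / 2)\<bar>) powr \<alpha>"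
    using norm_gbinomial_series_cball[OF \<alpha>, of u] nu norm_one_minus_cis[of "- (k * h)"]
    by (simp add: Z_def norm_mult u_def)
  show ?thesis
  proof (intro exI[of _ "Arg Z"] allI)
    fix x
    have "(\<lambda>n. Re (cis (k * x + \<theta>) * (cis (k * h * \<alpha>) * (of_real (\<alpha> gchoose n) * (- u) ^ n)))) sums Re (cis (k * x + \<theta>) * Z)"
      by (intro sums_Re sums_mult Z)
    moreover have "Re (cis (k * x + \<theta>) * (cis (k * h * \<alpha>) * (of_real (\<alpha> gchoose n) * (- u) ^ n))) =
      (- 1) ^ n * (\<alpha> gchoose n) * cos (k * (x + (\<alpha> - real n) * h) + \<theta>)" for n
    proof -
      have "(- u) ^ n = (- 1) ^ n * cis (- (k * h) * real n)"
        unfolding u_def power_minus[of "cis _"] Complex.DeMoivre by (simp only: mult.commute)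
      then have "cis (k * x + \<theta>) * (cis (k * h * \<alpha>) * (of_real (\<alpha> gchoose n) * (- u) ^ n)) =
         of_real ((- 1) ^ n * (\<alpha> gchoose n)) * (cis (k * x + \<theta>) * cis (k * h * \<alpha>) * cis (- (k * h) * real n))"
        by simp
      also have "cis (k * x + \<theta>) * cis (k * h * \<alpha>) * cis (- (k * h) * real n) = cis (k * (x + (\<alpha> - real n) * h) + \<theta>)"
        by (simp add: cis_mult algebra_simps)
      finally have E: "cis (k * x + \<theta>) * (cis (k * h * \<alpha>) * (of_real (\<alpha> gchoose n) * (- u) ^ n)) =
         of_real ((- 1) ^ n * (\<alpha> gchoose n)) * cis (k * (x + (\<alpha> - real n) * h) + \<theta>)" .
      show ?thesis unfolding E by (subst times_complex.sel) simp
    qed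
    moreover have "Re (cis (k * x + \<theta>) * Z) = (2 * \<bar>sin (k * h / 2)\<bar>) powr \<alpha> * cos (k * x + (\<theta> + Arg Z))"
    proof -
      have "Z = of_real (norm Z) * cis (Arg Z)" using rcis_cmod_Arg[of Z] by (simp add: rcis_def)
      then have "cis (k * x + \<theta>) * Z = of_real (norm Z) * (cis (k * x + \<theta>) * cis (Arg Z))" by (metis mult.left_commute)
      also have "\<dots> = of_real (norm Z) * cis (k * x + (\<theta> + Arg Z))" by (simp add: cis_mult add.assoc)
      finally have E: "cis (k * x + \<theta>) * Z = of_real (norm Z) * cis (k * x + (\<theta> + Arg Z))" .
      show ?thesis unfolding E nZ by simp
    qed
    ultimately show "(\<lambda>\<nu>. (- 1) ^ \<nu> * (\<alpha> gchoose \<nu>) * cos (k * (x + (\<alpha> - real \<nu>) * h) + \<theta>)) sums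
     ((2 * \<bar>sin (k * h / 2)\<bar>) powr \<alpha> * cos (k * x + (\<theta> + Arg Z)))" by simp
  qed
qed

text \<open>The factor by which the difference of order \<open>\<alpha>\<close> and step \<open>h\<close> changes the amplitude at the
  frequency \<open>2 ^ i\<close>.\<close>

definition diff_mult :: "real \<Rightarrow> real \<Rightarrow> nat \<Rightarrow> real" where
  "diff_mult \<alpha> h i = (2 * \<bar>sin (2 ^ i * h / 2)\<bar>) powr \<alpha>"

lemma frac_diff_x_lacunary_poly:
  assumes "\<alpha> > 0"
  obtains \<phi>' where "frac_diff_x \<alpha> h (lacunary_poly N c \<phi> \<psi>) = lacunary_poly N (\<lambda>i j. c i j * diff_mult \<alpha> h i) \<phi>' \<psi>"
proof -
  have "\<forall>i. \<exists>\<eta>. \<forall>x. (\<lambda>\<nu>. (- 1) ^ \<nu> * (\<alpha> gchoose \<nu>) * cos (2 ^ i * (x + (\<alpha> - real \<nu>) * h) + \<phi> i)) sums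
     (diff_mult \<alpha> h i * cos (2 ^ i * x + \<eta>))"
  proof
    fix i
    show "\<exists>\<eta>. \<forall>x. (\<lambda>\<nu>. (- 1) ^ \<nu> * (\<alpha> gchoose \<nu>) * cos (2 ^ i * (x + (\<alpha> - real \<nu>) * h) + \<phi> i)) sums
     (diff_mult \<alpha> h i * cos (2 ^ i * x + \<eta>))"
      unfolding diff_mult_def using frac_diff_cos[OF assms, of "2 ^ i" h "\<phi> i"] by blast
  qed
  from choice[OF this] obtain \<phi>' where \<phi>': "\<forall>i x. (\<lambda>\<nu>. (- 1) ^ \<nu> * (\<alpha> gchoose \<nu>) * cos (2 ^ i * (x + (\<alpha> - real \<nu>) * h) + \<phi> i)) sums
     (diff_mult \<alpha> h i * cos (2 ^ i * x + \<phi>' i))" by blast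
  have "frac_diff_x \<alpha> h (lacunary_poly N c \<phi> \<psi>) (x, y) = lacunary_poly N (\<lambda>i j. c i j * diff_mult \<alpha> h i) \<phi>' \<psi> (x, y)" for x y
  proof -
    have "(\<lambda>\<nu>. \<Sum>i<N. \<Sum>j<N. c i j * cos (2 ^ j * y + \<psi> j) * ((- 1) ^ \<nu> * (\<alpha> gchoose \<nu>) * cos (2 ^ i * (x + (\<alpha> - real \<nu>) * h) + \<phi> i))) sums
      (\<Sum>i<N. \<Sum>j<N. c i j * cos (2 ^ j * y + \<psi> j) * (diff_mult \<alpha> h i * cos (2 ^ i * x + \<phi>' i)))"
      by (intro sums_sum sums_mult \<phi>'[rule_format])
    moreover have "(\<Sum>i<N. \<Sum>j<N. c i j * cos (2 ^ j * y + \<psi> j) * ((- 1) ^ \<nu> * (\<alpha> gchoose \<nu>) * cos (2 ^ i * (x + (\<alpha> - real \<nu>) * h) + \<phi> i))) =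
      (- 1) ^ \<nu> * (\<alpha> gchoose \<nu>) * lacunary_poly N c \<phi> \<psi> (x + (\<alpha> - real \<nu>) * h, y)" for \<nu>
      unfolding lacunary_poly_def sum_distrib_left by (intro sum.cong refl) (simp add: mult_ac)
    ultimately show ?thesis
      unfolding frac_diff_x_def by (simp add: sums_iff lacunary_poly_def mult_ac)
  qed
  then show ?thesis by (intro that) (auto simp: fun_eq_iff)
qed

lemma frac_diff_y_lacunary_poly:
  assumes "\<alpha> > 0"
  obtains \<psi>' where "frac_diff_y \<alpha> h (lacunary_poly N c \<phi> \<psi>) = lacunary_poly N (\<lambda>i j. c i j * diff_mult \<alpha> h j) \<phi> \<psi>'"
proof -
  obtain \<psi>' where eq: "frac_diff_x \<alpha> h (lacunary_poly N (\<lambda>i j. c j i) \<psi> \<phi>) = lacunary_poly N (\<lambda>i j. c j i * diff_mult \<alpha> h i) \<psi>' \<phi>"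
    by (rule frac_diff_x_lacunary_poly[OF assms])
  have "frac_diff_y \<alpha> h (lacunary_poly N c \<phi> \<psi>) (x, y) = lacunary_poly N (\<lambda>i j. c i j * diff_mult \<alpha> h j) \<phi> \<psi>' (x, y)" for x y
    using fun_cong[OF eq, of "(y, x)"] unfolding frac_diff_x_def frac_diff_y_def prod.case lacunary_poly_swap[of N _ _ _ x] .
  then show ?thesis by (intro that) (auto simp: fun_eq_iff)
qed

section \<open>Functions with a lacunary Fourier series\<close>

text \<open>Of the class only membership in \<open>L\<^sub>p\<close> and the form of the Fourier series are used.\<close>

lemma Lambda_class_coeffs:
  assumes f: "f \<in> Lambda_class p" and p: "p > 1"
  obtains c where "f \<in> Lp_torus p" "has_lacunary_coeffs f c"
proof -
  have fL: "f \<in> Lp_torus p" using f by (auto simp: Lambda_class_def Lp0_torus_def)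
  obtain c where c: "\<And>i j. fourier_coeff cos cos f (2 ^ i) (2 ^ j) = c i j"
    "\<And>k l. (\<nexists>i j. k = 2 ^ i \<and> l = 2 ^ j) \<Longrightarrow> fourier_coeff cos cos f k l = 0"
    "\<And>k l. fourier_coeff cos sin f k l = 0" "\<And>k l. fourier_coeff sin cos f k l = 0"
    "\<And>k l. fourier_coeff sin sin f k l = 0"
    using f unfolding Lambda_class_def by blast
  define I where "I u v k l = (LINT z|torusM. f z * (u (real k * fst z) * v (real l * snd z)))"
    for u v :: "real \<Rightarrow> real" and k l :: nat
  have fc: "fourier_coeff u v f k l = (if k = 0 then 1 / (2 * pi) else 1 / pi) * (if l = 0 then 1 / (2 * pi) else 1 / pi) * I u v k l" for u v k l
    unfolding fourier_coeff_def I_def set_lebesgue_integral_def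
    by (simp add: integral_restrict_space mult.assoc)
  have Iz: "I u v k l = 0" if "fourier_coeff u v f k l = 0" for u v k l
    using that unfolding fc by (auto split: if_splits)
  have exp: "(LINT z|torusM. f z * cos_cos (real k) (real l) a b z) = cos a * cos b * I cos cos k l"
    for k l a b
  proof -
    have e: "f z * cos_cos (real k) (real l) a b z =
       cos a * cos b * (f z * (cos (real k * fst z) * cos (real l * snd z))) -
       cos a * sin b * (f z * (cos (real k * fst z) * sin (real l * snd z))) -
       sin a * cos b * (f z * (sin (real k * fst z) * cos (real l * snd z))) +
       sin a * sin b * (f z * (sin (real k * fst z) * sin (real l * snd z)))" for z
      unfolding cos_add by (simp add: algebra_simps)
    have i1: "integrable torusM (\<lambda>z. r * (f z * (cos (real k * fst z) * cos (real l * snd z))))"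
      and i2: "integrable torusM (\<lambda>z. r * (f z * (cos (real k * fst z) * sin (real l * snd z))))"
      and i3: "integrable torusM (\<lambda>z. r * (f z * (sin (real k * fst z) * cos (real l * snd z))))"
      and i4: "integrable torusM (\<lambda>z. r * (f z * (sin (real k * fst z) * sin (real l * snd z))))" for r
      by (intro integrable_mult_right integrable_Lp_mult_continuous[OF fL p] continuous_intros)+
    have "(LINT z|torusM. f z * cos_cos (real k) (real l) a b z) =
       cos a * cos b * I cos cos k l - cos a * sin b * I cos sin k l - sin a * cos b * I sin cos k l + sin a * sin b * I sin sin k l"
      unfolding e I_def
      by (subst Bochner_Integration.integral_add, intro Bochner_Integration.integrable_diff i1 i2 i3, rule i4,
          subst Bochner_Integration.integral_diff, intro Bochner_Integration.integrable_diff i1 i2, rule i3,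
          subst Bochner_Integration.integral_diff, rule i1, rule i2, simp)
    then show ?thesis using Iz[OF c(3)] Iz[OF c(4)] Iz[OF c(5)] by simp
  qed
  have "has_lacunary_coeffs f c"
    unfolding has_lacunary_coeffs_def exp
  proof (intro conjI allI impI)
    fix i j a b
    have "I cos cos (2 ^ i) (2 ^ j) = pi\<^sup>2 * c i j"
      using c(1)[of i j] unfolding fc by (simp add: power2_eq_square field_simps)
    then show "cos a * cos b * I cos cos (2 ^ i) (2 ^ j) = pi\<^sup>2 * c i j * cos a * cos b" by simp
  next
    fix k l :: nat and a b :: real
    assume "\<nexists>i j. k = 2 ^ i \<and> l = 2 ^ j"
    then show "cos a * cos b * I cos cos k l = 0" using Iz[OF c(2)] by simp
  qed
  then show ?thesis using that fL by blast
qed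

text \<open>The coefficients are square summable by Bessel's inequality, and the upper bound applies to the
  remainder, whose coefficients have small \<open>l\<^sub>2\<close> norm.\<close>

lemma lacunary_partial_sums_converge:
  assumes p: "p > 1" and f: "f \<in> Lp_torus p" "has_lacunary_coeffs f c"
  shows "(\<lambda>N. Lp_norm p (\<lambda>z. f z - cos_poly N c z)) \<longlonglongrightarrow> 0"
proof -
  have p0: "p > 0" using p by simp
  obtain B where B: "B > 0" "\<forall>N \<phi> \<psi>. \<forall>g\<in>Lp_torus p.
      sqrt (\<Sum>i<N. \<Sum>j<N. (lacunary_coeff \<phi> \<psi> g i j)\<^sup>2) \<le> B * Lp_norm p g"
    using lacunary_bessel[OF p] by blast
  obtain C where C: "C > 0"
    "\<forall>F c s. F \<in> Lp_torus p \<longrightarrow> has_lacunary_coeffs F c \<longrightarrow>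
      (\<forall>M. sqrt (\<Sum>i<M. \<Sum>j<M. (c i j)\<^sup>2) \<le> s) \<longrightarrow> Lp_norm p F \<le> C * s"
    using Lp_norm_le_lacunary_coeffs[OF p] by blast
  define s where "s N = (\<Sum>i<N. \<Sum>j<N. (c i j)\<^sup>2)" for N
  have s_alt: "s N = (\<Sum>x\<in>{..<N} \<times> {..<N}. (c (fst x) (snd x))\<^sup>2)" for N
    unfolding s_def by (simp add: sum.cartesian_product case_prod_unfold)
  have s0: "s N \<ge> 0" for N unfolding s_def by (intro sum_nonneg) auto
  have inc: "incseq s"
    unfolding incseq_def s_alt by (intro allI impI sum_mono2) auto
  have bd: "s N \<le> (B * Lp_norm p f)\<^sup>2" for N
  proof -
    have "sqrt (\<Sum>i<N. \<Sum>j<N. (lacunary_coeff (\<lambda>_. 0) (\<lambda>_. 0) f i j)\<^sup>2) \<le> B * Lp_norm p f"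
      using B(2) f(1) by blast
    then have "sqrt (s N) \<le> B * Lp_norm p f"
      by (simp add: s_def has_lacunary_coeffs_coeff[OF f(2)])
    then have "(sqrt (s N))\<^sup>2 \<le> (B * Lp_norm p f)\<^sup>2" using s0 by (intro power_mono) auto
    then show ?thesis using s0 by simp
  qed
  obtain S where S: "s \<longlonglongrightarrow> S" "\<And>N. s N \<le> S"
    using incseq_convergent[OF inc, of "(B * Lp_norm p f)\<^sup>2"] bd by blast
  let ?h = "\<lambda>N. cos_poly N c"
  have le: "Lp_norm p (\<lambda>z. f z - ?h N z) \<le> C * sqrt (S - s N)" for N
  proof (rule C(2)[rule_format])
    have hL: "?h N \<in> Lp_torus p" by (rule lacunary_poly_Lp[OF p0])
    show "(\<lambda>z. f z - ?h N z) \<in> Lp_torus p" by (rule Lp_torus_diff[OF f(1) hL p0])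
    show "has_lacunary_coeffs (\<lambda>z. f z - ?h N z) (\<lambda>i j. c i j - (if i < N \<and> j < N then c i j else 0))"
      by (rule has_lacunary_coeffs_diff[OF f(1) hL p f(2) has_lacunary_coeffs_lacunary_poly])
    fix M
    let ?d = "\<lambda>x. c (fst x) (snd x) - (if fst x < N \<and> snd x < N then c (fst x) (snd x) else 0)"
    have "(\<Sum>i<M. \<Sum>j<M. (c i j - (if i < N \<and> j < N then c i j else 0))\<^sup>2) = (\<Sum>x\<in>{..<M} \<times> {..<M}. (?d x)\<^sup>2)"
      by (simp add: sum.cartesian_product case_prod_unfold)
    also have "\<dots> \<le> (\<Sum>x\<in>{..<max M N} \<times> {..<max M N}. (?d x)\<^sup>2)"
      by (intro sum_mono2) auto
    also have "\<dots> = (\<Sum>x\<in>{..<max M N} \<times> {..<max M N} - {..<N} \<times> {..<N}. (c (fst x) (snd x))\<^sup>2)"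
      by (rule sum.mono_neutral_cong_right) auto
    also have "\<dots> = s (max M N) - s N"
      unfolding s_alt by (subst sum_diff) auto
    also have "\<dots> \<le> S - s N" using S(2) by simp
    finally show "sqrt (\<Sum>i<M. \<Sum>j<M. (c i j - (if i < N \<and> j < N then c i j else 0))\<^sup>2) \<le> sqrt (S - s N)"
      by simp
  qed
  have "(\<lambda>N. C * sqrt (S - s N)) \<longlonglongrightarrow> C * sqrt (S - S)"
    by (intro tendsto_intros S)
  then have "(\<lambda>N. C * sqrt (S - s N)) \<longlonglongrightarrow> 0" by simp
  then show ?thesis
    by (rule Lim_null_comparison[rotated]) (use le in auto)
qed

section \<open>Best angular approximation\<close>

text \<open>Fubini's theorem for a function that is measurable for the completed measure only. The function is
  replaced by a Borel function; for almost every section the two agree almost everywhere. The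
  sections are assumed to be measurable, which holds for polynomials in one variable with arbitrary
  coefficients depending on the other.\<close>

lemma integral_torus_zero_sections:
  fixes H :: "real \<times> real \<Rightarrow> real"
  assumes H: "integrable torusM H"
    and sec: "(\<forall>y. (\<lambda>x. H (x, y)) \<in> borel_measurable borel \<and> (LBINT x:{0..2 * pi}. H (x, y)) = 0) \<or>
       (\<forall>x. (\<lambda>y. H (x, y)) \<in> borel_measurable borel \<and> (LBINT y:{0..2 * pi}. H (x, y)) = 0)"
  shows "integral\<^sup>L torusM H = 0"
proof -
  define H1 where "H1 z = indicator torus z * H z" for z
  have iH1: "integrable lebesgue H1"
    using H unfolding H1_def by (simp add: integrable_restrict_space)
  have mH1: "H1 \<in> borel_measurable (completion lborel)" using iH1 by auto
  obtain H2 where H2: "H2 \<in> borel_measurable lborel" "AE z in lborel. H1 z = H2 z"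
    using completion_ex_borel_measurable_real[OF mH1] by blast
  obtain N where N': "{z \<in> space lborel. \<not> H1 z = H2 z} \<subseteq> N" "emeasure lborel N = 0" "N \<in> sets lborel"
    using H2(2) by (rule AE_E)
  then have N: "N \<in> sets lborel" "emeasure lborel N = 0" "\<And>z. z \<notin> N \<Longrightarrow> H1 z = H2 z"
    by auto
  have NH: "H2 (x, y) = indicator {0..2 * pi} y * (indicator {0..2 * pi} x * H (x, y))"
    "H2 (x, y) = indicator {0..2 * pi} x * (indicator {0..2 * pi} y * H (x, y))" if "(x, y) \<notin> N" for x y
    using N(3)[OF that] by (auto simp: H1_def torus_def indicator_def)
  have H2c: "H2 \<in> borel_measurable lebesgue" using H2(1) by (rule measurable_completion)
  have ae: "AE z in lebesgue. H1 z = H2 z" using H2(2) by (rule AE_completion)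
  have iH2': "integrable lebesgue H2" using iH1 by (subst integrable_cong_AE[OF H2c mH1]) (use ae in auto)
  have iH2: "integrable (lborel \<Otimes>\<^sub>M lborel) H2"
    using iH2' H2(1) by (simp add: integrable_completion lborel_prod)
  have "integral\<^sup>L torusM H = integral\<^sup>L lebesgue H1"
    unfolding H1_def by (simp add: integral_restrict_space)
  also have "\<dots> = integral\<^sup>L lebesgue H2" by (rule integral_cong_AE[OF mH1 H2c ae])
  also have "\<dots> = integral\<^sup>L (lborel \<Otimes>\<^sub>M lborel) H2" using H2(1) by (simp add: integral_completion lborel_prod)
  also have "\<dots> = 0"
  proof -
    have Nn: "AE z in lborel \<Otimes>\<^sub>M lborel. z \<notin> N"
      unfolding lborel_prod using N by (intro AE_not_in) (auto simp: null_sets_def)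
    have ae1: "AE x in lborel. AE y in lborel. (x, y) \<notin> N"
      by (rule lborel_pair.AE_pair[OF Nn])
    have "{z \<in> space (lborel \<Otimes>\<^sub>M lborel). (fst z, snd z) \<notin> N} = - N" by (auto simp: lborel_prod)
    also have "\<dots> \<in> sets (lborel \<Otimes>\<^sub>M lborel)" using N(1) unfolding lborel_prod by simp
    finally have ae2: "AE y in lborel. AE x in lborel. (x, y) \<notin> N"
      using ae1 lborel_pair.AE_commute[of "\<lambda>x y. (x, y) \<notin> N"] by simp
    have m2 [measurable]: "H2 \<in> borel_measurable borel" using H2(1) by simp
    from sec show ?thesis
    proof
      assume s: "\<forall>y. (\<lambda>x. H (x, y)) \<in> borel_measurable borel \<and> (LBINT x:{0..2 * pi}. H (x, y)) = 0"
      then have [measurable]: "(\<lambda>x. H (x, y)) \<in> borel_measurable borel" for y by blast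
      have "integral\<^sup>L (lborel \<Otimes>\<^sub>M lborel) H2 = (LINT y|lborel. LINT x|lborel. H2 (x, y))"
        using lborel_pair.integral_snd[of "\<lambda>x y. H2 (x, y)"] iH2 by simp
      also have "\<dots> = integral\<^sup>L lborel (\<lambda>y::real. 0)"
      proof (rule integral_cong_AE)
        show "AE y in lborel. (LINT x|lborel. H2 (x, y)) = 0"
          using ae2
        proof eventually_elim
          case (elim y)
          have "(LINT x|lborel. H2 (x, y)) = (LINT x|lborel. indicator {0..2 * pi} y * (indicator {0..2 * pi} x * H (x, y)))"
          proof (rule integral_cong_AE)
            show "AE x in lborel. H2 (x, y) = indicator {0..2 * pi} y * (indicator {0..2 * pi} x * H (x, y))"
              using elim by eventually_elim (rule NH(1))
          qed measurable
          also have "\<dots> = 0" using s by (simp add: set_lebesgue_integral_def)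
          finally show ?case .
        qed
      qed (use lborel_pair.integrable_snd[of "\<lambda>x y. H2 (x, y)"] iH2 in auto)
      finally show ?thesis by simp
    next
      assume s: "\<forall>x. (\<lambda>y. H (x, y)) \<in> borel_measurable borel \<and> (LBINT y:{0..2 * pi}. H (x, y)) = 0"
      then have [measurable]: "(\<lambda>y. H (x, y)) \<in> borel_measurable borel" for x by blast
      have "integral\<^sup>L (lborel \<Otimes>\<^sub>M lborel) H2 = (LINT x|lborel. LINT y|lborel. H2 (x, y))"
        using lborel_pair.integral_fst[of "\<lambda>x y. H2 (x, y)"] iH2 by simp
      also have "\<dots> = integral\<^sup>L lborel (\<lambda>x::real. 0)"
      proof (rule integral_cong_AE)
        show "AE x in lborel. (LINT y|lborel. H2 (x, y)) = 0"
          using ae1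
        proof eventually_elim
          case (elim x)
          have "(LINT y|lborel. H2 (x, y)) = (LINT y|lborel. indicator {0..2 * pi} x * (indicator {0..2 * pi} y * H (x, y)))"
          proof (rule integral_cong_AE)
            show "AE y in lborel. H2 (x, y) = indicator {0..2 * pi} x * (indicator {0..2 * pi} y * H (x, y))"
              using elim by eventually_elim (rule NH(2))
          qed measurable
          also have "\<dots> = 0" using s by (simp add: set_lebesgue_integral_def)
          finally show ?case .
        qed
      qed (use lborel_pair.integrable_fst[of "\<lambda>x y. H2 (x, y)"] iH2 in auto)
      finally show ?thesis by simp
    qed
  qed
  finally show ?thesis .
qed

lemma LBINT_trig_orthogonal:
  fixes a b :: "nat \<Rightarrow> real" and m K :: nat
  assumes "m < K"
  shows "(LBINT x:{0..2 * pi}. (\<Sum>k\<le>m. a k * cos (real k * x) + b k * sin (real k * x)) * (cos (real K * x) * r)) = 0"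
proof -
  let ?f = "\<lambda>x. (\<Sum>k\<le>m. a k * cos (real k * x) + b k * sin (real k * x)) * (cos (real K * x) * r)"
  have e: "?f x = (\<Sum>k\<le>m. r * a k * (cos (real K * x + 0) * cos (real k * x + 0)) + r * b k * (cos (real K * x + 0) * cos (real k * x + - (pi / 2))))" for x
    unfolding sum_distrib_right by (intro sum.cong refl) (simp add: cos_diff algebra_simps)
  have K: "K > 0" using assms by simp
  have "set_integrable lborel {0..2 * pi} ?f"
    by (intro borel_integrable_atLeastAtMost' continuous_intros)
  then have "(LBINT x:{0..2 * pi}. ?f x) = integral {0..2 * pi} ?f"
    by (rule set_borel_integral_eq_integral)
  also have "\<dots> = (\<Sum>k\<le>m. integral {0..2 * pi} (\<lambda>x. r * a k * (cos (real K * x + 0) * cos (real k * x + 0)) + r * b k * (cos (real K * x + 0) * cos (real k * x + - (pi / 2)))))"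
    unfolding e by (rule integral_sum) (auto intro!: integrable_continuous_interval continuous_intros)
  also have "\<dots> = 0"
  proof (intro sum.neutral ballI)
    fix k assume "k \<in> {..m}"
    then have Kk: "K \<noteq> k" using assms by auto
    have "integral {0..2 * pi} (\<lambda>x. r * a k * (cos (real K * x + 0) * cos (real k * x + 0)) + r * b k * (cos (real K * x + 0) * cos (real k * x + - (pi / 2)))) =
       r * a k * integral {0..2 * pi} (\<lambda>x. cos (real K * x + 0) * cos (real k * x + 0)) +
       r * b k * integral {0..2 * pi} (\<lambda>x. cos (real K * x + 0) * cos (real k * x + - (pi / 2)))"
      by (subst integral_add) (auto intro!: integrable_continuous_interval continuous_intros simp del: add_0_right)
    then show "integral {0..2 * pi} (\<lambda>x. r * a k * (cos (real K * x + 0) * cos (real k * x + 0)) + r * b k * (cos (real K * x + 0) * cos (real k * x + - (pi / 2)))) = 0"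
      unfolding integral_cos_mult_cos[OF K] using Kk by simp
  qed
  finally show ?thesis .
qed

lemma trig_poly_x_orthogonal:
  assumes T: "T \<in> Lp_torus p" "trig_poly_x m T" and p: "p > 1" and K: "m < K"
  shows "(LINT z|torusM. T z * (cos (real K * fst z) * cos (l * snd z))) = 0"
proof (rule integral_torus_zero_sections)
  show "integrable torusM (\<lambda>z. T z * (cos (real K * fst z) * cos (l * snd z)))"
    by (intro integrable_Lp_mult_continuous[OF T(1) p] continuous_intros)
  obtain a b where ab: "\<And>x y. T (x, y) = (\<Sum>k\<le>m. a k y * cos (real k * x) + b k y * sin (real k * x))"
    using T(2) unfolding trig_poly_x_def by blast
  show "(\<forall>y. (\<lambda>x. T (x, y) * (cos (real K * fst (x, y)) * cos (l * snd (x, y)))) \<in> borel_measurable borel \<and> (LBINT x:{0..2 * pi}. T (x, y) * (cos (real K * fst (x, y)) * cos (l * snd (x, y)))) = 0) \<or>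
       (\<forall>x. (\<lambda>y. T (x, y) * (cos (real K * fst (x, y)) * cos (l * snd (x, y)))) \<in> borel_measurable borel \<and> (LBINT y:{0..2 * pi}. T (x, y) * (cos (real K * fst (x, y)) * cos (l * snd (x, y)))) = 0)"
    unfolding ab fst_conv snd_conv
    by (intro disjI1 allI conjI LBINT_trig_orthogonal K borel_measurable_continuous_onI continuous_intros)
qed

lemma trig_poly_y_orthogonal:
  assumes T: "T \<in> Lp_torus p" "trig_poly_y m T" and p: "p > 1" and K: "m < K"
  shows "(LINT z|torusM. T z * (cos (real K * snd z) * cos (l * fst z))) = 0"
proof (rule integral_torus_zero_sections)
  show "integrable torusM (\<lambda>z. T z * (cos (real K * snd z) * cos (l * fst z)))"
    by (intro integrable_Lp_mult_continuous[OF T(1) p] continuous_intros)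
  obtain a b where ab: "\<And>x y. T (x, y) = (\<Sum>k\<le>m. a k x * cos (real k * y) + b k x * sin (real k * y))"
    using T(2) unfolding trig_poly_y_def by blast
  show "(\<forall>y. (\<lambda>x. T (x, y) * (cos (real K * snd (x, y)) * cos (l * fst (x, y)))) \<in> borel_measurable borel \<and> (LBINT x:{0..2 * pi}. T (x, y) * (cos (real K * snd (x, y)) * cos (l * fst (x, y)))) = 0) \<or>
       (\<forall>x. (\<lambda>y. T (x, y) * (cos (real K * snd (x, y)) * cos (l * fst (x, y)))) \<in> borel_measurable borel \<and> (LBINT y:{0..2 * pi}. T (x, y) * (cos (real K * snd (x, y)) * cos (l * fst (x, y)))) = 0)"
    unfolding ab fst_conv snd_conv
    by (intro disjI2 allI conjI LBINT_trig_orthogonal K borel_measurable_continuous_onI continuous_intros)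
qed

text \<open>The sum of the squares of the coefficients at frequencies above \<open>m1\<close> and \<open>m2\<close>, restricted to
  indices below \<open>N\<close>. The truncation keeps all sums finite.\<close>

definition tail_energy :: "nat \<Rightarrow> (nat \<Rightarrow> nat \<Rightarrow> real) \<Rightarrow> nat \<Rightarrow> nat \<Rightarrow> real" where
  "tail_energy N c m1 m2 = (\<Sum>i<N. \<Sum>j<N. if m1 < 2 ^ i \<and> m2 < 2 ^ j then (c i j)\<^sup>2 else 0)"

lemma tail_energy_eq: "tail_energy N c m1 m2 = (\<Sum>i<N. \<Sum>j<N. (if m1 < 2 ^ i \<and> m2 < 2 ^ j then c i j else 0)\<^sup>2)"
  unfolding tail_energy_def by (intro sum.cong refl) auto

lemma tail_energy_nonneg: "tail_energy N c m1 m2 \<ge> 0"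
  unfolding tail_energy_eq by (intro sum_nonneg) auto

text \<open>The subtracted polynomials have no coefficients at frequencies above both \<open>m1\<close> and \<open>m2\<close>, so Bessel's
  inequality bounds every competitor from below.\<close>

lemma angular_approx_lower:
  assumes p: "p > 1"
  obtains C where "C > 0"
    "\<And>f c N m1 m2. f \<in> Lp_torus p \<Longrightarrow> has_lacunary_coeffs f c \<Longrightarrow>
       sqrt (tail_energy N c m1 m2) \<le> C * angular_approx p m1 m2 f"
proof -
  have p0: "p > 0" using p by simp
  obtain B where B: "B > 0" "\<forall>N \<phi> \<psi>. \<forall>g\<in>Lp_torus p.
      sqrt (\<Sum>i<N. \<Sum>j<N. (lacunary_coeff \<phi> \<psi> g i j)\<^sup>2) \<le> B * Lp_norm p g"
    using lacunary_bessel[OF p] by blast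
  show ?thesis
  proof (rule that[OF B(1)])
    fix f c and N m1 m2 :: nat
    assume f: "f \<in> Lp_torus p" "has_lacunary_coeffs f c"
    have "sqrt (tail_energy N c m1 m2) / B \<le> angular_approx p m1 m2 f"
      unfolding angular_approx_def
    proof (rule cInf_greatest)
      have 0: "(\<lambda>z. 0) \<in> Lp_torus p" using p0 by (intro Lp_torus_continuous) (auto simp: torus_periodic_def)
      have "trig_poly_x m1 (\<lambda>z. 0)" "trig_poly_y m2 (\<lambda>z. 0)"
        unfolding trig_poly_x_def trig_poly_y_def by (intro exI[of _ "\<lambda>_ _. 0"]; simp)+
      then show "{Lp_norm p (\<lambda>z. f z - T1 z - T2 z) | T1 T2.
         T1 \<in> Lp_torus p \<and> T2 \<in> Lp_torus p \<and> trig_poly_x m1 T1 \<and> trig_poly_y m2 T2} \<noteq> {}"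
        using 0 by blast
      fix r assume "r \<in> {Lp_norm p (\<lambda>z. f z - T1 z - T2 z) | T1 T2.
         T1 \<in> Lp_torus p \<and> T2 \<in> Lp_torus p \<and> trig_poly_x m1 T1 \<and> trig_poly_y m2 T2}"
      then obtain T1 T2 where T: "T1 \<in> Lp_torus p" "T2 \<in> Lp_torus p" "trig_poly_x m1 T1" "trig_poly_y m2 T2"
        and r: "r = Lp_norm p (\<lambda>z. f z - T1 z - T2 z)" by blast
      have g: "(\<lambda>z. f z - T1 z - T2 z) \<in> Lp_torus p"
        by (intro Lp_torus_diff f T p0)
      have co: "lacunary_coeff (\<lambda>_. 0) (\<lambda>_. 0) (\<lambda>z. f z - T1 z - T2 z) i j = c i j" if m: "m1 < 2 ^ i" "m2 < 2 ^ j" for i j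
      proof -
        let ?e = "\<lambda>z. cos_cos (real (2 ^ i)) (real (2 ^ j)) 0 0 z"
        have ce: "continuous_on UNIV ?e" by (intro continuous_intros)
        have "(LINT z|torusM. f z * ?e z) = pi\<^sup>2 * c i j * cos 0 * cos 0"
          using f(2) unfolding has_lacunary_coeffs_def by blast
        moreover have "(LINT z|torusM. T1 z * ?e z) = 0"
          using trig_poly_x_orthogonal[OF T(1) T(3) p m(1), of "real (2 ^ j)"] by simp
        moreover have "(LINT z|torusM. T2 z * ?e z) = 0"
          using trig_poly_y_orthogonal[OF T(2) T(4) p m(2), of "real (2 ^ i)"] by (simp add: mult.commute)
        moreover have "(LINT z|torusM. (f z - T1 z - T2 z) * ?e z) =
           (LINT z|torusM. f z * ?e z) - (LINT z|torusM. T1 z * ?e z) - (LINT z|torusM. T2 z * ?e z)"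
          unfolding left_diff_distrib
          by (subst Bochner_Integration.integral_diff, intro Bochner_Integration.integrable_diff
                integrable_Lp_mult_continuous[OF f(1) p ce] integrable_Lp_mult_continuous[OF T(1) p ce], rule integrable_Lp_mult_continuous[OF T(2) p ce],
              subst Bochner_Integration.integral_diff, rule integrable_Lp_mult_continuous[OF f(1) p ce], rule integrable_Lp_mult_continuous[OF T(1) p ce], rule refl)
        ultimately show ?thesis by (simp add: lacunary_coeff_def)
      qed
      have "tail_energy N c m1 m2 \<le> (\<Sum>i<N. \<Sum>j<N. (lacunary_coeff (\<lambda>_. 0) (\<lambda>_. 0) (\<lambda>z. f z - T1 z - T2 z) i j)\<^sup>2)"
        unfolding tail_energy_def by (intro sum_mono) (simp add: co)
      then have "sqrt (tail_energy N c m1 m2) \<le> sqrt (\<Sum>i<N. \<Sum>j<N. (lacunary_coeff (\<lambda>_. 0) (\<lambda>_. 0) (\<lambda>z. f z - T1 z - T2 z) i j)\<^sup>2)"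
        by simp
      also have "\<dots> \<le> B * Lp_norm p (\<lambda>z. f z - T1 z - T2 z)" using B(2) g by blast
      finally have "sqrt (tail_energy N c m1 m2) \<le> B * Lp_norm p (\<lambda>z. f z - T1 z - T2 z)" .
      then show "sqrt (tail_energy N c m1 m2) / B \<le> r"
        unfolding r using B(1) by (simp add: field_simps)
    qed
    then show "sqrt (tail_energy N c m1 m2) \<le> B * angular_approx p m1 m2 f"
      using B(1) by (simp add: field_simps)
  qed
qed

lemma lacunary_poly_trig_poly_x:
  assumes "\<And>i j. i < N \<Longrightarrow> j < N \<Longrightarrow> c i j \<noteq> 0 \<Longrightarrow> 2 ^ i \<le> m"
  shows "trig_poly_x m (cos_poly N c)"
proof -
  define b where "b i y = (\<Sum>j<N. c i j * cos (2 ^ j * y))" for i y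
  have b0: "b i y = 0" if "i < N" "\<not> 2 ^ i \<le> m" for i y
    unfolding b_def using assms[OF that(1)] that(2) by (intro sum.neutral) auto
  have "cos_poly N c (x, y) =
     (\<Sum>k\<le>m. (\<Sum>i<N. if 2 ^ i = k then b i y else 0) * cos (real k * x) + 0 * sin (real k * x))" for x y
  proof -
    have "(\<Sum>k\<le>m. (\<Sum>i<N. if 2 ^ i = k then b i y else 0) * cos (real k * x) + 0 * sin (real k * x)) =
       (\<Sum>i<N. \<Sum>k\<le>m. if 2 ^ i = k then b i y * cos (2 ^ i * x) else 0)"
      unfolding sum_distrib_right mult_zero_left add_0_right
      by (subst sum.swap) (intro sum.cong refl, auto)
    also have "\<dots> = (\<Sum>i<N. b i y * cos (2 ^ i * x))"
      using b0 by (intro sum.cong refl) auto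
    also have "\<dots> = cos_poly N c (x, y)"
      unfolding b_def lacunary_poly_def sum_distrib_right by (simp add: mult_ac)
    finally show ?thesis by simp
  qed
  then show ?thesis unfolding trig_poly_x_def by (intro exI allI)
qed

lemma lacunary_poly_trig_poly_y:
  assumes "\<And>i j. i < N \<Longrightarrow> j < N \<Longrightarrow> c i j \<noteq> 0 \<Longrightarrow> 2 ^ j \<le> m"
  shows "trig_poly_y m (cos_poly N c)"
proof -
  have "trig_poly_x m (cos_poly N (\<lambda>i j. c j i))"
    by (rule lacunary_poly_trig_poly_x) (use assms in blast)
  then obtain a b where ab: "\<forall>x y. cos_poly N (\<lambda>i j. c j i) (x, y) =
      (\<Sum>k\<le>m. a k y * cos (real k * x) + b k y * sin (real k * x))"
    unfolding trig_poly_x_def by blast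
  have swap: "cos_poly N c (x, y) = cos_poly N (\<lambda>i j. c j i) (y, x)" for x y
    by (rule lacunary_poly_swap)
  show ?thesis
    unfolding trig_poly_y_def swap by (rule exI[of _ a], rule exI[of _ b]) (use ab in simp)
qed

text \<open>A competitor is obtained from the partial sum: the terms with \<open>2 ^ i \<le> m1\<close> form a polynomial of
  degree \<open>m1\<close> in \<open>x\<close>, and among the others those with \<open>2 ^ j \<le> m2\<close> one of degree \<open>m2\<close> in \<open>y\<close>.\<close>

lemma angular_approx_upper:
  assumes p: "p > 1"
  obtains C where "C > 0"
    "\<And>f c N m1 m2. f \<in> Lp_torus p \<Longrightarrow>
       angular_approx p m1 m2 f \<le> C * (sqrt (tail_energy N c m1 m2) +
          Lp_norm p (\<lambda>z. f z - cos_poly N c z))"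
proof -
  have p0: "p > 0" using p by simp
  obtain C where C: "C > 0"
    "\<And>N c \<phi> \<psi>. Lp_norm p (lacunary_poly N c \<phi> \<psi>) \<le> C * sqrt (\<Sum>i<N. \<Sum>j<N. (c i j)\<^sup>2)"
    using lacunary_Lp_upper[OF p0] by blast
  show ?thesis
  proof (rule that[of "4 * (C + 1)"])
    show "4 * (C + 1) > 0" using C by simp
    fix f and N m1 m2 :: nat and c :: "nat \<Rightarrow> nat \<Rightarrow> real"
    assume f: "f \<in> Lp_torus p"
    let ?L = "\<lambda>c. cos_poly N c"
    let ?d = "\<lambda>i j. if m1 < 2 ^ i \<and> m2 < 2 ^ j then c i j else 0"
    let ?c1 = "\<lambda>i j. if 2 ^ i \<le> m1 then c i j else 0"
    let ?c2 = "\<lambda>i j. if m1 < 2 ^ i \<and> 2 ^ j \<le> m2 then c i j else 0"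
    have T: "?L ?c1 \<in> Lp_torus p" "?L ?c2 \<in> Lp_torus p" "trig_poly_x m1 (?L ?c1)" "trig_poly_y m2 (?L ?c2)"
      by (auto intro!: lacunary_poly_Lp p0 lacunary_poly_trig_poly_x lacunary_poly_trig_poly_y split: if_splits)
    have "?L c z = ?L ?c1 z + ?L ?c2 z + ?L ?d z" for z
      unfolding lacunary_poly_def sum.distrib[symmetric] by (intro sum.cong refl) auto
    then have e: "f z - ?L ?c1 z - ?L ?c2 z = (f z - ?L c z) + ?L ?d z" for z by simp
    have "angular_approx p m1 m2 f \<le> Lp_norm p (\<lambda>z. f z - ?L ?c1 z - ?L ?c2 z)"
      unfolding angular_approx_def
    proof (rule cInf_lower)
      show "bdd_below {Lp_norm p (\<lambda>z. f z - T1 z - T2 z) | T1 T2.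
         T1 \<in> Lp_torus p \<and> T2 \<in> Lp_torus p \<and> trig_poly_x m1 T1 \<and> trig_poly_y m2 T2}"
        by (rule bdd_belowI[of _ 0]) auto
    qed (use T in blast)
    also have "\<dots> = Lp_norm p (\<lambda>z. (f z - ?L c z) + ?L ?d z)" unfolding e ..
    also have "\<dots> \<le> 4 * (Lp_norm p (\<lambda>z. f z - ?L c z) + Lp_norm p (?L ?d))"
      by (intro Lp_norm_add Lp_torus_diff f lacunary_poly_Lp p0 p)
    also have "\<dots> \<le> 4 * (Lp_norm p (\<lambda>z. f z - ?L c z) + C * sqrt (tail_energy N c m1 m2))"
      using C(2)[of N ?d "\<lambda>_. 0" "\<lambda>_. 0"] unfolding tail_energy_eq by simp
    also have "\<dots> \<le> 4 * (C + 1) * (sqrt (tail_energy N c m1 m2) + Lp_norm p (\<lambda>z. f z - ?L c z))"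
    proof -
      have "C * Lp_norm p (\<lambda>z. f z - ?L c z) \<ge> 0" "sqrt (tail_energy N c m1 m2) \<ge> 0"
        using C(1) tail_energy_nonneg by auto
      then show ?thesis by (simp add: algebra_simps)
    qed
    finally show "angular_approx p m1 m2 f \<le> 4 * (C + 1) * (sqrt (tail_energy N c m1 m2) + Lp_norm p (\<lambda>z. f z - ?L c z))" .
  qed
qed

lemma angular_approx_nonneg: "angular_approx p m1 m2 f \<ge> 0" if "p > 1"
proof -
  have p0: "p > 0" using that by simp
  show ?thesis unfolding angular_approx_def
  proof (rule cInf_greatest)
    have 0: "(\<lambda>z. 0) \<in> Lp_torus p" using p0 by (intro Lp_torus_continuous) (auto simp: torus_periodic_def)
    have "trig_poly_x m1 (\<lambda>z. 0)" "trig_poly_y m2 (\<lambda>z. 0)"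
      unfolding trig_poly_x_def trig_poly_y_def by (intro exI[of _ "\<lambda>_ _. 0"]; simp)+
    then show "{Lp_norm p (\<lambda>z. f z - T1 z - T2 z) | T1 T2.
       T1 \<in> Lp_torus p \<and> T2 \<in> Lp_torus p \<and> trig_poly_x m1 T1 \<and> trig_poly_y m2 T2} \<noteq> {}"
      using 0 by blast
  qed auto
qed

section \<open>Power sums and difference multipliers\<close>

text \<open>The mean value theorem for \<open>x powr b\<close> on \<open>[n - 1, n]\<close>. For \<open>n = 1\<close> the derivative may be singular at
  \<open>0\<close>, and the claim is checked directly.\<close>

lemma powr_diff_bounds:
  fixes b :: real and n :: nat
  assumes b: "b > 0" and n: "n \<ge> 1"
  shows "b \<le> 1 \<Longrightarrow> b * real n powr (b - 1) \<le> real n powr b - real (n - 1) powr b"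
    and "b \<ge> 1 \<Longrightarrow> real n powr b - real (n - 1) powr b \<le> b * real n powr (b - 1)"
proof -
  have "(b \<le> 1 \<longrightarrow> b * real n powr (b - 1) \<le> real n powr b - real (n - 1) powr b) \<and>
    (b \<ge> 1 \<longrightarrow> real n powr b - real (n - 1) powr b \<le> b * real n powr (b - 1))"
  proof (cases "n = 1")
    case True
    then show ?thesis using b by simp
  next
    case False
    then have n2: "n \<ge> 2" using n by simp
    have "\<exists>z. real (n - 1) < z \<and> z < real n \<and>
        real n powr b - real (n - 1) powr b = (real n - real (n - 1)) * (b * z powr (b - 1))"
    proof (rule MVT2)
      show "real (n - 1) < real n" using n2 by simp
      fix x assume "real (n - 1) \<le> x"
      then have "x > 0" using n2 by linarith
      then show "((\<lambda>x. x powr b) has_real_derivative b * x powr (b - 1)) (at x)"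
        by (rule has_real_derivative_powr)
    qed
    then obtain z where z: "real (n - 1) < z" "z < real n"
      "real n powr b - real (n - 1) powr b = b * z powr (b - 1)" using n by (auto simp: of_nat_diff)
    have z0: "z > 0" using z(1) by linarith
    have "b \<le> 1 \<longrightarrow> real n powr (b - 1) \<le> z powr (b - 1)"
      using z z0 by (auto intro!: powr_mono2')
    moreover have "b \<ge> 1 \<longrightarrow> z powr (b - 1) \<le> real n powr (b - 1)"
      using z z0 by (auto intro!: powr_mono2)
    ultimately show ?thesis using b z(3) by simp
  qed
  then show "b \<le> 1 \<Longrightarrow> b * real n powr (b - 1) \<le> real n powr b - real (n - 1) powr b"
    and "b \<ge> 1 \<Longrightarrow> real n powr b - real (n - 1) powr b \<le> b * real n powr (b - 1)" by auto
qed

text \<open>For either sign of \<open>b - 1\<close>, one bound compares all terms with the last one and the other bound telescopes.\<close>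

lemma sum_powr_asymp:
  fixes b :: real
  assumes b: "b > 0"
  shows "\<exists>c1>0. \<exists>c2>0. \<forall>M. c1 * real M powr b \<le> (\<Sum>\<nu>=1..M. real \<nu> powr (b - 1)) \<and>
     (\<Sum>\<nu>=1..M. real \<nu> powr (b - 1)) \<le> c2 * real M powr b"
proof -
  have tel: "(\<Sum>\<nu>=1..M. real \<nu> powr b - real (\<nu> - 1) powr b) = real M powr b" for M
    by (induction M) auto
  have Mb: "(\<Sum>\<nu>=1..M. real M powr (b - 1)) = real M powr b" for M
  proof (cases "M = 0")
    case False
    have "real M powr 1 * real M powr (b - 1) = real M powr b" by (simp only: powr_add[symmetric]) simp
    then show ?thesis by simp
  qed simp
  have S: "b * (\<Sum>\<nu>=1..M. real \<nu> powr (b - 1)) = (\<Sum>\<nu>=1..M. b * real \<nu> powr (b - 1))" for M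
    by (rule sum_distrib_left)
  show ?thesis
  proof (cases "b \<le> 1")
    case True
    have "(\<Sum>\<nu>=1..M. real M powr (b - 1)) \<le> (\<Sum>\<nu>=1..M. real \<nu> powr (b - 1))" for M
      using True by (intro sum_mono powr_mono2') auto
    then have l: "1 * real M powr b \<le> (\<Sum>\<nu>=1..M. real \<nu> powr (b - 1))" for M unfolding Mb by simp
    have "(\<Sum>\<nu>=1..M. b * real \<nu> powr (b - 1)) \<le> (\<Sum>\<nu>=1..M. real \<nu> powr b - real (\<nu> - 1) powr b)" for M
      using True b by (intro sum_mono powr_diff_bounds(1)) auto
    then have "b * (\<Sum>\<nu>=1..M. real \<nu> powr (b - 1)) \<le> real M powr b" for M
      unfolding S tel .
    then have "(\<Sum>\<nu>=1..M. real \<nu> powr (b - 1)) \<le> 1 / b * real M powr b" for M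
      using b by (simp add: field_simps)
    then show ?thesis using l b
      by (intro exI[of _ 1] conjI exI[of _ "1 / b"] allI) auto
  next
    case False
    have "(\<Sum>\<nu>=1..M. real \<nu> powr (b - 1)) \<le> (\<Sum>\<nu>=1..M. real M powr (b - 1))" for M
      using False by (intro sum_mono powr_mono2) auto
    then have u: "(\<Sum>\<nu>=1..M. real \<nu> powr (b - 1)) \<le> 1 * real M powr b" for M unfolding Mb by simp
    have "(\<Sum>\<nu>=1..M. real \<nu> powr b - real (\<nu> - 1) powr b) \<le> (\<Sum>\<nu>=1..M. b * real \<nu> powr (b - 1))" for M
      using False b by (intro sum_mono powr_diff_bounds(2)) auto
    then have "real M powr b \<le> b * (\<Sum>\<nu>=1..M. real \<nu> powr (b - 1))" for M
      unfolding S tel .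
    then have "1 / b * real M powr b \<le> (\<Sum>\<nu>=1..M. real \<nu> powr (b - 1))" for M
      using b by (simp add: field_simps)
    then show ?thesis using u b
      by (intro exI[of _ "1 / b"] conjI exI[of _ 1] allI) auto
  qed
qed

text \<open>The size of the frequency \<open>2 ^ i\<close> relative to the resolution \<open>n\<close>, cut off at \<open>1\<close>.\<close>

definition freq_ratio :: "nat \<Rightarrow> nat \<Rightarrow> real" where
  "freq_ratio n i = min 1 (2 ^ i / real n)"

lemma freq_ratio_pos: "n \<ge> 1 \<Longrightarrow> freq_ratio n i > 0"
  by (simp add: freq_ratio_def)

text \<open>The total weight that the sum over \<open>\<nu>\<close> in the theorem gives to the frequency \<open>2 ^ i\<close>: this frequency
  is counted by the approximation of degree \<open>\<nu> - 1\<close> if \<open>\<nu> - 1 < 2 ^ i\<close>.\<close>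

definition approx_weight :: "real \<Rightarrow> nat \<Rightarrow> nat \<Rightarrow> real" where
  "approx_weight \<alpha> n i = (\<Sum>\<nu>=1..n + 1. if \<nu> - 1 < 2 ^ i then real \<nu> powr (2 * \<alpha> - 1) else 0)"

lemma approx_weight_asymp:
  assumes \<alpha>: "\<alpha> > 0"
  shows "\<exists>c1>0. \<exists>c2>0. \<forall>n\<ge>1. \<forall>i.
     c1 * freq_ratio n i powr (2 * \<alpha>) \<le> (1 / real n powr \<alpha>)\<^sup>2 * approx_weight \<alpha> n i \<and>
     (1 / real n powr \<alpha>)\<^sup>2 * approx_weight \<alpha> n i \<le> c2 * freq_ratio n i powr (2 * \<alpha>)"
proof -
  obtain c1 c2 where c: "c1 > 0" "c2 > 0"
    "\<forall>M. c1 * real M powr (2 * \<alpha>) \<le> (\<Sum>\<nu>=1..M. real \<nu> powr (2 * \<alpha> - 1)) \<and>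
     (\<Sum>\<nu>=1..M. real \<nu> powr (2 * \<alpha> - 1)) \<le> c2 * real M powr (2 * \<alpha>)"
    using sum_powr_asymp[of "2 * \<alpha>"] \<alpha> by auto
  have main: "c1 * freq_ratio n i powr (2 * \<alpha>) \<le> (1 / real n powr \<alpha>)\<^sup>2 * approx_weight \<alpha> n i \<and>
     (1 / real n powr \<alpha>)\<^sup>2 * approx_weight \<alpha> n i \<le> (c2 * 2 powr (2 * \<alpha>)) * freq_ratio n i powr (2 * \<alpha>)"
    if n: "n \<ge> 1" for n i :: nat
  proof -
    define M where "M = min (n + 1) (2 ^ i)"
    define f where "f = freq_ratio n i"
    have f0: "f > 0" using freq_ratio_pos[OF n] f_def by simp
    have "approx_weight \<alpha> n i = (\<Sum>\<nu>\<in>{1..n + 1} \<inter> {\<nu>. \<nu> - 1 < 2 ^ i}. real \<nu> powr (2 * \<alpha> - 1))"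
      unfolding approx_weight_def by (simp add: sum.inter_restrict)
    also have "{1..n + 1} \<inter> {\<nu>. \<nu> - 1 < 2 ^ i} = {1..M}"
      unfolding M_def by auto
    finally have V: "approx_weight \<alpha> n i = (\<Sum>\<nu>=1..M. real \<nu> powr (2 * \<alpha> - 1))" .
    have Mr: "real M = min (real n + 1) (2 ^ i)" unfolding M_def by (simp add: of_nat_min)
    have nf: "real n * f = min (real n) (2 ^ i)"
      using n unfolding f_def freq_ratio_def by (simp add: min_mult_distrib_left)
    have min_shift: "min a t \<le> min (a + 1) t \<and> min (a + 1) t \<le> 2 * min a t" if "a \<ge> 1" "t \<ge> 1" for a t :: real
      using that by (auto simp: min_def)
    have M1: "real n * f \<le> real M" and M2: "real M \<le> 2 * (real n * f)"
      unfolding nf Mr using min_shift[of "real n" "2 ^ i"] n by simp_all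
    have k: "(1 / real n powr \<alpha>)\<^sup>2 * (real n * f) powr (2 * \<alpha>) = f powr (2 * \<alpha>)"
    proof -
      have "(real n powr \<alpha>)\<^sup>2 = real n powr (2 * \<alpha>)"
        using n by (simp add: power2_eq_square powr_add[symmetric])
      then show ?thesis using n f0 by (simp add: powr_mult power_divide)
    qed
    have "c1 * f powr (2 * \<alpha>) = (1 / real n powr \<alpha>)\<^sup>2 * (c1 * (real n * f) powr (2 * \<alpha>))"
      by (subst k[symmetric]) simp
    also have "\<dots> \<le> (1 / real n powr \<alpha>)\<^sup>2 * (c1 * real M powr (2 * \<alpha>))"
      using M1 f0 \<alpha> c by (intro mult_left_mono powr_mono2) auto
    also have "\<dots> \<le> (1 / real n powr \<alpha>)\<^sup>2 * approx_weight \<alpha> n i"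
      unfolding V using c by (intro mult_left_mono) auto
    finally have 1: "c1 * f powr (2 * \<alpha>) \<le> (1 / real n powr \<alpha>)\<^sup>2 * approx_weight \<alpha> n i" .
    have "(1 / real n powr \<alpha>)\<^sup>2 * approx_weight \<alpha> n i \<le> (1 / real n powr \<alpha>)\<^sup>2 * (c2 * real M powr (2 * \<alpha>))"
      unfolding V using c by (intro mult_left_mono) auto
    also have "\<dots> \<le> (1 / real n powr \<alpha>)\<^sup>2 * (c2 * (2 * (real n * f)) powr (2 * \<alpha>))"
      using M2 \<alpha> c by (intro mult_left_mono powr_mono2) auto
    also have "\<dots> = (c2 * 2 powr (2 * \<alpha>)) * ((1 / real n powr \<alpha>)\<^sup>2 * (real n * f) powr (2 * \<alpha>))"
      by (simp add: powr_mult)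
    also have "\<dots> = (c2 * 2 powr (2 * \<alpha>)) * f powr (2 * \<alpha>)" unfolding k ..
    finally show ?thesis using 1 unfolding f_def by blast
  qed
  show ?thesis
    by (rule exI[of _ c1], rule conjI[OF c(1)], rule exI[of _ "c2 * 2 powr (2 * \<alpha>)"], rule conjI)
       (use c main in auto)
qed

lemma powr_power2: "(x powr a)\<^sup>2 = x powr (2 * a)" for x a :: real
  by (simp add: power2_eq_square powr_add[symmetric])

lemma diff_mult_upper:
  assumes \<alpha>: "\<alpha> > 0" and n: "n \<ge> 1" and h: "\<bar>h\<bar> \<le> 1 / real n"
  shows "(diff_mult \<alpha> h i)\<^sup>2 \<le> (2 powr \<alpha>)\<^sup>2 * freq_ratio n i powr (2 * \<alpha>)"
proof -
  have "\<bar>sin (2 ^ i * h / 2)\<bar> \<le> 2 ^ i / real n"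
  proof -
    have "\<bar>sin (2 ^ i * h / 2)\<bar> \<le> \<bar>2 ^ i * h / 2\<bar>" by (rule abs_sin_x_le_abs_x)
    also have "\<dots> \<le> 2 ^ i * \<bar>h\<bar>" by (simp add: abs_mult)
    also have "\<dots> \<le> 2 ^ i * (1 / real n)" using h by (intro mult_left_mono) auto
    finally show ?thesis by simp
  qed
  then have "2 * \<bar>sin (2 ^ i * h / 2)\<bar> \<le> 2 * freq_ratio n i"
    unfolding freq_ratio_def by simp
  then have "diff_mult \<alpha> h i \<le> (2 * freq_ratio n i) powr \<alpha>"
    unfolding diff_mult_def using \<alpha> by (intro powr_mono2) auto
  also have "\<dots> = 2 powr \<alpha> * freq_ratio n i powr \<alpha>"
    by (simp add: powr_mult)
  finally have "(diff_mult \<alpha> h i)\<^sup>2 \<le> (2 powr \<alpha> * freq_ratio n i powr \<alpha>)\<^sup>2"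
    by (intro power_mono) (auto simp: diff_mult_def)
  then show ?thesis by (simp only: power_mult_distrib powr_power2)
qed

lemma abs_cos_pow2_third: "\<bar>cos (2 ^ d * (pi / 3))\<bar> = 1 / 2"
proof (induction d)
  case (Suc d)
  have "cos (2 ^ Suc d * (pi / 3)) = 2 * (cos (2 ^ d * (pi / 3)))\<^sup>2 - 1"
    using cos_double_cos[of "2 ^ d * (pi / 3)"] by (simp add: mult.assoc)
  also have "(cos (2 ^ d * (pi / 3)))\<^sup>2 = (1 / 2)\<^sup>2"
    using Suc by (metis power2_abs)
  finally show ?case by (simp add: power2_eq_square)
qed (simp add: cos_60)

lemma half_le_sin: "x / 2 \<le> sin x" if "0 \<le> x" "x \<le> pi / 3" for x :: real
proof (cases "x = 0")
  case False
  then have x: "0 < x" using that by simp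
  have "\<exists>z. 0 < z \<and> z < x \<and> sin x - sin 0 = (x - 0) * cos z"
    by (rule MVT2[OF x]) (auto intro!: derivative_eq_intros)
  then obtain z where z: "0 < z" "z < x" "sin x = x * cos z" by auto
  have "cos (pi / 3) \<le> cos z"
    using z that pi_gt_zero by (intro cos_monotone_0_pi_le) auto
  then show ?thesis using z(3) x mult_left_mono[of "1 / 2" "cos z" x] by (simp add: cos_60)
qed simp

text \<open>A single step \<open>h\<close> resolves all frequencies at once. It is \<open>h = 2 * pi / (3 * 2 ^ k)\<close> with \<open>2 ^ k\<close> comparable
  to \<open>n\<close>: doubling the angle \<open>pi / 3\<close> never changes the modulus of its cosine, so the sine stays away
  from \<open>0\<close> at all frequencies \<open>2 ^ i\<close> with \<open>k \<le> i\<close>, whereas for \<open>i < k\<close> the angles lie below \<open>pi / 3\<close>,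
  where the sine is comparable to its argument.\<close>

lemma diff_mult_lower:
  assumes n: "n \<ge> 1"
  obtains h where "\<bar>h\<bar> \<le> 1 / real n"
    "\<And>\<alpha> i. \<alpha> > 0 \<Longrightarrow> freq_ratio n i powr (2 * \<alpha>) \<le> (16 powr \<alpha>)\<^sup>2 * (diff_mult \<alpha> h i)\<^sup>2"
proof -
  define k where "k = (LEAST k. 4 * n \<le> 2 ^ k)"
  have ex: "4 * n \<le> 2 ^ (4 * n)" using less_exp[of "4 * n"] by simp
  have k1: "4 * n \<le> 2 ^ k" unfolding k_def by (rule LeastI[of "\<lambda>k. 4 * n \<le> 2 ^ k", OF ex])
  have k2: "2 ^ k \<le> 8 * n"
  proof (cases k)
    case 0
    then show ?thesis using n by simp
  next
    case (Suc k')
    then have "\<not> 4 * n \<le> 2 ^ k'" using not_less_Least[of k' "\<lambda>k. 4 * n \<le> 2 ^ k"] k_def by simp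
    then show ?thesis using Suc by simp
  qed
  have k1r: "4 * real n \<le> 2 ^ k" and k2r: "2 ^ k \<le> 8 * real n"
  proof -
    have "real (4 * n) \<le> real (2 ^ k)" "real (2 ^ k) \<le> real (8 * n)" using k1 k2 by (simp_all only: of_nat_le_iff)
    then show "4 * real n \<le> 2 ^ k" "2 ^ k \<le> 8 * real n" by simp_all
  qed
  define h where "h = 2 * pi / (3 * 2 ^ k)"
  have h0: "h > 0" unfolding h_def by simp
  have "h \<le> 2 * pi / (3 * (4 * real n))"
    unfolding h_def using k1r n by (intro divide_left_mono) auto
  also have "\<dots> \<le> 1 / real n" using n pi_less_4 by (simp add: field_simps)
  finally have hn: "h \<le> 1 / real n" .
  have low: "freq_ratio n i / 16 \<le> 2 * \<bar>sin (2 ^ i * h / 2)\<bar>" for i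
  proof (cases "k \<le> i")
    case True
    then have "(2::real) ^ i = 2 ^ (i - k) * 2 ^ k" by (simp add: power_add[symmetric])
    then have e: "2 ^ i * h / 2 = 2 ^ (i - k) * (pi / 3)" unfolding h_def by simp
    have c: "\<bar>cos (2 ^ i * h / 2)\<bar> = 1 / 2" unfolding e by (rule abs_cos_pow2_third)
    have "(sin (2 ^ i * h / 2))\<^sup>2 = 1 - \<bar>cos (2 ^ i * h / 2)\<bar>\<^sup>2" by (simp add: sin_squared_eq)
    also have "\<dots> \<ge> (1 / 2)\<^sup>2" unfolding c by (simp add: power2_eq_square)
    finally have "(1 / 2)\<^sup>2 \<le> \<bar>sin (2 ^ i * h / 2)\<bar>\<^sup>2" by simp
    then have "1 / 2 \<le> \<bar>sin (2 ^ i * h / 2)\<bar>" by (rule power2_le_imp_le) simp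
    moreover have "freq_ratio n i \<le> 1" by (simp add: freq_ratio_def)
    ultimately show ?thesis by linarith
  next
    case False
    then have le: "(2::real) ^ i \<le> 2 ^ k" by (intro power_increasing) auto
    define x where "x = 2 ^ i * h / 2"
    have x0: "x \<ge> 0" unfolding x_def using h0 by simp
    have x_eq: "x = pi / 3 * (2 ^ i / 2 ^ k)" unfolding x_def h_def by simp
    have "x \<le> pi / 3 * 1" unfolding x_eq using le by (intro mult_left_mono) auto
    then have "x / 2 \<le> sin x" using x0 by (intro half_le_sin) auto
    then have s: "x \<le> 2 * \<bar>sin x\<bar>" using x0 by linarith
    have "freq_ratio n i \<le> 2 ^ i / real n" by (simp add: freq_ratio_def)
    also have "\<dots> = 8 * (2 ^ i / (8 * real n))" by simp
    also have "\<dots> \<le> 8 * (2 ^ i / 2 ^ k)"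
      using k2r n by (intro mult_left_mono divide_left_mono) auto
    also have "\<dots> \<le> 16 * x"
      unfolding x_eq using pi_gt3 by (simp add: field_simps)
    finally have "freq_ratio n i \<le> 16 * x" .
    then show ?thesis using s unfolding x_def[symmetric] by linarith
  qed
  show ?thesis
  proof
    show "\<bar>h\<bar> \<le> 1 / real n" using h0 hn by simp
    fix \<alpha> :: real and i assume \<alpha>: "\<alpha> > 0"
    have f0: "freq_ratio n i > 0" using freq_ratio_pos[OF n] .
    have "freq_ratio n i powr \<alpha> \<le> (16 * (2 * \<bar>sin (2 ^ i * h / 2)\<bar>)) powr \<alpha>"
      using low[of i] f0 \<alpha> by (intro powr_mono2) auto
    also have "\<dots> = 16 powr \<alpha> * diff_mult \<alpha> h i"
      unfolding diff_mult_def by (rule powr_mult)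
    finally have "(freq_ratio n i powr \<alpha>)\<^sup>2 \<le> (16 powr \<alpha> * diff_mult \<alpha> h i)\<^sup>2"
      by (intro power_mono) auto
    then show "freq_ratio n i powr (2 * \<alpha>) \<le> (16 powr \<alpha>)\<^sup>2 * (diff_mult \<alpha> h i)\<^sup>2"
      by (simp only: power_mult_distrib powr_power2)
  qed
qed

section \<open>Comparison with the coefficients\<close>

text \<open>The mixed difference, whose norm is maximised in the mixed modulus of smoothness.\<close>

definition mixed_diff :: "real \<Rightarrow> real \<Rightarrow> real \<Rightarrow> real \<Rightarrow> (real \<times> real \<Rightarrow> real) \<Rightarrow> real \<times> real \<Rightarrow> real" where
  "mixed_diff \<alpha>1 \<alpha>2 h1 h2 f = frac_diff_x \<alpha>1 h1 (frac_diff_y \<alpha>2 h2 f)"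

lemma gbinomial_weights:
  fixes \<alpha> :: real
  assumes "\<alpha> > 0"
  shows "summable (\<lambda>\<nu>. \<bar>(- 1) ^ \<nu> * (\<alpha> gchoose \<nu>)\<bar>)" "(\<Sum>\<nu>. \<bar>(- 1) ^ \<nu> * (\<alpha> gchoose \<nu>)\<bar>) > 0"
proof -
  show s: "summable (\<lambda>\<nu>. \<bar>(- 1) ^ \<nu> * (\<alpha> gchoose \<nu>)\<bar>)"
    using summable_gbinomial_abs[OF assms] by (simp add: abs_mult)
  show "(\<Sum>\<nu>. \<bar>(- 1) ^ \<nu> * (\<alpha> gchoose \<nu>)\<bar>) > 0"
    by (rule suminf_pos2[OF s, of 0]) auto
qed

lemma mixed_diff_Lipschitz:
  assumes p: "p > 1" and \<alpha>: "\<alpha>1 > 0" "\<alpha>2 > 0"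
  shows "\<exists>W>0. \<forall>f\<in>Lp_torus p. \<forall>g\<in>Lp_torus p. \<forall>h1 h2. mixed_diff \<alpha>1 \<alpha>2 h1 h2 f \<in> Lp_torus p \<and>
     Lp_norm p (\<lambda>z. mixed_diff \<alpha>1 \<alpha>2 h1 h2 f z - mixed_diff \<alpha>1 \<alpha>2 h1 h2 g z) \<le> W * Lp_norm p (\<lambda>z. f z - g z)"
proof -
  define W1 where "W1 = (\<Sum>\<nu>. \<bar>(- 1) ^ \<nu> * (\<alpha>1 gchoose \<nu>)\<bar>)"
  define W2 where "W2 = (\<Sum>\<nu>. \<bar>(- 1) ^ \<nu> * (\<alpha>2 gchoose \<nu>)\<bar>)"
  have W: "W1 > 0" "W2 > 0" unfolding W1_def W2_def using gbinomial_weights(2) \<alpha> by auto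
  have e: "(1, 0) \<in> {(1, 0), (0, 1) :: real \<times> real}" "(0, 1) \<in> {(1, 0), (0, 1) :: real \<times> real}" by auto
  have y: "frac_diff_y \<alpha>2 h f \<in> Lp_torus p" if "f \<in> Lp_torus p" for h f
    unfolding frac_diff_y_eq by (rule shift_series_Lp(2)[OF p e(2) gbinomial_weights[OF \<alpha>(2)] that])
  have x: "frac_diff_x \<alpha>1 h f \<in> Lp_torus p" if "f \<in> Lp_torus p" for h f
    unfolding frac_diff_x_eq by (rule shift_series_Lp(2)[OF p e(1) gbinomial_weights[OF \<alpha>(1)] that])
  show ?thesis
  proof (intro exI[of _ "W1 * W2"] conjI ballI allI)
    show "W1 * W2 > 0" using W by simp
    fix f g h1 h2 assume f: "f \<in> Lp_torus p" and g: "g \<in> Lp_torus p"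
    show "mixed_diff \<alpha>1 \<alpha>2 h1 h2 f \<in> Lp_torus p" unfolding mixed_diff_def by (intro x y f)
    have "Lp_norm p (\<lambda>z. mixed_diff \<alpha>1 \<alpha>2 h1 h2 f z - mixed_diff \<alpha>1 \<alpha>2 h1 h2 g z) \<le>
       W1 * Lp_norm p (\<lambda>z. frac_diff_y \<alpha>2 h2 f z - frac_diff_y \<alpha>2 h2 g z)"
      unfolding mixed_diff_def frac_diff_x_eq W1_def
      by (rule shift_series_Lipschitz[OF p e(1) gbinomial_weights[OF \<alpha>(1)] y[OF f] y[OF g]])
    also have "\<dots> \<le> W1 * (W2 * Lp_norm p (\<lambda>z. f z - g z))"
      unfolding frac_diff_y_eq W2_def using W
      by (intro mult_left_mono shift_series_Lipschitz[OF p e(2) gbinomial_weights[OF \<alpha>(2)] f g]) auto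
    finally show "Lp_norm p (\<lambda>z. mixed_diff \<alpha>1 \<alpha>2 h1 h2 f z - mixed_diff \<alpha>1 \<alpha>2 h1 h2 g z) \<le> W1 * W2 * Lp_norm p (\<lambda>z. f z - g z)"
      by (simp add: mult.assoc)
  qed
qed

lemma mixed_diff_lacunary_poly:
  assumes "\<alpha>1 > 0" "\<alpha>2 > 0"
  obtains \<phi> \<psi> where "mixed_diff \<alpha>1 \<alpha>2 h1 h2 (cos_poly N c) =
    lacunary_poly N (\<lambda>i j. c i j * diff_mult \<alpha>2 h2 j * diff_mult \<alpha>1 h1 i) \<phi> \<psi>"
proof -
  obtain \<psi> where 1: "frac_diff_y \<alpha>2 h2 (cos_poly N c) = lacunary_poly N (\<lambda>i j. c i j * diff_mult \<alpha>2 h2 j) (\<lambda>_. 0) \<psi>"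
    by (rule frac_diff_y_lacunary_poly[OF assms(2)])
  obtain \<phi> where 2: "frac_diff_x \<alpha>1 h1 (lacunary_poly N (\<lambda>i j. c i j * diff_mult \<alpha>2 h2 j) (\<lambda>_. 0) \<psi>) =
     lacunary_poly N (\<lambda>i j. c i j * diff_mult \<alpha>2 h2 j * diff_mult \<alpha>1 h1 i) \<phi> \<psi>"
    by (rule frac_diff_x_lacunary_poly[OF assms(1)])
  show ?thesis by (rule that[of \<phi> \<psi>]) (simp add: mixed_diff_def 1 2)
qed

text \<open>The quantity with which both sides of the theorem are compared, restricted to indices below \<open>N\<close>.\<close>

definition smoothness_energy :: "real \<Rightarrow> real \<Rightarrow> nat \<Rightarrow> (nat \<Rightarrow> nat \<Rightarrow> real) \<Rightarrow> nat \<Rightarrow> nat \<Rightarrow> real" where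
  "smoothness_energy \<alpha>1 \<alpha>2 N c n1 n2 =
     (\<Sum>i<N. \<Sum>j<N. (c i j)\<^sup>2 * (freq_ratio n1 i powr (2 * \<alpha>1) * freq_ratio n2 j powr (2 * \<alpha>2)))"

lemma smoothness_energy_nonneg: "smoothness_energy \<alpha>1 \<alpha>2 N c n1 n2 \<ge> 0"
  unfolding smoothness_energy_def by (intro sum_nonneg) auto

lemma mixed_diff_norm_upper:
  assumes p: "p > 1" and \<alpha>: "\<alpha>1 > 0" "\<alpha>2 > 0"
  shows "\<exists>C>0. \<forall>f\<in>Lp_torus p. \<forall>c N n1 n2 h1 h2. n1 \<ge> 1 \<longrightarrow> n2 \<ge> 1 \<longrightarrow> \<bar>h1\<bar> \<le> 1 / real n1 \<longrightarrow> \<bar>h2\<bar> \<le> 1 / real n2 \<longrightarrow>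
    Lp_norm p (mixed_diff \<alpha>1 \<alpha>2 h1 h2 f) \<le>
      C * (sqrt (smoothness_energy \<alpha>1 \<alpha>2 N c n1 n2) + Lp_norm p (\<lambda>z. f z - cos_poly N c z))"
proof -
  have p0: "p > 0" using p by simp
  obtain W where W: "W > 0" "\<forall>f\<in>Lp_torus p. \<forall>g\<in>Lp_torus p. \<forall>h1 h2. mixed_diff \<alpha>1 \<alpha>2 h1 h2 f \<in> Lp_torus p \<and>
     Lp_norm p (\<lambda>z. mixed_diff \<alpha>1 \<alpha>2 h1 h2 f z - mixed_diff \<alpha>1 \<alpha>2 h1 h2 g z) \<le> W * Lp_norm p (\<lambda>z. f z - g z)"
    using mixed_diff_Lipschitz[OF p \<alpha>] by blast
  obtain C where C: "C > 0"
    "\<And>N c \<phi> \<psi>. Lp_norm p (lacunary_poly N c \<phi> \<psi>) \<le> C * sqrt (\<Sum>i<N. \<Sum>j<N. (c i j)\<^sup>2)"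
    using lacunary_Lp_upper[OF p0] by blast
  define K where "K = 2 powr \<alpha>1 * 2 powr \<alpha>2"
  have K0: "K > 0" unfolding K_def by simp
  show ?thesis
  proof (intro exI[of _ "4 * (C * K + W)"] conjI ballI allI impI)
    show "4 * (C * K + W) > 0" using C W K0 by (simp add: add_pos_pos)
    fix f and c :: "nat \<Rightarrow> nat \<Rightarrow> real" and N n1 n2 :: nat and h1 h2 :: real
    assume f: "f \<in> Lp_torus p" and n: "n1 \<ge> 1" "n2 \<ge> 1" and h: "\<bar>h1\<bar> \<le> 1 / real n1" "\<bar>h2\<bar> \<le> 1 / real n2"
    let ?S = "cos_poly N c"
    let ?D = "mixed_diff \<alpha>1 \<alpha>2 h1 h2"
    let ?H = "smoothness_energy \<alpha>1 \<alpha>2 N c n1 n2"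
    let ?E = "Lp_norm p (\<lambda>z. f z - ?S z)"
    have S: "?S \<in> Lp_torus p" by (rule lacunary_poly_Lp[OF p0])
    obtain \<phi> \<psi> where D: "?D ?S = lacunary_poly N (\<lambda>i j. c i j * diff_mult \<alpha>2 h2 j * diff_mult \<alpha>1 h1 i) \<phi> \<psi>"
      by (rule mixed_diff_lacunary_poly[OF \<alpha>])
    have "(\<Sum>i<N. \<Sum>j<N. (c i j * diff_mult \<alpha>2 h2 j * diff_mult \<alpha>1 h1 i)\<^sup>2) \<le> K\<^sup>2 * ?H"
      unfolding smoothness_energy_def sum_distrib_left
    proof (intro sum_mono)
      fix i j
      have "(c i j * diff_mult \<alpha>2 h2 j * diff_mult \<alpha>1 h1 i)\<^sup>2 = (c i j)\<^sup>2 * ((diff_mult \<alpha>1 h1 i)\<^sup>2 * (diff_mult \<alpha>2 h2 j)\<^sup>2)"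
        by (simp add: power_mult_distrib)
      also have "\<dots> \<le> (c i j)\<^sup>2 * (((2 powr \<alpha>1)\<^sup>2 * freq_ratio n1 i powr (2 * \<alpha>1)) * ((2 powr \<alpha>2)\<^sup>2 * freq_ratio n2 j powr (2 * \<alpha>2)))"
        by (intro mult_left_mono mult_mono diff_mult_upper \<alpha> n h) auto
      finally show "(c i j * diff_mult \<alpha>2 h2 j * diff_mult \<alpha>1 h1 i)\<^sup>2 \<le> K\<^sup>2 * ((c i j)\<^sup>2 * (freq_ratio n1 i powr (2 * \<alpha>1) * freq_ratio n2 j powr (2 * \<alpha>2)))"
        by (simp add: K_def power_mult_distrib mult_ac)
    qed
    then have "sqrt (\<Sum>i<N. \<Sum>j<N. (c i j * diff_mult \<alpha>2 h2 j * diff_mult \<alpha>1 h1 i)\<^sup>2) \<le> sqrt (K\<^sup>2 * ?H)"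
      by (rule real_sqrt_le_mono)
    also have "\<dots> = K * sqrt ?H" using K0 by (simp add: real_sqrt_mult)
    finally have "Lp_norm p (?D ?S) \<le> C * (K * sqrt ?H)"
      unfolding D using C(1) by (intro order_trans[OF C(2)] mult_left_mono) auto
    moreover have "Lp_norm p (\<lambda>z. ?D f z - ?D ?S z) \<le> W * ?E" using W(2) f S by blast
    ultimately have "4 * (Lp_norm p (?D ?S) + Lp_norm p (\<lambda>z. ?D f z - ?D ?S z)) \<le> 4 * (C * (K * sqrt ?H) + W * ?E)"
      by (intro mult_left_mono add_mono) simp_all
    moreover have "Lp_norm p (?D f) \<le> 4 * (Lp_norm p (?D ?S) + Lp_norm p (\<lambda>z. ?D f z - ?D ?S z))"
      using W(2) f S p by (intro Lp_norm_le_diff) blast+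
    ultimately have "Lp_norm p (?D f) \<le> 4 * (C * (K * sqrt ?H) + W * ?E)" by (rule order_trans[rotated])
    also have "\<dots> \<le> 4 * (C * K + W) * (sqrt ?H + ?E)"
    proof -
      have "C * K * ?E \<ge> 0" "W * sqrt ?H \<ge> 0" using C(1) W(1) K0 smoothness_energy_nonneg by auto
      then show ?thesis by (simp add: algebra_simps)
    qed
    finally show "Lp_norm p (?D f) \<le> 4 * (C * K + W) * (sqrt ?H + ?E)" .
  qed
qed

lemma mixed_diff_norm_lower:
  assumes p: "p > 1" and \<alpha>: "\<alpha>1 > 0" "\<alpha>2 > 0"
  shows "\<exists>C>0. \<forall>n1 n2. n1 \<ge> 1 \<longrightarrow> n2 \<ge> 1 \<longrightarrow> (\<exists>h1 h2. \<bar>h1\<bar> \<le> 1 / real n1 \<and> \<bar>h2\<bar> \<le> 1 / real n2 \<and>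
    (\<forall>f\<in>Lp_torus p. \<forall>c N. sqrt (smoothness_energy \<alpha>1 \<alpha>2 N c n1 n2) \<le>
      C * (Lp_norm p (mixed_diff \<alpha>1 \<alpha>2 h1 h2 f) + Lp_norm p (\<lambda>z. f z - cos_poly N c z))))"
proof -
  have p0: "p > 0" using p by simp
  obtain W where W: "W > 0" "\<forall>f\<in>Lp_torus p. \<forall>g\<in>Lp_torus p. \<forall>h1 h2. mixed_diff \<alpha>1 \<alpha>2 h1 h2 f \<in> Lp_torus p \<and>
     Lp_norm p (\<lambda>z. mixed_diff \<alpha>1 \<alpha>2 h1 h2 f z - mixed_diff \<alpha>1 \<alpha>2 h1 h2 g z) \<le> W * Lp_norm p (\<lambda>z. f z - g z)"
    using mixed_diff_Lipschitz[OF p \<alpha>] by blast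
  obtain C where C: "C > 0"
    "\<And>N c \<phi> \<psi>. sqrt (\<Sum>i<N. \<Sum>j<N. (c i j)\<^sup>2) \<le> C * Lp_norm p (lacunary_poly N c \<phi> \<psi>)"
    using lacunary_Lp_lower[OF p] by blast
  define K where "K = 16 powr \<alpha>1 * 16 powr \<alpha>2"
  have K0: "K > 0" unfolding K_def by simp
  show ?thesis
  proof (rule exI[of _ "4 * K * C * (1 + W)"], intro conjI allI impI)
    show "4 * K * C * (1 + W) > 0" using C W K0 by simp
    fix n1 n2 :: nat assume n: "n1 \<ge> 1" "n2 \<ge> 1"
    obtain h1 where h1: "\<bar>h1\<bar> \<le> 1 / real n1"
      "\<And>\<alpha> i. \<alpha> > 0 \<Longrightarrow> freq_ratio n1 i powr (2 * \<alpha>) \<le> (16 powr \<alpha>)\<^sup>2 * (diff_mult \<alpha> h1 i)\<^sup>2"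
      by (rule diff_mult_lower[OF n(1)]) blast
    obtain h2 where h2: "\<bar>h2\<bar> \<le> 1 / real n2"
      "\<And>\<alpha> i. \<alpha> > 0 \<Longrightarrow> freq_ratio n2 i powr (2 * \<alpha>) \<le> (16 powr \<alpha>)\<^sup>2 * (diff_mult \<alpha> h2 i)\<^sup>2"
      by (rule diff_mult_lower[OF n(2)]) blast
    let ?D = "mixed_diff \<alpha>1 \<alpha>2 h1 h2"
    have "sqrt (smoothness_energy \<alpha>1 \<alpha>2 N c n1 n2) \<le>
      4 * K * C * (1 + W) * (Lp_norm p (?D f) + Lp_norm p (\<lambda>z. f z - cos_poly N c z))"
      if f: "f \<in> Lp_torus p" for f c N
    proof -
      let ?S = "cos_poly N c"
      let ?H = "smoothness_energy \<alpha>1 \<alpha>2 N c n1 n2"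
      let ?E = "Lp_norm p (\<lambda>z. f z - ?S z)"
      let ?d = "\<lambda>i j. c i j * diff_mult \<alpha>2 h2 j * diff_mult \<alpha>1 h1 i"
      have S: "?S \<in> Lp_torus p" by (rule lacunary_poly_Lp[OF p0])
      obtain \<phi> \<psi> where D: "?D ?S = lacunary_poly N ?d \<phi> \<psi>"
        by (rule mixed_diff_lacunary_poly[OF \<alpha>])
      have "?H \<le> K\<^sup>2 * (\<Sum>i<N. \<Sum>j<N. (?d i j)\<^sup>2)"
        unfolding smoothness_energy_def sum_distrib_left
      proof (intro sum_mono)
        fix i j
        have "(c i j)\<^sup>2 * (freq_ratio n1 i powr (2 * \<alpha>1) * freq_ratio n2 j powr (2 * \<alpha>2)) \<le>
           (c i j)\<^sup>2 * (((16 powr \<alpha>1)\<^sup>2 * (diff_mult \<alpha>1 h1 i)\<^sup>2) * ((16 powr \<alpha>2)\<^sup>2 * (diff_mult \<alpha>2 h2 j)\<^sup>2))"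
          by (intro mult_left_mono mult_mono h1(2) h2(2) \<alpha>) auto
        then show "(c i j)\<^sup>2 * (freq_ratio n1 i powr (2 * \<alpha>1) * freq_ratio n2 j powr (2 * \<alpha>2)) \<le> K\<^sup>2 * (?d i j)\<^sup>2"
          by (simp add: K_def power_mult_distrib mult_ac)
      qed
      then have "sqrt ?H \<le> sqrt (K\<^sup>2 * (\<Sum>i<N. \<Sum>j<N. (?d i j)\<^sup>2))" by (rule real_sqrt_le_mono)
      also have "\<dots> = K * sqrt (\<Sum>i<N. \<Sum>j<N. (?d i j)\<^sup>2)" using K0 by (simp add: real_sqrt_mult)
      also have "\<dots> \<le> K * (C * Lp_norm p (?D ?S))"
        unfolding D using K0 by (intro mult_left_mono C(2)) auto
      also have "\<dots> \<le> K * (C * (4 * (Lp_norm p (?D f) + W * ?E)))"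
      proof -
        have "Lp_norm p (?D ?S) \<le> 4 * (Lp_norm p (?D f) + Lp_norm p (\<lambda>z. ?D ?S z - ?D f z))"
          using W(2) f S p by (intro Lp_norm_le_diff) blast+
        also have "(\<lambda>z. ?D ?S z - ?D f z) = (\<lambda>z. - (?D f z - ?D ?S z))" by simp
        also have "Lp_norm p \<dots> = Lp_norm p (\<lambda>z. ?D f z - ?D ?S z)" by (rule Lp_norm_uminus)
        also have "\<dots> \<le> W * ?E" using W(2) f S by blast
        finally show ?thesis using K0 C(1) by (intro mult_left_mono) auto
      qed
      also have "\<dots> = 4 * K * C * (Lp_norm p (?D f) + W * ?E)" by simp
      also have "\<dots> \<le> 4 * K * C * ((1 + W) * (Lp_norm p (?D f) + ?E))"
      proof (rule mult_left_mono)
        have "W * Lp_norm p (?D f) \<ge> 0" using W(1) by simp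
        then show "Lp_norm p (?D f) + W * ?E \<le> (1 + W) * (Lp_norm p (?D f) + ?E)"
          using Lp_norm_nonneg[of p "\<lambda>z. f z - ?S z"] by (simp add: algebra_simps)
      qed (use K0 C(1) in auto)
      finally show ?thesis by (simp add: mult.assoc)
    qed
    then show "\<exists>h1 h2. \<bar>h1\<bar> \<le> 1 / real n1 \<and> \<bar>h2\<bar> \<le> 1 / real n2 \<and>
      (\<forall>f\<in>Lp_torus p. \<forall>c N. sqrt (smoothness_energy \<alpha>1 \<alpha>2 N c n1 n2) \<le>
      4 * K * C * (1 + W) * (Lp_norm p (mixed_diff \<alpha>1 \<alpha>2 h1 h2 f) + Lp_norm p (\<lambda>z. f z - cos_poly N c z)))"
      using h1(1) h2(1) by blast
  qed
qed

text \<open>The double sum of the theorem, for a general array \<open>a\<close> in place of the squares of the best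
  approximations.\<close>

definition angular_sum :: "real \<Rightarrow> real \<Rightarrow> (nat \<Rightarrow> nat \<Rightarrow> real) \<Rightarrow> nat \<Rightarrow> nat \<Rightarrow> real" where
  "angular_sum \<alpha>1 \<alpha>2 a n1 n2 = (\<Sum>\<nu>1 = 1..n1 + 1. \<Sum>\<nu>2 = 1..n2 + 1.
     real \<nu>1 powr (2 * \<alpha>1 - 1) * real \<nu>2 powr (2 * \<alpha>2 - 1) * a (\<nu>1 - 1) (\<nu>2 - 1))"

lemma angular_sum_mono:
  assumes "\<And>i j. a i j \<le> b i j"
  shows "angular_sum \<alpha>1 \<alpha>2 a n1 n2 \<le> angular_sum \<alpha>1 \<alpha>2 b n1 n2"
  unfolding angular_sum_def by (intro sum_mono mult_left_mono assms) auto

lemma angular_sum_cmult: "angular_sum \<alpha>1 \<alpha>2 (\<lambda>i j. r * a i j) n1 n2 = r * angular_sum \<alpha>1 \<alpha>2 a n1 n2"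
  unfolding angular_sum_def sum_distrib_left by (intro sum.cong refl) (simp only: mult_ac)

lemma angular_sum_add: "angular_sum \<alpha>1 \<alpha>2 (\<lambda>i j. a i j + b i j) n1 n2 = angular_sum \<alpha>1 \<alpha>2 a n1 n2 + angular_sum \<alpha>1 \<alpha>2 b n1 n2"
  unfolding angular_sum_def by (simp add: distrib_left sum.distrib)

lemma angular_sum_nonneg: "(\<And>i j. a i j \<ge> 0) \<Longrightarrow> angular_sum \<alpha>1 \<alpha>2 a n1 n2 \<ge> 0"
  unfolding angular_sum_def by (intro sum_nonneg mult_nonneg_nonneg) auto

text \<open>Interchanging the summations, every coefficient is counted with the product of its weights.\<close>

lemma angular_sum_tail_energy:
  "angular_sum \<alpha>1 \<alpha>2 (tail_energy N c) n1 n2 =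
     (\<Sum>i<N. \<Sum>j<N. (c i j)\<^sup>2 * (approx_weight \<alpha>1 n1 i * approx_weight \<alpha>2 n2 j))"
proof -
  let ?w1 = "\<lambda>\<nu>. real \<nu> powr (2 * \<alpha>1 - 1)" and ?w2 = "\<lambda>\<nu>. real \<nu> powr (2 * \<alpha>2 - 1)"
  let ?t = "\<lambda>\<nu>1 \<nu>2 i j. (c i j)\<^sup>2 * ((if \<nu>1 - 1 < 2 ^ i then ?w1 \<nu>1 else 0) * (if \<nu>2 - 1 < 2 ^ j then ?w2 \<nu>2 else 0))"
  have "angular_sum \<alpha>1 \<alpha>2 (tail_energy N c) n1 n2 =
     (\<Sum>\<nu>1 = 1..n1 + 1. \<Sum>\<nu>2 = 1..n2 + 1. \<Sum>i<N. \<Sum>j<N. ?t \<nu>1 \<nu>2 i j)"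
    unfolding angular_sum_def tail_energy_def sum_distrib_left by (intro sum.cong refl) auto
  also have "\<dots> = (\<Sum>\<nu>1 = 1..n1 + 1. \<Sum>i<N. \<Sum>\<nu>2 = 1..n2 + 1. \<Sum>j<N. ?t \<nu>1 \<nu>2 i j)"
    by (intro sum.cong refl sum.swap)
  also have "\<dots> = (\<Sum>i<N. \<Sum>\<nu>1 = 1..n1 + 1. \<Sum>\<nu>2 = 1..n2 + 1. \<Sum>j<N. ?t \<nu>1 \<nu>2 i j)"
    by (rule sum.swap)
  also have "\<dots> = (\<Sum>i<N. \<Sum>\<nu>1 = 1..n1 + 1. \<Sum>j<N. \<Sum>\<nu>2 = 1..n2 + 1. ?t \<nu>1 \<nu>2 i j)"
    by (intro sum.cong refl sum.swap)
  also have "\<dots> = (\<Sum>i<N. \<Sum>j<N. \<Sum>\<nu>1 = 1..n1 + 1. \<Sum>\<nu>2 = 1..n2 + 1. ?t \<nu>1 \<nu>2 i j)"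
    by (intro sum.cong refl sum.swap)
  also have "\<dots> = (\<Sum>i<N. \<Sum>j<N. (c i j)\<^sup>2 * (approx_weight \<alpha>1 n1 i * approx_weight \<alpha>2 n2 j))"
    unfolding approx_weight_def sum_product unfolding sum_distrib_left ..
  finally show ?thesis .
qed

lemma power2_sum_le: "(x + y)\<^sup>2 \<le> 2 * (x\<^sup>2 + y\<^sup>2)" for x y :: real
  using sum_squares_bound[of x y] by (simp add: power2_sum)

lemma approx_weight_nonneg: "approx_weight \<alpha> n i \<ge> 0"
  unfolding approx_weight_def by (intro sum_nonneg) auto

lemma smoothness_energy_asymp:
  assumes \<alpha>: "\<alpha>1 > 0" "\<alpha>2 > 0"
  shows "\<exists>C>0. \<forall>N c n1 n2. n1 \<ge> 1 \<longrightarrow> n2 \<ge> 1 \<longrightarrow>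
    sqrt (smoothness_energy \<alpha>1 \<alpha>2 N c n1 n2) \<le>
       C * (1 / real n1 powr \<alpha>1 * (1 / real n2 powr \<alpha>2) * sqrt (angular_sum \<alpha>1 \<alpha>2 (tail_energy N c) n1 n2)) \<and>
    1 / real n1 powr \<alpha>1 * (1 / real n2 powr \<alpha>2) * sqrt (angular_sum \<alpha>1 \<alpha>2 (tail_energy N c) n1 n2) \<le>
       C * sqrt (smoothness_energy \<alpha>1 \<alpha>2 N c n1 n2)"
proof -
  obtain a1 b1 where 1: "a1 > 0" "b1 > 0" "\<forall>n\<ge>1. \<forall>i.
     a1 * freq_ratio n i powr (2 * \<alpha>1) \<le> (1 / real n powr \<alpha>1)\<^sup>2 * approx_weight \<alpha>1 n i \<and>
     (1 / real n powr \<alpha>1)\<^sup>2 * approx_weight \<alpha>1 n i \<le> b1 * freq_ratio n i powr (2 * \<alpha>1)"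
    using approx_weight_asymp[OF \<alpha>(1)] by blast
  obtain a2 b2 where 2: "a2 > 0" "b2 > 0" "\<forall>n\<ge>1. \<forall>i.
     a2 * freq_ratio n i powr (2 * \<alpha>2) \<le> (1 / real n powr \<alpha>2)\<^sup>2 * approx_weight \<alpha>2 n i \<and>
     (1 / real n powr \<alpha>2)\<^sup>2 * approx_weight \<alpha>2 n i \<le> b2 * freq_ratio n i powr (2 * \<alpha>2)"
    using approx_weight_asymp[OF \<alpha>(2)] by blast
  have ab: "sqrt (a1 * a2) > 0" "sqrt (b1 * b2) > 0" using 1 2 by simp_all
  show ?thesis
  proof (intro exI[of _ "1 / sqrt (a1 * a2) + sqrt (b1 * b2)"] conjI[of "_ > 0"] allI impI)
    show "1 / sqrt (a1 * a2) + sqrt (b1 * b2) > 0" using ab by (simp add: add_pos_pos)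
    fix N n1 n2 :: nat and c :: "nat \<Rightarrow> nat \<Rightarrow> real"
    assume n: "n1 \<ge> 1" "n2 \<ge> 1"
    define k where "k = 1 / real n1 powr \<alpha>1 * (1 / real n2 powr \<alpha>2)"
    define S where "S = angular_sum \<alpha>1 \<alpha>2 (tail_energy N c) n1 n2"
    define H where "H = smoothness_energy \<alpha>1 \<alpha>2 N c n1 n2"
    let ?u = "\<lambda>i. (1 / real n1 powr \<alpha>1)\<^sup>2 * approx_weight \<alpha>1 n1 i"
    let ?v = "\<lambda>j. (1 / real n2 powr \<alpha>2)\<^sup>2 * approx_weight \<alpha>2 n2 j"
    have k0: "k \<ge> 0" unfolding k_def by simp
    have kS: "k\<^sup>2 * S = (\<Sum>i<N. \<Sum>j<N. (c i j)\<^sup>2 * (?u i * ?v j))"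
      unfolding S_def angular_sum_tail_energy k_def power_mult_distrib sum_distrib_left
      by (intro sum.cong refl) (simp only: mult_ac)
    have H0: "H \<ge> 0" unfolding H_def by (rule smoothness_energy_nonneg)
    have u: "a1 * freq_ratio n1 i powr (2 * \<alpha>1) \<le> ?u i" "?u i \<le> b1 * freq_ratio n1 i powr (2 * \<alpha>1)" "?u i \<ge> 0" for i
      using 1(3) n(1) by (auto simp: approx_weight_nonneg)
    have v: "a2 * freq_ratio n2 j powr (2 * \<alpha>2) \<le> ?v j" "?v j \<le> b2 * freq_ratio n2 j powr (2 * \<alpha>2)" "?v j \<ge> 0" for j
      using 2(3) n(2) by (auto simp: approx_weight_nonneg)
    have lo: "(a1 * a2) * H \<le> k\<^sup>2 * S"
      unfolding kS H_def smoothness_energy_def sum_distrib_left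
    proof (intro sum_mono)
      fix i j
      have "(c i j)\<^sup>2 * ((a1 * freq_ratio n1 i powr (2 * \<alpha>1)) * (a2 * freq_ratio n2 j powr (2 * \<alpha>2))) \<le> (c i j)\<^sup>2 * (?u i * ?v j)"
        using 2(1) by (intro mult_left_mono[OF mult_mono[OF u(1) v(1) u(3)]]) simp_all
      then show "a1 * a2 * ((c i j)\<^sup>2 * (freq_ratio n1 i powr (2 * \<alpha>1) * freq_ratio n2 j powr (2 * \<alpha>2))) \<le> (c i j)\<^sup>2 * (?u i * ?v j)"
        by (simp only: mult_ac)
    qed
    have hi: "k\<^sup>2 * S \<le> (b1 * b2) * H"
      unfolding kS H_def smoothness_energy_def sum_distrib_left
    proof (intro sum_mono)
      fix i j
      have "(c i j)\<^sup>2 * (?u i * ?v j) \<le> (c i j)\<^sup>2 * ((b1 * freq_ratio n1 i powr (2 * \<alpha>1)) * (b2 * freq_ratio n2 j powr (2 * \<alpha>2)))"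
        using 1(2) by (intro mult_left_mono[OF mult_mono[OF u(2) v(2) _ v(3)]]) simp_all
      then show "(c i j)\<^sup>2 * (?u i * ?v j) \<le> b1 * b2 * ((c i j)\<^sup>2 * (freq_ratio n1 i powr (2 * \<alpha>1) * freq_ratio n2 j powr (2 * \<alpha>2)))"
        by (simp only: mult_ac)
    qed
    have sk: "sqrt (k\<^sup>2 * S) = k * sqrt S" using k0 by (simp add: real_sqrt_mult)
    have "sqrt (a1 * a2) * sqrt H \<le> k * sqrt S"
      using real_sqrt_le_mono[OF lo] unfolding sk by (simp add: real_sqrt_mult)
    then have l: "sqrt H \<le> 1 / sqrt (a1 * a2) * (k * sqrt S)"
      using ab(1) by (simp add: pos_le_divide_eq mult.commute)
    have h: "k * sqrt S \<le> sqrt (b1 * b2) * sqrt H"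
      using real_sqrt_le_mono[OF hi] unfolding sk by (simp add: real_sqrt_mult)
    have S0: "S \<ge> 0" unfolding S_def by (intro angular_sum_nonneg tail_energy_nonneg)
    have "sqrt (b1 * b2) * (k * sqrt S) \<ge> 0" "1 / sqrt (a1 * a2) * sqrt H \<ge> 0"
      using ab k0 S0 H0 by (auto intro!: mult_nonneg_nonneg)
    then have "sqrt H \<le> (1 / sqrt (a1 * a2) + sqrt (b1 * b2)) * (k * sqrt S) \<and>
        k * sqrt S \<le> (1 / sqrt (a1 * a2) + sqrt (b1 * b2)) * sqrt H"
      using l h unfolding distrib_right by linarith
    then show "sqrt (smoothness_energy \<alpha>1 \<alpha>2 N c n1 n2) \<le>
       (1 / sqrt (a1 * a2) + sqrt (b1 * b2)) * (1 / real n1 powr \<alpha>1 * (1 / real n2 powr \<alpha>2) * sqrt (angular_sum \<alpha>1 \<alpha>2 (tail_energy N c) n1 n2)) \<and>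
      1 / real n1 powr \<alpha>1 * (1 / real n2 powr \<alpha>2) * sqrt (angular_sum \<alpha>1 \<alpha>2 (tail_energy N c) n1 n2) \<le>
       (1 / sqrt (a1 * a2) + sqrt (b1 * b2)) * sqrt (smoothness_energy \<alpha>1 \<alpha>2 N c n1 n2)"
      unfolding H_def S_def k_def .
  qed
qed

theorem theorem9p3:
  fixes p \<alpha>1 \<alpha>2 :: real
  assumes "1 < p" and "\<alpha>1 > 0" and "\<alpha>2 > 0"
  shows "\<exists>C > 0. \<forall>f \<in> Lambda_class p. \<forall>n1 n2 :: nat. n1 \<ge> 1 \<longrightarrow> n2 \<ge> 1 \<longrightarrow>
    (let A = mixed_modulus p \<alpha>1 \<alpha>2 f (1 / real n1) (1 / real n2);
         B = 1 / real n1 powr \<alpha>1 * (1 / real n2 powr \<alpha>2) *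
             sqrt (\<Sum>\<nu>1 = 1..n1 + 1. \<Sum>\<nu>2 = 1..n2 + 1.
               real \<nu>1 powr (2 * \<alpha>1 - 1) * real \<nu>2 powr (2 * \<alpha>2 - 1) *
               (angular_approx p (\<nu>1 - 1) (\<nu>2 - 1) f)\<^sup>2)
     in inverse C * B \<le> A \<and> A \<le> C * B)"
proof -
  note p = assms(1) and \<alpha> = assms(2,3)
  obtain CA where CA: "CA > 0" "\<forall>f\<in>Lp_torus p. \<forall>c N n1 n2 h1 h2. n1 \<ge> 1 \<longrightarrow> n2 \<ge> 1 \<longrightarrow> \<bar>h1\<bar> \<le> 1 / real n1 \<longrightarrow> \<bar>h2\<bar> \<le> 1 / real n2 \<longrightarrow>
    Lp_norm p (mixed_diff \<alpha>1 \<alpha>2 h1 h2 f) \<le>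
      CA * (sqrt (smoothness_energy \<alpha>1 \<alpha>2 N c n1 n2) + Lp_norm p (\<lambda>z. f z - cos_poly N c z))"
    using mixed_diff_norm_upper[OF p \<alpha>] by blast
  obtain CB where CB: "CB > 0" "\<forall>n1 n2. n1 \<ge> 1 \<longrightarrow> n2 \<ge> 1 \<longrightarrow> (\<exists>h1 h2. \<bar>h1\<bar> \<le> 1 / real n1 \<and> \<bar>h2\<bar> \<le> 1 / real n2 \<and>
    (\<forall>f\<in>Lp_torus p. \<forall>c N. sqrt (smoothness_energy \<alpha>1 \<alpha>2 N c n1 n2) \<le>
      CB * (Lp_norm p (mixed_diff \<alpha>1 \<alpha>2 h1 h2 f) + Lp_norm p (\<lambda>z. f z - cos_poly N c z))))"
    using mixed_diff_norm_lower[OF p \<alpha>] by blast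
  obtain CE where CE: "CE > 0" "\<forall>N c n1 n2. n1 \<ge> 1 \<longrightarrow> n2 \<ge> 1 \<longrightarrow>
    sqrt (smoothness_energy \<alpha>1 \<alpha>2 N c n1 n2) \<le>
       CE * (1 / real n1 powr \<alpha>1 * (1 / real n2 powr \<alpha>2) * sqrt (angular_sum \<alpha>1 \<alpha>2 (tail_energy N c) n1 n2)) \<and>
    1 / real n1 powr \<alpha>1 * (1 / real n2 powr \<alpha>2) * sqrt (angular_sum \<alpha>1 \<alpha>2 (tail_energy N c) n1 n2) \<le>
       CE * sqrt (smoothness_energy \<alpha>1 \<alpha>2 N c n1 n2)"
    using smoothness_energy_asymp[OF \<alpha>] by blast
  obtain CL where CL: "CL > 0"
    "\<And>f c N m1 m2. f \<in> Lp_torus p \<Longrightarrow> has_lacunary_coeffs f c \<Longrightarrow>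
       sqrt (tail_energy N c m1 m2) \<le> CL * angular_approx p m1 m2 f"
    by (rule angular_approx_lower[OF p]) blast
  obtain CU where CU: "CU > 0"
    "\<And>f c N m1 m2. f \<in> Lp_torus p \<Longrightarrow>
       angular_approx p m1 m2 f \<le> CU * (sqrt (tail_energy N c m1 m2) +
          Lp_norm p (\<lambda>z. f z - cos_poly N c z))"
    by (rule angular_approx_upper[OF p]) blast
  define C1 where "C1 = CA * (CE * CL)"
  define C2 where "C2 = sqrt 2 * CU * (CE * CB)"
  have C12: "C1 > 0" "C2 > 0" unfolding C1_def C2_def using CA(1) CB(1) CE(1) CL(1) CU(1) by auto
  have main: "B \<le> C2 * A \<and> A \<le> C1 * B \<and> A \<ge> 0 \<and> B \<ge> 0"
    if f: "f \<in> Lambda_class p" and n: "n1 \<ge> 1" "n2 \<ge> 1"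
      and A: "A = mixed_modulus p \<alpha>1 \<alpha>2 f (1 / real n1) (1 / real n2)"
      and B: "B = 1 / real n1 powr \<alpha>1 * (1 / real n2 powr \<alpha>2) *
         sqrt (angular_sum \<alpha>1 \<alpha>2 (\<lambda>i j. (angular_approx p i j f)\<^sup>2) n1 n2)"
    for f and n1 n2 :: nat and A B :: real
  proof -
    obtain c where fL: "f \<in> Lp_torus p" and c: "has_lacunary_coeffs f c"
      by (rule Lambda_class_coeffs[OF f p])
    \<comment> \<open>the truncation error, sent to \<open>0\<close> at the end of both estimates\<close>
    define E where "E N = Lp_norm p (\<lambda>z. f z - cos_poly N c z)" for N
    have E0: "E N \<ge> 0" for N unfolding E_def by simp
    have Elim: "E \<longlonglongrightarrow> 0" unfolding E_def by (rule lacunary_partial_sums_converge[OF p fL c])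
    define H where "H N = smoothness_energy \<alpha>1 \<alpha>2 N c n1 n2" for N
    define S where "S N = angular_sum \<alpha>1 \<alpha>2 (tail_energy N c) n1 n2" for N
    define k where "k = 1 / real n1 powr \<alpha>1 * (1 / real n2 powr \<alpha>2)"
    have k0: "k \<ge> 0" unfolding k_def by simp
    define T where "T = angular_sum \<alpha>1 \<alpha>2 (\<lambda>i j. (angular_approx p i j f)\<^sup>2) n1 n2"
    have T0: "T \<ge> 0" unfolding T_def by (rule angular_sum_nonneg) simp
    have S0: "S N \<ge> 0" for N unfolding S_def by (intro angular_sum_nonneg tail_energy_nonneg)
    have BT: "B = k * sqrt T" unfolding B T_def k_def ..
    have B0: "B \<ge> 0" unfolding BT using k0 T0 by simp
    have HS: "sqrt (H N) \<le> CE * (k * sqrt (S N))" "k * sqrt (S N) \<le> CE * sqrt (H N)" for N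
      using CE(2) n unfolding H_def S_def k_def by blast+
    \<comment> \<open>the energy is bounded by the right-hand side, uniformly in \<open>N\<close>\<close>
    have HB: "sqrt (H N) \<le> CE * CL * B" for N
    proof -
      have "S N \<le> angular_sum \<alpha>1 \<alpha>2 (\<lambda>i j. CL\<^sup>2 * (angular_approx p i j f)\<^sup>2) n1 n2"
        unfolding S_def
      proof (rule angular_sum_mono)
        fix i j
        have "(sqrt (tail_energy N c i j))\<^sup>2 \<le> (CL * angular_approx p i j f)\<^sup>2"
          by (intro power_mono CL(2) fL c) (simp add: tail_energy_nonneg)
        then show "tail_energy N c i j \<le> CL\<^sup>2 * (angular_approx p i j f)\<^sup>2"
          by (simp add: tail_energy_nonneg power_mult_distrib)
      qed
      also have "\<dots> = CL\<^sup>2 * T" unfolding T_def by (rule angular_sum_cmult)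
      finally have "sqrt (S N) \<le> sqrt (CL\<^sup>2 * T)" by (rule real_sqrt_le_mono)
      also have "\<dots> = CL * sqrt T" using CL(1) by (simp add: real_sqrt_mult)
      finally have "CE * (k * sqrt (S N)) \<le> CE * (k * (CL * sqrt T))"
        using CE(1) k0 by (intro mult_left_mono) auto
      also have "\<dots> = CE * CL * B" unfolding BT by simp
      finally show ?thesis using HS(1)[of N] by linarith
    qed
    have Dup: "Lp_norm p (mixed_diff \<alpha>1 \<alpha>2 h1 h2 f) \<le> C1 * B" if h: "\<bar>h1\<bar> \<le> 1 / real n1" "\<bar>h2\<bar> \<le> 1 / real n2" for h1 h2
    proof -
      have "Lp_norm p (mixed_diff \<alpha>1 \<alpha>2 h1 h2 f) \<le> CA * (CE * CL * B + E N)" for N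
      proof -
        have "Lp_norm p (mixed_diff \<alpha>1 \<alpha>2 h1 h2 f) \<le> CA * (sqrt (H N) + E N)"
          using CA(2) fL n h unfolding H_def E_def by blast
        also have "\<dots> \<le> CA * (CE * CL * B + E N)" using CA(1) HB[of N] by (intro mult_left_mono) auto
        finally show ?thesis .
      qed
      moreover have "(\<lambda>N. CA * (CE * CL * B + E N)) \<longlonglongrightarrow> CA * (CE * CL * B + 0)"
        by (intro tendsto_intros Elim)
      ultimately have "Lp_norm p (mixed_diff \<alpha>1 \<alpha>2 h1 h2 f) \<le> CA * (CE * CL * B + 0)"
        by (intro LIMSEQ_le_const) auto
      then show ?thesis unfolding C1_def by (simp add: mult.assoc)
    qed
    define R where "R = {(h1, h2). \<bar>h1\<bar> \<le> 1 / real n1 \<and> \<bar>h2\<bar> \<le> 1 / real n2}"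
    define g where "g = (\<lambda>(h1, h2). Lp_norm p (mixed_diff \<alpha>1 \<alpha>2 h1 h2 f))"
    have AR: "A = Sup (g ` R)"
      unfolding A mixed_modulus_def R_def g_def mixed_diff_def ..
    have gR: "g x \<le> C1 * B" if "x \<in> R" for x using that Dup unfolding R_def g_def by auto
    have R0: "(0, 0) \<in> R" unfolding R_def by simp
    have bdd: "bdd_above (g ` R)" by (rule bdd_aboveI2[of _ _ "C1 * B"]) (rule gR)
    have up: "A \<le> C1 * B" unfolding AR using R0 gR by (intro cSUP_least) auto
    have ge: "g x \<le> A" if "x \<in> R" for x unfolding AR by (rule cSUP_upper[OF that bdd])
    have A0: "A \<ge> 0" using ge[OF R0] unfolding g_def by (auto intro: order_trans[OF Lp_norm_nonneg])
    obtain h1 h2 where h: "\<bar>h1\<bar> \<le> 1 / real n1" "\<bar>h2\<bar> \<le> 1 / real n2"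
      "\<forall>f\<in>Lp_torus p. \<forall>c N. sqrt (smoothness_energy \<alpha>1 \<alpha>2 N c n1 n2) \<le>
      CB * (Lp_norm p (mixed_diff \<alpha>1 \<alpha>2 h1 h2 f) + Lp_norm p (\<lambda>z. f z - cos_poly N c z))"
      using CB(2) n by blast
    have "(h1, h2) \<in> R" using h unfolding R_def by simp
    then have DA: "Lp_norm p (mixed_diff \<alpha>1 \<alpha>2 h1 h2 f) \<le> A" using ge[of "(h1, h2)"] unfolding g_def by simp
    \<comment> \<open>the total weight, through which the truncation error enters; it depends on \<open>n1\<close> and \<open>n2\<close>, but the error tends to \<open>0\<close>\<close>
    define r where "r = angular_sum \<alpha>1 \<alpha>2 (\<lambda>_ _. 1) n1 n2"
    have r0: "r \<ge> 0" unfolding r_def by (rule angular_sum_nonneg) simp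
    have low: "B \<le> sqrt 2 * CU * (CE * (CB * (A + E N)) + k * sqrt r * E N)" for N
    proof -
      have HA: "sqrt (H N) \<le> CB * (A + E N)"
      proof -
        have "sqrt (H N) \<le> CB * (Lp_norm p (mixed_diff \<alpha>1 \<alpha>2 h1 h2 f) + E N)"
          using h(3) fL unfolding H_def E_def by blast
        also have "\<dots> \<le> CB * (A + E N)" using CB(1) DA by (intro mult_left_mono) auto
        finally show ?thesis .
      qed
      have "T \<le> angular_sum \<alpha>1 \<alpha>2 (\<lambda>i j. 2 * CU\<^sup>2 * (tail_energy N c i j + (E N)\<^sup>2 * 1)) n1 n2"
        unfolding T_def
      proof (rule angular_sum_mono)
        fix i j
        have "(angular_approx p i j f)\<^sup>2 \<le> (CU * (sqrt (tail_energy N c i j) + E N))\<^sup>2"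
          unfolding E_def by (intro power_mono CU(2) fL angular_approx_nonneg p)
        also have "\<dots> = CU\<^sup>2 * (sqrt (tail_energy N c i j) + E N)\<^sup>2" by (rule power_mult_distrib)
        also have "\<dots> \<le> CU\<^sup>2 * (2 * ((sqrt (tail_energy N c i j))\<^sup>2 + (E N)\<^sup>2))"
          by (intro mult_left_mono power2_sum_le) simp
        finally show "(angular_approx p i j f)\<^sup>2 \<le> 2 * CU\<^sup>2 * (tail_energy N c i j + (E N)\<^sup>2 * 1)"
          by (simp add: tail_energy_nonneg algebra_simps)
      qed
      also have "\<dots> = 2 * CU\<^sup>2 * (S N + (E N)\<^sup>2 * r)"
        unfolding S_def r_def angular_sum_cmult angular_sum_add ..
      finally have "sqrt T \<le> sqrt (2 * CU\<^sup>2 * (S N + (E N)\<^sup>2 * r))" by (rule real_sqrt_le_mono)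
      also have "\<dots> = sqrt 2 * CU * sqrt (S N + (E N)\<^sup>2 * r)" using CU(1) by (simp add: real_sqrt_mult)
      also have "\<dots> \<le> sqrt 2 * CU * (sqrt (S N) + sqrt ((E N)\<^sup>2 * r))"
        using CU(1) S0 r0 by (intro mult_left_mono sqrt_add_le_add_sqrt) auto
      also have "sqrt ((E N)\<^sup>2 * r) = sqrt r * E N" using E0 by (simp add: real_sqrt_mult mult.commute)
      finally have "B \<le> k * (sqrt 2 * CU * (sqrt (S N) + sqrt r * E N))"
        unfolding BT using k0 by (intro mult_left_mono)
      also have "\<dots> = sqrt 2 * CU * (k * sqrt (S N) + k * sqrt r * E N)" by (simp add: algebra_simps)
      also have "\<dots> \<le> sqrt 2 * CU * (CE * (CB * (A + E N)) + k * sqrt r * E N)"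
      proof (intro mult_left_mono add_right_mono)
        show "k * sqrt (S N) \<le> CE * (CB * (A + E N))"
          using HS(2)[of N] mult_left_mono[OF HA, of CE] CE(1) by linarith
      qed (use CU(1) in auto)
      finally show ?thesis .
    qed
    have "(\<lambda>N. sqrt 2 * CU * (CE * (CB * (A + E N)) + k * sqrt r * E N)) \<longlonglongrightarrow>
        sqrt 2 * CU * (CE * (CB * (A + 0)) + k * sqrt r * 0)"
      by (intro tendsto_intros Elim)
    then have "B \<le> sqrt 2 * CU * (CE * (CB * (A + 0)) + k * sqrt r * 0)"
      by (rule LIMSEQ_le_const) (use low in auto)
    then have "B \<le> C2 * A" unfolding C2_def by (simp add: mult.assoc)
    then show ?thesis using up A0 B0 by blast
  qed
  have fin: "inverse (C1 + C2) * B \<le> A \<and> A \<le> (C1 + C2) * B"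
    if "B \<le> C2 * A \<and> A \<le> C1 * B \<and> A \<ge> 0 \<and> B \<ge> 0" for A B
  proof
    have "C1 * A \<ge> 0" "C2 * B \<ge> 0" using C12 that by auto
    then have "B \<le> (C1 + C2) * A" "A \<le> (C1 + C2) * B"
      using that unfolding distrib_right by linarith+
    then show "inverse (C1 + C2) * B \<le> A" "A \<le> (C1 + C2) * B"
      using C12 by (auto simp: field_simps)
  qed
  show ?thesis
    unfolding Let_def
  proof (intro exI[of _ "C1 + C2"] conjI[of "_ > 0"] ballI allI impI)
    show "C1 + C2 > 0" using C12 by simp
  qed (rule fin, rule main, assumption+, rule refl, simp only: angular_sum_def)
qed

end
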